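(* Let $n \geq 3$ and let $M$ be a compact, connected surface (possibly with boundary) different from the sphere $S^2$ and the real projective plane $\mathbb{R}P^2$. If $H$ is a subgroup of $B_n(M)$ with $P_n(M) \subsetneq H \subset B_n(M)$, then $H$ is not bi-orderable.
   Context: For a surface $M$, $F_n(M)=\{(z_1,\dots,z_n)\in M^n : z_i\neq z_j \text{ for } i\neq j\}$ is the ordered configuration space and $C_n(M)=F_n(M)/S_n$ the unordered configuration space (quotient by permuting coordinates). The pure braid group is $P_n(M)=\pi_1(F_n(M))$ and the braid group is $B_n(M)=\pi_1(C_n(M))$; $P_n(M)$ is the kernel of the permutation homomorphism $B_n(M)\to S_n$ induced by the covering $F_n(M)\to C_n(M)$. A group is bi-orderable if it admits a strict total ordering $<$ such that $x<y$ implies $gx<gy$ and $xg<yg$ for all $x,y,g$. *)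

theory Defs
  imports "HOL-Analysis.Analysis" "HOL-Algebra.Group"
begin

lemma istopology_quotient:
  "istopology (\<lambda>U. U \<subseteq> f ` topspace X \<and> openin X {x \<in> topspace X. f x \<in> U})"
  unfolding istopology_def
proof (rule conjI; intro allI impI)
  fix S T assume S: "S \<subseteq> f ` topspace X \<and> openin X {x \<in> topspace X. f x \<in> S}"
    and T: "T \<subseteq> f ` topspace X \<and> openin X {x \<in> topspace X. f x \<in> T}"
  have "{x \<in> topspace X. f x \<in> S \<inter> T} =
        {x \<in> topspace X. f x \<in> S} \<inter> {x \<in> topspace X. f x \<in> T}" by auto
  then show "S \<inter> T \<subseteq> f ` topspace X \<and> openin X {x \<in> topspace X. f x \<in> S \<inter> T}"
    using S T by (simp add: openin_Int le_infI1)
next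
  fix K assume K: "\<forall>U\<in>K. U \<subseteq> f ` topspace X \<and> openin X {x \<in> topspace X. f x \<in> U}"
  have "{x \<in> topspace X. f x \<in> \<Union>K} = \<Union>((\<lambda>U. {x \<in> topspace X. f x \<in> U}) ` K)" by auto
  then show "\<Union>K \<subseteq> f ` topspace X \<and> openin X {x \<in> topspace X. f x \<in> \<Union>K}"
    using K by (auto intro!: openin_Union)
qed

definition quotient_topology :: "'a topology \<Rightarrow> ('a \<Rightarrow> 'b) \<Rightarrow> 'b topology" where
  "quotient_topology X f =
     topology (\<lambda>U. U \<subseteq> f ` topspace X \<and> openin X {x \<in> topspace X. f x \<in> U})"

definition closed_half_plane :: "(real \<times> real) set" where
  "closed_half_plane = {p. snd p \<ge> 0}"

definition surface_with_boundary :: "'a topology \<Rightarrow> bool" where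
  "surface_with_boundary X \<longleftrightarrow> Hausdorff_space X \<and> second_countable X \<and>
     (\<forall>x \<in> topspace X. \<exists>U V. openin X U \<and> x \<in> U \<and>
         openin (top_of_set closed_half_plane) V \<and>
         subtopology X U homeomorphic_space top_of_set V)"

definition sphere2 :: "(real^3) topology" where
  "sphere2 = top_of_set (sphere 0 1)"

definition real_projective_plane :: "(real^3) set topology" where
  "real_projective_plane = quotient_topology sphere2 (\<lambda>x. {x, -x})"

definition ordered_config :: "'a topology \<Rightarrow> nat \<Rightarrow> (nat \<Rightarrow> 'a) topology" where
  "ordered_config X n = subtopology (product_topology (\<lambda>_. X) {..<n})
                                    {z. inj_on z {..<n}}"

text \<open>Unordered configuration space C_n(M) = F_n(M)/S_n; a configuration is identified
  with its (n-element) set of points, which is exactly the S_n-orbit.\<close>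
definition unordered_config :: "'a topology \<Rightarrow> nat \<Rightarrow> 'a set topology" where
  "unordered_config X n = quotient_topology (ordered_config X n) (\<lambda>z. z ` {..<n})"

definition loopin :: "'a topology \<Rightarrow> 'a \<Rightarrow> (real \<Rightarrow> 'a) \<Rightarrow> bool" where
  "loopin X x0 g \<longleftrightarrow> pathin X g \<and> g 0 = x0 \<and> g 1 = x0"

definition loop_class :: "'a topology \<Rightarrow> 'a \<Rightarrow> (real \<Rightarrow> 'a) \<Rightarrow> (real \<Rightarrow> 'a) set" where
  "loop_class X x0 g = {h. loopin X x0 h \<and>
      homotopic_with (\<lambda>k. k 0 = x0 \<and> k 1 = x0) (top_of_set {0..1}) X g h}"

definition loop_join :: "(real \<Rightarrow> 'a) \<Rightarrow> (real \<Rightarrow> 'a) \<Rightarrow> real \<Rightarrow> 'a" where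
  "loop_join p q t = (if t \<le> 1/2 then p (2 * t) else q (2 * t - 1))"

definition fundamental_group :: "'a topology \<Rightarrow> 'a \<Rightarrow> (real \<Rightarrow> 'a) set monoid" where
  "fundamental_group X x0 =
     \<lparr> carrier = {loop_class X x0 g | g. loopin X x0 g},
       mult = (\<lambda>A B. loop_class X x0 (loop_join (SOME p. p \<in> A) (SOME q. q \<in> B))),
       one = loop_class X x0 (\<lambda>_. x0) \<rparr>"

definition braid_group :: "'a topology \<Rightarrow> nat \<Rightarrow> (nat \<Rightarrow> 'a) \<Rightarrow> (real \<Rightarrow> 'a set) set monoid" where
  "braid_group X n b = fundamental_group (unordered_config X n) (b ` {..<n})"

text \<open>P_n(M) = pi_1(F_n(M), b), viewed as a subgroup of B_n(M) via the covering map
  F_n(M) -> C_n(M) (which induces an injection on fundamental groups).\<close>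
definition pure_braid_subgroup :: "'a topology \<Rightarrow> nat \<Rightarrow> (nat \<Rightarrow> 'a) \<Rightarrow> (real \<Rightarrow> 'a set) set set" where
  "pure_braid_subgroup X n b =
     {loop_class (unordered_config X n) (b ` {..<n}) (\<lambda>t. g t ` {..<n}) | g.
        loopin (ordered_config X n) b g}"

definition biorderable :: "('g, 'b) monoid_scheme \<Rightarrow> bool" where
  "biorderable G \<longleftrightarrow> (\<exists>r :: 'g \<Rightarrow> 'g \<Rightarrow> bool.
      (\<forall>x \<in> carrier G. \<not> r x x) \<and>
      (\<forall>x \<in> carrier G. \<forall>y \<in> carrier G. \<forall>z \<in> carrier G. r x y \<longrightarrow> r y z \<longrightarrow> r x z) \<and>
      (\<forall>x \<in> carrier G. \<forall>y \<in> carrier G. x \<noteq> y \<longrightarrow> r x y \<or> r y x) \<and>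
      (\<forall>x \<in> carrier G. \<forall>y \<in> carrier G. \<forall>g \<in> carrier G. r x y \<longrightarrow>
          r (g \<otimes>\<^bsub>G\<^esub> x) (g \<otimes>\<^bsub>G\<^esub> y) \<and> r (x \<otimes>\<^bsub>G\<^esub> g) (y \<otimes>\<^bsub>G\<^esub> g)))"

end

theory Submission
  imports Defs "HOL-Combinatorics.Cycles"
begin

text \<open>Suppose \<open>H\<close> is bi-ordered. An element of \<open>H\<close> outside \<open>P\<^sub>n\<close> induces a nontrivial permutation \<open>p\<close>, and since
  \<open>P\<^sub>n \<subseteq> H\<close>, every braid with permutation \<open>p\<close> lies in \<open>H\<close>. One such braid is the rotation \<open>x\<close> of points placed in a
  chart on circles around the origin, one circle for each cycle of \<open>p\<close>. Let \<open>y\<close> be the pure braid in which a point \<open>d j\<close>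
  runs around a nearby point \<open>d l\<close>. Some power of \<open>x\<close> consists of full turns and commutes with \<open>y\<close>; in a bi-ordered group
  \<open>x\<close> itself then commutes with \<open>y\<close>. Hence \<open>y\<close> equals its conjugate by \<open>x\<close>, where the strand \<open>p j\<close> runs around \<open>p l\<close>.

  Contracting the latter loop while allowing \<open>p j\<close> to hit \<open>p l\<close> gives a family of configurations over a disc, which
  trivializes over the strand \<open>l\<close> (and one further strand outside \<open>{j, p j, l, p l}\<close>, if there is one). Thus the
  loop of \<open>j\<close> around \<open>l\<close> is null-homotopic in \<open>M\<close> minus the remaining base points. With two base points this
  contradicts winding numbers. With one base point it makes the double rotation trivial, as in \<open>SU(2)\<close>, so that a power
  of \<open>x\<close> is trivial; then \<open>x = 1\<close> because bi-ordered groups are torsion free, although \<open>x\<close> induces \<open>p\<close>.\<close>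

section \<open>Path homotopy\<close>

text \<open>The choice of \<open>j\<close> and \<open>l\<close> carries the argument:
  \<open>l\<close> is moved by \<open>p\<close> and differs from \<open>j\<close> and
  \<open>p j\<close>. In \<open>y\<close> the strand \<open>j\<close> runs around \<open>l\<close>,
  whereas in the conjugate the moving and the encircled strand are \<open>p j\<close> and
  \<open>p l\<close>, so contracting that loop never touches \<open>l\<close>. Over the whole disc
  the strand \<open>l\<close> is disjoint from all others, although the boundary of the disc shows
  the loop around it.

  A relation between braids moves all points at once. To extract one loop, the strand
  \<open>l\<close> must be held still, by isotopies that drag points along. These are built in
  planar charts, so all strands are first pushed into the interior. Over the boundary circle the
  isotopies may still twist loops; comparison with a second strand that is at rest there removes the
  twist.

  As \<open>p\<close> is arbitrary, its cycles rotate at different speeds; different radii keep them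
  apart.

  With one base point left, winding numbers give no contradiction, since the loop may contract on
  the far side of the surface. The null-homotopy then serves as a cap that closes the chart up to
  the image of a sphere.\<close>

lemma continuous_map_compose_on:
  assumes "continuous_map (top_of_set B) X f" "continuous_on A g" "\<And>x. x \<in> A \<Longrightarrow> g x \<in> B"
  shows "continuous_map (top_of_set A) X (\<lambda>x. f (g x))"
proof -
  have "continuous_map (top_of_set A) (top_of_set B) g"
    using assms by auto
  from continuous_map_compose[OF this assms(1)] show ?thesis by (simp add: o_def)
qed

lemma continuous_map_top_of_set_cases_le:
  fixes A :: "'b::topological_space set" and p q :: "'b \<Rightarrow> real"
  assumes "continuous_on A p" "continuous_on A q"
    and "continuous_map (top_of_set {x \<in> A. p x \<le> q x}) X f"
    and "continuous_map (top_of_set {x \<in> A. q x \<le> p x}) X g"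
    and "\<And>x. x \<in> A \<Longrightarrow> p x = q x \<Longrightarrow> f x = g x"
  shows "continuous_map (top_of_set A) X (\<lambda>x. if p x \<le> q x then f x else g x)"
proof (rule continuous_map_cases_le)
  have "A \<inter> {x \<in> A. p x \<le> q x} = {x \<in> A. p x \<le> q x}" "A \<inter> {x \<in> A. q x \<le> p x} = {x \<in> A. q x \<le> p x}"
    by auto
  then show "continuous_map (subtopology (top_of_set A) {x \<in> topspace (top_of_set A). p x \<le> q x}) X f"
    and "continuous_map (subtopology (top_of_set A) {x \<in> topspace (top_of_set A). q x \<le> p x}) X g"
    using assms(3,4) by (simp_all add: subtopology_subtopology)
qed (use assms in auto)

lemma continuous_map_eq_on:
  "continuous_map (top_of_set A) X f \<Longrightarrow> (\<And>x. x \<in> A \<Longrightarrow> f x = g x) \<Longrightarrow> continuous_map (top_of_set A) X g"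
  by (erule continuous_map_eq) simp

abbreviation unit_square :: "(real \<times> real) set" where
  "unit_square \<equiv> {0..1} \<times> {0..1}"

text \<open>The fixed ends are read off from \<open>p\<close>, so the relation also covers open
  paths, which occur as connections between base points. On loops it is the relation behind
  \<open>loop_class\<close>, by \<open>loop_class_eq_path_homotopic\<close>.\<close>

definition path_homotopic :: "'a topology \<Rightarrow> (real \<Rightarrow> 'a) \<Rightarrow> (real \<Rightarrow> 'a) \<Rightarrow> bool" where
  "path_homotopic X p q \<longleftrightarrow> (\<exists>S. continuous_map (top_of_set unit_square) X S \<and>
     (\<forall>t\<in>{0..1}. S (0, t) = p t \<and> S (1, t) = q t) \<and> (\<forall>s\<in>{0..1}. S (s, 0) = p 0 \<and> S (s, 1) = p 1))"

lemma path_homotopicI: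
  assumes "continuous_map (top_of_set unit_square) X S"
    and "\<And>t. t \<in> {0..1} \<Longrightarrow> S (0, t) = p t" "\<And>t. t \<in> {0..1} \<Longrightarrow> S (1, t) = q t"
    and "\<And>s. s \<in> {0..1} \<Longrightarrow> S (s, 0) = p 0" "\<And>s. s \<in> {0..1} \<Longrightarrow> S (s, 1) = p 1"
  shows "path_homotopic X p q"
  unfolding path_homotopic_def using assms by blast

lemma path_homotopicE:
  assumes "path_homotopic X p q"
  obtains S where "continuous_map (top_of_set unit_square) X S"
    "\<And>t. t \<in> {0..1} \<Longrightarrow> S (0, t) = p t \<and> S (1, t) = q t"
    "\<And>s. s \<in> {0..1} \<Longrightarrow> S (s, 0) = p 0 \<and> S (s, 1) = p 1"
  using assms unfolding path_homotopic_def by (elim exE conjE) (simp only: Ball_def)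

lemma path_homotopicD:
  assumes "path_homotopic X p q"
  shows "pathin X p" "pathin X q" "q 0 = p 0" "q 1 = p 1"
proof -
  obtain S where S: "continuous_map (top_of_set unit_square) X S"
    "\<And>t. t \<in> {0..1} \<Longrightarrow> S (0, t) = p t \<and> S (1, t) = q t"
    "\<And>s. s \<in> {0..1} \<Longrightarrow> S (s, 0) = p 0 \<and> S (s, 1) = p 1"
    by (rule path_homotopicE[OF assms]) (rule that)
  have 1: "continuous_map (top_of_set {0..1}) X (\<lambda>t. S (0, t))"
    and 2: "continuous_map (top_of_set {0..1}) X (\<lambda>t. S (1, t))"
    by (rule continuous_map_compose_on[OF S(1)]; force intro!: continuous_intros)+
  show "pathin X p" unfolding pathin_def by (rule continuous_map_eq_on[OF 1]) (use S(2) in auto)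
  show "pathin X q" unfolding pathin_def by (rule continuous_map_eq_on[OF 2]) (use S(2) in auto)
  show "q 0 = p 0" "q 1 = p 1"
    using S(2)[of 0] S(2)[of 1] S(3)[of 1] by auto
qed

text \<open>Straight-line homotopy inside the parameter domain \<open>C\<close>, followed by
  \<open>G\<close>. The group laws and the relations between rotation loops thereby reduce to pairs
  of reparametrizations of one map \<open>G\<close>.\<close>

lemma path_homotopic_convex:
  fixes C :: "'b::real_normed_vector set"
  assumes "continuous_map (top_of_set C) X G" "convex C"
    and "continuous_on {0..1} u" "continuous_on {0..1} v"
    and "\<And>t. t \<in> {0..1} \<Longrightarrow> u t \<in> C" "\<And>t. t \<in> {0..1} \<Longrightarrow> v t \<in> C"
    and "u 0 = v 0" "u 1 = v 1"
    and p: "\<And>t. t \<in> {0..1} \<Longrightarrow> p t = G (u t)" and q: "\<And>t. t \<in> {0..1} \<Longrightarrow> q t = G (v t)"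
  shows "path_homotopic X p q"
proof (rule path_homotopicI)
  let ?w = "\<lambda>x::real \<times> real. (1 - fst x) *\<^sub>R u (snd x) + fst x *\<^sub>R v (snd x)"
  show "continuous_map (top_of_set unit_square) X (\<lambda>x. G (?w x))"
  proof (rule continuous_map_compose_on[OF assms(1)])
    show "continuous_on unit_square ?w"
      by (intro continuous_intros continuous_on_compose2[OF assms(3)] continuous_on_compose2[OF assms(4)]) auto
    show "?w x \<in> C" if "x \<in> unit_square" for x
    proof -
      have "u (snd x) \<in> C" "v (snd x) \<in> C" "0 \<le> fst x" "fst x \<le> 1" using that assms(5,6) by auto
      then show ?thesis using convexD_alt[OF assms(2), of "u (snd x)" "v (snd x)" "fst x"] by blast
    qed
  qed
  have e: "u 0 = (1 - s) *\<^sub>R u 0 + s *\<^sub>R v 0" "u 1 = (1 - s) *\<^sub>R u 1 + s *\<^sub>R v 1" for s :: real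
    using assms(7,8) by (simp_all flip: scaleR_left_distrib)
  show "G (?w (s, 0)) = p 0" "G (?w (s, 1)) = p 1" if "s \<in> {0..1}" for s
    using p[of 0] p[of 1] e[of s] by simp_all
qed (use p q in auto)

lemma path_homotopic_eq:
  "pathin X p \<Longrightarrow> (\<And>t. t \<in> {0..1} \<Longrightarrow> q t = p t) \<Longrightarrow> path_homotopic X p q"
  unfolding pathin_def
  by (rule path_homotopic_convex[of "{0..1}" X p "\<lambda>t. t" "\<lambda>t. t"]) auto

lemma path_homotopic_refl: "pathin X p \<Longrightarrow> path_homotopic X p p"
  by (rule path_homotopic_eq) auto

lemma path_homotopic_sym:
  assumes "path_homotopic X p q"
  shows "path_homotopic X q p"
proof -
  obtain S where S: "continuous_map (top_of_set unit_square) X S"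
    "\<And>t. t \<in> {0..1} \<Longrightarrow> S (0, t) = p t \<and> S (1, t) = q t"
    "\<And>s. s \<in> {0..1} \<Longrightarrow> S (s, 0) = p 0 \<and> S (s, 1) = p 1"
    by (rule path_homotopicE[OF assms]) (rule that)
  show ?thesis
  proof (rule path_homotopicI)
    show "continuous_map (top_of_set unit_square) X (\<lambda>x. S (1 - fst x, snd x))"
      by (rule continuous_map_compose_on[OF S(1)]) (auto intro!: continuous_intros)
  qed (use S(2,3) path_homotopicD[OF assms] in auto)
qed

lemma path_homotopic_trans [trans]:
  assumes "path_homotopic X p q" "path_homotopic X q r"
  shows "path_homotopic X p r"
proof -
  obtain S where S: "continuous_map (top_of_set unit_square) X S"
    "\<And>t. t \<in> {0..1} \<Longrightarrow> S (0, t) = p t \<and> S (1, t) = q t"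
    "\<And>s. s \<in> {0..1} \<Longrightarrow> S (s, 0) = p 0 \<and> S (s, 1) = p 1"
    by (rule path_homotopicE[OF assms(1)]) (rule that)
  obtain T where T: "continuous_map (top_of_set unit_square) X T"
    "\<And>t. t \<in> {0..1} \<Longrightarrow> T (0, t) = q t \<and> T (1, t) = r t"
    "\<And>s. s \<in> {0..1} \<Longrightarrow> T (s, 0) = q 0 \<and> T (s, 1) = q 1"
    by (rule path_homotopicE[OF assms(2)]) (rule that)
  show ?thesis
  proof (rule path_homotopicI)
    show "continuous_map (top_of_set unit_square) X
       (\<lambda>x. if fst x \<le> 1/2 then S (2 * fst x, snd x) else T (2 * fst x - 1, snd x))"
    proof (rule continuous_map_top_of_set_cases_le)
      show "continuous_map (top_of_set {x \<in> unit_square. fst x \<le> 1/2}) X (\<lambda>x. S (2 * fst x, snd x))"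
        by (rule continuous_map_compose_on[OF S(1)]) (auto intro!: continuous_intros)
      show "continuous_map (top_of_set {x \<in> unit_square. 1/2 \<le> fst x}) X (\<lambda>x. T (2 * fst x - 1, snd x))"
        by (rule continuous_map_compose_on[OF T(1)]) (auto intro!: continuous_intros)
      show "S (2 * fst x, snd x) = T (2 * fst x - 1, snd x)" if "x \<in> unit_square" "fst x = 1/2" for x
      proof -
        have e: "2 * fst x = 1" using that(2) by simp
        show ?thesis unfolding e using that(1) S(2)[of "snd x"] T(2)[of "snd x"] by (auto simp: mem_Times_iff)
      qed
    qed (auto intro!: continuous_intros)
  qed (use S(2,3) T(2,3) path_homotopicD[OF assms(1)] in auto)
qed

lemma path_homotopic_compose:
  assumes "path_homotopic X p q" "continuous_map X Y f"
  shows "path_homotopic Y (\<lambda>t. f (p t)) (\<lambda>t. f (q t))"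
proof -
  obtain S where S: "continuous_map (top_of_set unit_square) X S"
    "\<And>t. t \<in> {0..1} \<Longrightarrow> S (0, t) = p t \<and> S (1, t) = q t"
    "\<And>s. s \<in> {0..1} \<Longrightarrow> S (s, 0) = p 0 \<and> S (s, 1) = p 1"
    by (rule path_homotopicE[OF assms(1)]) (rule that)
  show ?thesis
    by (rule path_homotopicI[where S = "\<lambda>x. f (S x)"])
      (use S(2,3) continuous_map_compose[OF S(1) assms(2)] in \<open>auto simp: o_def\<close>)
qed

lemma pathin_loop_join:
  assumes "pathin X p" "pathin X q" "p 1 = q 0"
  shows "pathin X (loop_join p q)"
proof -
  have "continuous_map (top_of_set {0..1}) X (\<lambda>t::real. if t \<le> 1/2 then p (2 * t) else q (2 * t - 1))"
  proof (rule continuous_map_top_of_set_cases_le)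
    show "continuous_map (top_of_set {t \<in> {0..1}. t \<le> 1/2}) X (\<lambda>t. p (2 * t))"
      by (rule continuous_map_compose_on[OF assms(1)[unfolded pathin_def]]) (auto intro!: continuous_intros)
    show "continuous_map (top_of_set {t \<in> {0..1}. 1/2 \<le> t}) X (\<lambda>t. q (2 * t - 1))"
      by (rule continuous_map_compose_on[OF assms(2)[unfolded pathin_def]]) (auto intro!: continuous_intros)
    show "p (2 * t) = q (2 * t - 1)" if "t \<in> {0..1}" "t = 1/2" for t
    proof -
      have e: "2 * t = 1" using that(2) by simp
      show ?thesis unfolding e using assms(3) by simp
    qed
  qed (auto intro!: continuous_intros)
  then show ?thesis unfolding pathin_def loop_join_def[abs_def] by simp
qed

lemma loop_join_ends [simp]: "loop_join p q 0 = p 0" "loop_join p q 1 = q 1"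
  by (simp_all add: loop_join_def)

lemma path_homotopic_loop_join:
  assumes "path_homotopic X p p'" "path_homotopic X q q'" "p 1 = q 0"
  shows "path_homotopic X (loop_join p q) (loop_join p' q')"
proof -
  obtain S where S: "continuous_map (top_of_set unit_square) X S"
    "\<And>t. t \<in> {0..1} \<Longrightarrow> S (0, t) = p t \<and> S (1, t) = p' t"
    "\<And>s. s \<in> {0..1} \<Longrightarrow> S (s, 0) = p 0 \<and> S (s, 1) = p 1"
    by (rule path_homotopicE[OF assms(1)]) (rule that)
  obtain T where T: "continuous_map (top_of_set unit_square) X T"
    "\<And>t. t \<in> {0..1} \<Longrightarrow> T (0, t) = q t \<and> T (1, t) = q' t"
    "\<And>s. s \<in> {0..1} \<Longrightarrow> T (s, 0) = q 0 \<and> T (s, 1) = q 1"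
    by (rule path_homotopicE[OF assms(2)]) (rule that)
  show ?thesis
  proof (rule path_homotopicI)
    show "continuous_map (top_of_set unit_square) X
       (\<lambda>x. if snd x \<le> 1/2 then S (fst x, 2 * snd x) else T (fst x, 2 * snd x - 1))"
    proof (rule continuous_map_top_of_set_cases_le)
      show "continuous_map (top_of_set {x \<in> unit_square. snd x \<le> 1/2}) X (\<lambda>x. S (fst x, 2 * snd x))"
        by (rule continuous_map_compose_on[OF S(1)]) (auto intro!: continuous_intros)
      show "continuous_map (top_of_set {x \<in> unit_square. 1/2 \<le> snd x}) X (\<lambda>x. T (fst x, 2 * snd x - 1))"
        by (rule continuous_map_compose_on[OF T(1)]) (auto intro!: continuous_intros)
      show "S (fst x, 2 * snd x) = T (fst x, 2 * snd x - 1)" if "x \<in> unit_square" "snd x = 1/2" for x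
      proof -
        have e: "2 * snd x = 1" using that(2) by simp
        show ?thesis unfolding e using that(1) S(3)[of "fst x"] T(3)[of "fst x"] assms(3) by (auto simp: mem_Times_iff)
      qed
    qed (auto intro!: continuous_intros)
  qed (use S(2,3) T(2,3) in \<open>auto simp: loop_join_def\<close>)
qed

lemma path_homotopic_assoc:
  assumes "pathin X p" "pathin X q" "pathin X r" "p 1 = q 0" "q 1 = r 0"
  shows "path_homotopic X (loop_join (loop_join p q) r) (loop_join p (loop_join q r))"
proof -
  define G where "G u = (if u \<le> 1 then p u else if u \<le> 2 then q (u - 1) else r (u - 2))" for u :: real
  have "continuous_map (top_of_set {0..3}) X G"
    unfolding G_def
  proof (rule continuous_map_top_of_set_cases_le)
    show "continuous_map (top_of_set {x \<in> {0..3}. x \<le> 1}) X p"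
      by (rule continuous_map_compose_on[OF assms(1)[unfolded pathin_def], where g = "\<lambda>x. x"]) auto
    show "continuous_map (top_of_set {x \<in> {0..3}. 1 \<le> x}) X (\<lambda>u. if u \<le> 2 then q (u - 1) else r (u - 2))"
    proof (rule continuous_map_top_of_set_cases_le)
      show "continuous_map (top_of_set {x \<in> {x \<in> {0..3}. 1 \<le> x}. x \<le> 2}) X (\<lambda>u. q (u - 1))"
        by (rule continuous_map_compose_on[OF assms(2)[unfolded pathin_def]]) (auto intro!: continuous_intros)
      show "continuous_map (top_of_set {x \<in> {x \<in> {0..3}. 1 \<le> x}. 2 \<le> x}) X (\<lambda>u. r (u - 2))"
        by (rule continuous_map_compose_on[OF assms(3)[unfolded pathin_def]]) (auto intro!: continuous_intros)
    qed (use assms in auto)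
  qed (use assms in auto)
  \<comment> \<open>\<open>G\<close> runs through \<open>p\<close>, \<open>q\<close>,
    \<open>r\<close> on \<open>[0, 3]\<close>. Bracketing to the left has speeds 4, 4, 2, a concave
    parametrization and hence a minimum of two lines; to the right the speeds are 2, 4, 4, hence a
    maximum.\<close>
  then show ?thesis
  proof (rule path_homotopic_convex[where u = "\<lambda>t. min (4 * t) (2 * t + 1)" and v = "\<lambda>t. max (2 * t) (4 * t - 1)"])
    show "loop_join (loop_join p q) r t = G (min (4 * t) (2 * t + 1))" if "t \<in> {0..1}" for t
      using that assms(4,5) by (cases t "1/2::real" rule: linorder_cases) (auto simp: G_def loop_join_def min_def)
    show "loop_join p (loop_join q r) t = G (max (2 * t) (4 * t - 1))" if "t \<in> {0..1}" for t
    proof (cases "t = 1/2")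
      case True
      then show ?thesis unfolding True by (simp add: G_def loop_join_def)
    qed (use that assms(4,5) in \<open>auto simp: G_def loop_join_def max_def\<close>)
  qed (auto intro!: continuous_intros)
qed

lemma path_homotopic_const_left:
  assumes "pathin X p"
  shows "path_homotopic X (loop_join (\<lambda>_. p 0) p) p"
proof (rule path_homotopic_convex[OF assms[unfolded pathin_def], where u = "\<lambda>t. max 0 (2 * t - 1)" and v = "\<lambda>t. t"])
  show "loop_join (\<lambda>_. p 0) p t = p (max 0 (2 * t - 1))" for t
    by (cases t "1/2::real" rule: linorder_cases) (auto simp: loop_join_def)
qed (auto intro!: continuous_intros)

lemma path_homotopic_const_right:
  assumes "pathin X p"
  shows "path_homotopic X (loop_join p (\<lambda>_. p 1)) p"
proof (rule path_homotopic_convex[OF assms[unfolded pathin_def], where u = "\<lambda>t. min (2 * t) 1" and v = "\<lambda>t. t"])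
  show "loop_join p (\<lambda>_. p 1) t = p (min (2 * t) 1)" for t
    by (cases t "1/2::real" rule: linorder_cases) (auto simp: loop_join_def)
qed (auto intro!: continuous_intros)

lemma path_homotopic_reverse:
  assumes "pathin X p"
  shows "path_homotopic X (loop_join p (\<lambda>t. p (1 - t))) (\<lambda>_. p 0)"
proof (rule path_homotopic_convex[OF assms[unfolded pathin_def], where u = "\<lambda>t. min (2 * t) (2 - 2 * t)" and v = "\<lambda>_. 0"])
  show "loop_join p (\<lambda>t. p (1 - t)) t = p (min (2 * t) (2 - 2 * t))" for t
    by (cases t "1/2::real" rule: linorder_cases) (auto simp: loop_join_def min_def)
qed (auto intro!: continuous_intros)

lemma pathin_reverse: "pathin X p \<Longrightarrow> pathin X (\<lambda>t. p (1 - t))"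
  unfolding pathin_def by (erule continuous_map_compose_on) (auto intro!: continuous_intros)

lemma pathin_in_topspace: "pathin X p \<Longrightarrow> t \<in> {0..1} \<Longrightarrow> p t \<in> topspace X"
  unfolding pathin_def continuous_map_def by auto

lemma path_homotopic_reverse':
  assumes "pathin X p"
  shows "path_homotopic X (loop_join (\<lambda>t. p (1 - t)) p) (\<lambda>_. p 1)"
  using path_homotopic_reverse[OF pathin_reverse[OF assms]] by simp

text \<open>Both sides run along the boundary of the square from \<open>(0, 0)\<close> to
  \<open>(1, 1)\<close>, one each way round. A two-parameter family of configurations thus yields a
  relation between braids.\<close>

lemma path_homotopic_square:
  assumes "continuous_map (top_of_set unit_square) X S"
  shows "path_homotopic X (loop_join (\<lambda>t. S (t, 0)) (\<lambda>t. S (1, t))) (loop_join (\<lambda>t. S (0, t)) (\<lambda>t. S (t, 1)))"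
proof (rule path_homotopic_convex[OF assms, where u = "\<lambda>t. (min (2 * t) 1, max 0 (2 * t - 1))"
    and v = "\<lambda>t. (max 0 (2 * t - 1), min (2 * t) 1)"])
  show "loop_join (\<lambda>t. S (t, 0)) (\<lambda>t. S (1, t)) t = S (min (2 * t) 1, max 0 (2 * t - 1))" for t
    by (cases t "1/2::real" rule: linorder_cases) (auto simp: loop_join_def)
  show "loop_join (\<lambda>t. S (0, t)) (\<lambda>t. S (t, 1)) t = S (max 0 (2 * t - 1), min (2 * t) 1)" for t
    by (cases t "1/2::real" rule: linorder_cases) (auto simp: loop_join_def)
qed (auto intro!: continuous_intros convex_Times)

section \<open>Loop classes and the fundamental group\<close>

lemma prod_topology_top_of_set:
  "prod_topology (top_of_set A) (top_of_set B) = top_of_set (A \<times> B)"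
  by (simp flip: subtopology_Times)

lemma loop_class_eq_path_homotopic:
  assumes "loopin X x p"
  shows "loop_class X x p = {q. path_homotopic X p q}"
proof -
  have *: "homotopic_with (\<lambda>k. k 0 = x \<and> k 1 = x) (top_of_set {0..1}) X p q \<longleftrightarrow> path_homotopic X p q"
    if "loopin X x q" for q
  proof -
    have "homotopic_with (\<lambda>k. k 0 = x \<and> k 1 = x) (top_of_set {0..1}) X p q \<longleftrightarrow>
      (\<exists>S. continuous_map (top_of_set unit_square) X S \<and> (\<forall>t\<in>{0..1}. S (0, t) = p t) \<and> (\<forall>t\<in>{0..1}. S (1, t) = q t) \<and>
        (\<forall>s\<in>{0..1}. S (s, 0) = x \<and> S (s, 1) = x))"
      by (subst homotopic_with) (auto simp: prod_topology_top_of_set)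
    moreover have "p 0 = x" "p 1 = x" using assms by (simp_all add: loopin_def)
    ultimately show ?thesis by (simp only: path_homotopic_def ball_conj_distrib conj_assoc)
  qed
  have "loopin X x q" if "path_homotopic X p q" for q
    using path_homotopicD[OF that] assms by (simp add: loopin_def)
  then show ?thesis unfolding loop_class_def using * by blast
qed

lemma loop_class_eq_iff:
  assumes "loopin X x p" "loopin X x q"
  shows "loop_class X x p = loop_class X x q \<longleftrightarrow> path_homotopic X p q"
proof -
  have "path_homotopic X q q" using assms(2) by (simp add: loopin_def path_homotopic_refl)
  then show ?thesis
    unfolding loop_class_eq_path_homotopic[OF assms(1)] loop_class_eq_path_homotopic[OF assms(2)]
    by (auto intro: path_homotopic_sym path_homotopic_trans)
qed

lemma loopin_loop_join: "loopin X x p \<Longrightarrow> loopin X x q \<Longrightarrow> loopin X x (loop_join p q)"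
  by (simp add: loopin_def pathin_loop_join)

lemma fundamental_group_mult:
  assumes "loopin X x p" "loopin X x q"
  shows "loop_class X x p \<otimes>\<^bsub>fundamental_group X x\<^esub> loop_class X x q = loop_class X x (loop_join p q)"
proof -
  \<comment> \<open>The product is defined through chosen representatives; the chosen loop is
    homotopic to the given one, so the class of the concatenation does not depend on the
    choice.\<close>
  have *: "path_homotopic X p (SOME q. q \<in> loop_class X x p) \<and> loopin X x (SOME q. q \<in> loop_class X x p)"
    if "loopin X x p" for p
  proof -
    have "p \<in> loop_class X x p"
      using that by (simp add: loop_class_eq_path_homotopic loopin_def path_homotopic_refl)
    then have "(SOME q. q \<in> loop_class X x p) \<in> loop_class X x p" by (rule someI[where P = "\<lambda>q. q \<in> loop_class X x p"])
    moreover have "path_homotopic X p q \<and> loopin X x q" if "q \<in> loop_class X x p" for q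
      using that loop_class_eq_path_homotopic[OF \<open>loopin X x p\<close>] unfolding loop_class_def by blast
    ultimately show ?thesis by blast
  qed
  show ?thesis
    unfolding fundamental_group_def monoid.simps using *[OF assms(1)] *[OF assms(2)] assms
    by (subst loop_class_eq_iff)
      (auto intro: loopin_loop_join intro!: path_homotopic_sym[OF path_homotopic_loop_join], simp add: loopin_def)
qed

lemma group_fundamental_group:
  assumes "x \<in> topspace X"
  shows "group (fundamental_group X x)"
proof (rule groupI)
  have c: "loopin X x (\<lambda>_. x)"
    using assms by (simp add: loopin_def)
  have car: "A \<in> carrier (fundamental_group X x) \<longleftrightarrow> (\<exists>p. A = loop_class X x p \<and> loopin X x p)" for A
    by (auto simp: fundamental_group_def)
  have one: "\<one>\<^bsub>fundamental_group X x\<^esub> = loop_class X x (\<lambda>_. x)"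
    by (simp add: fundamental_group_def)
  show "\<one>\<^bsub>fundamental_group X x\<^esub> \<in> carrier (fundamental_group X x)"
    using c car one by blast
  fix A assume "A \<in> carrier (fundamental_group X x)"
  then obtain p where p: "A = loop_class X x p" "loopin X x p" using car by blast
  show "\<one>\<^bsub>fundamental_group X x\<^esub> \<otimes>\<^bsub>fundamental_group X x\<^esub> A = A"
    using p c path_homotopic_const_left[of X p]
    by (simp add: one fundamental_group_mult loop_class_eq_iff loopin_loop_join) (simp add: loopin_def)
  have r: "loopin X x (\<lambda>t. p (1 - t))" using p by (simp add: loopin_def pathin_reverse)
  have "loop_class X x (\<lambda>t. p (1 - t)) \<otimes>\<^bsub>fundamental_group X x\<^esub> A = \<one>\<^bsub>fundamental_group X x\<^esub>"
    using p c r path_homotopic_reverse'[of X p]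
    by (simp add: one fundamental_group_mult loop_class_eq_iff loopin_loop_join) (simp add: loopin_def)
  then show "\<exists>B\<in>carrier (fundamental_group X x). B \<otimes>\<^bsub>fundamental_group X x\<^esub> A = \<one>\<^bsub>fundamental_group X x\<^esub>"
    using r car by blast
  fix B assume "B \<in> carrier (fundamental_group X x)"
  then obtain q where q: "B = loop_class X x q" "loopin X x q" using car by blast
  show "A \<otimes>\<^bsub>fundamental_group X x\<^esub> B \<in> carrier (fundamental_group X x)"
    using p q car fundamental_group_mult loopin_loop_join by metis
  fix C assume "C \<in> carrier (fundamental_group X x)"
  then obtain r where r: "C = loop_class X x r" "loopin X x r" using car by blast
  show "A \<otimes>\<^bsub>fundamental_group X x\<^esub> B \<otimes>\<^bsub>fundamental_group X x\<^esub> C =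
        A \<otimes>\<^bsub>fundamental_group X x\<^esub> (B \<otimes>\<^bsub>fundamental_group X x\<^esub> C)"
    using p q r path_homotopic_assoc[of X p q r]
    by (simp add: fundamental_group_mult loop_class_eq_iff loopin_loop_join) (simp add: loopin_def)
qed

section \<open>Lifting to ordered configurations\<close>

text \<open>Bisection in each variable in turn: for fixed \<open>u\<close>, bisecting the second
  variable gives one width that works for a whole strip around \<open>u\<close>; bisecting the first
  variable then assembles the strips. It takes the place of a Lebesgue number for the
  square.\<close>

lemma rectangle_induct:
  fixes P :: "real \<Rightarrow> real \<Rightarrow> real \<Rightarrow> real \<Rightarrow> bool"
  assumes horiz: "\<And>a b c d e. a \<le> b \<Longrightarrow> b \<le> e \<Longrightarrow> c \<le> d \<Longrightarrow> P a b c d \<Longrightarrow> P b e c d \<Longrightarrow> P a e c d"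
    and vert: "\<And>a b c d e. a \<le> b \<Longrightarrow> c \<le> d \<Longrightarrow> d \<le> e \<Longrightarrow> P a b c d \<Longrightarrow> P a b d e \<Longrightarrow> P a b c e"
    and loc: "\<And>u v. u \<in> {0..1} \<Longrightarrow> v \<in> {0..1} \<Longrightarrow> \<exists>\<delta>>0. \<forall>a b c d. 0 \<le> a \<and> a \<le> u \<and> u \<le> b \<and> b \<le> 1 \<and> b - a < \<delta> \<and>
          0 \<le> c \<and> c \<le> v \<and> v \<le> d \<and> d \<le> 1 \<and> d - c < \<delta> \<longrightarrow> P a b c d"
  shows "P 0 1 0 1"
proof -
  have "\<exists>\<delta>>0. \<forall>a b. 0 \<le> a \<and> a \<le> u \<and> u \<le> b \<and> b \<le> 1 \<and> b - a < \<delta> \<longrightarrow> P a b 0 1" if u: "u \<in> {0..1}" for u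
  proof -
    have "(0::real) \<le> 0 \<longrightarrow> 1 \<le> (1::real) \<longrightarrow> (\<exists>\<delta>>0. \<forall>a b. 0 \<le> a \<and> a \<le> u \<and> u \<le> b \<and> b \<le> 1 \<and> b - a < \<delta> \<longrightarrow> P a b 0 1)"
    proof (rule Bolzano[of 0 1 "\<lambda>c d. 0 \<le> c \<longrightarrow> d \<le> 1 \<longrightarrow> (\<exists>\<delta>>0. \<forall>a b. 0 \<le> a \<and> a \<le> u \<and> u \<le> b \<and> b \<le> 1 \<and> b - a < \<delta> \<longrightarrow> P a b c d)"])
      show "0 \<le> c \<longrightarrow> e \<le> 1 \<longrightarrow> (\<exists>\<delta>>0. \<forall>a b. 0 \<le> a \<and> a \<le> u \<and> u \<le> b \<and> b \<le> 1 \<and> b - a < \<delta> \<longrightarrow> P a b c e)"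
        if c: "0 \<le> c \<longrightarrow> d \<le> 1 \<longrightarrow> (\<exists>\<delta>>0. \<forall>a b. 0 \<le> a \<and> a \<le> u \<and> u \<le> b \<and> b \<le> 1 \<and> b - a < \<delta> \<longrightarrow> P a b c d)"
          and d: "0 \<le> d \<longrightarrow> e \<le> 1 \<longrightarrow> (\<exists>\<delta>>0. \<forall>a b. 0 \<le> a \<and> a \<le> u \<and> u \<le> b \<and> b \<le> 1 \<and> b - a < \<delta> \<longrightarrow> P a b d e)"
          and le: "c \<le> d" "d \<le> e" for c d e
      proof (intro impI)
        assume "0 \<le> c" "e \<le> 1"
        then obtain \<delta> \<delta>' where "\<delta> > 0" "\<delta>' > 0"
          "\<And>a b. 0 \<le> a \<and> a \<le> u \<and> u \<le> b \<and> b \<le> 1 \<and> b - a < \<delta> \<Longrightarrow> P a b c d"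
          "\<And>a b. 0 \<le> a \<and> a \<le> u \<and> u \<le> b \<and> b \<le> 1 \<and> b - a < \<delta>' \<Longrightarrow> P a b d e"
          using c d le by force
        then show "\<exists>\<delta>>0. \<forall>a b. 0 \<le> a \<and> a \<le> u \<and> u \<le> b \<and> b \<le> 1 \<and> b - a < \<delta> \<longrightarrow> P a b c e"
          using le by (intro exI[of _ "min \<delta> \<delta>'"]) (auto intro: vert[of _ _ c d e])
      qed
      show "\<exists>\<epsilon>>0. \<forall>c d. c \<le> v \<and> v \<le> d \<and> d - c < \<epsilon> \<longrightarrow> 0 \<le> c \<longrightarrow> d \<le> 1 \<longrightarrow>
             (\<exists>\<delta>>0. \<forall>a b. 0 \<le> a \<and> a \<le> u \<and> u \<le> b \<and> b \<le> 1 \<and> b - a < \<delta> \<longrightarrow> P a b c d)" if "0 \<le> v" "v \<le> 1" for v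
        using loc[OF u, of v] that by (smt (verit) atLeastAtMost_iff)
    qed simp
    then show ?thesis by simp
  qed
  note l = this
  have "(0::real) \<le> 0 \<longrightarrow> 1 \<le> (1::real) \<longrightarrow> P 0 1 0 1"
  proof (rule Bolzano[of 0 1 "\<lambda>a b. 0 \<le> a \<longrightarrow> b \<le> 1 \<longrightarrow> P a b 0 1"])
    show "0 \<le> a \<longrightarrow> c \<le> 1 \<longrightarrow> P a c 0 1" if "0 \<le> a \<longrightarrow> b \<le> 1 \<longrightarrow> P a b 0 1" "0 \<le> b \<longrightarrow> c \<le> 1 \<longrightarrow> P b c 0 1" "a \<le> b" "b \<le> c" for a b c
      using that by (auto intro: horiz[of a b c])
    show "\<exists>d>0. \<forall>a b. a \<le> x \<and> x \<le> b \<and> b - a < d \<longrightarrow> 0 \<le> a \<longrightarrow> b \<le> 1 \<longrightarrow> P a b 0 1" if "0 \<le> x" "x \<le> 1" for x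
      using l[of x] that by auto
  qed simp
  then show ?thesis by simp
qed

section \<open>The topology of ordered and unordered configurations\<close>

lemma topspace_ordered_config:
  "z \<in> topspace (ordered_config M n) \<longleftrightarrow> z \<in> {..<n} \<rightarrow>\<^sub>E topspace M \<and> inj_on z {..<n}"
  by (simp add: ordered_config_def)

lemma continuous_map_ordered_config:
  "continuous_map X (ordered_config M n) f \<longleftrightarrow>
     (\<forall>i<n. continuous_map X M (\<lambda>x. f x i)) \<and> (\<forall>x\<in>topspace X. f x \<in> extensional {..<n} \<and> inj_on (f x) {..<n})"
  unfolding ordered_config_def continuous_map_in_subtopology continuous_map_componentwise by auto

lemma openin_unordered_config:
  "openin (unordered_config M n) U \<longleftrightarrow> U \<subseteq> (\<lambda>z. z ` {..<n}) ` topspace (ordered_config M n) \<and>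
     openin (ordered_config M n) {z \<in> topspace (ordered_config M n). z ` {..<n} \<in> U}"
  unfolding unordered_config_def quotient_topology_def
  by (subst topology_inverse'[OF istopology_quotient]) (rule refl)

lemma topspace_unordered_config:
  "topspace (unordered_config M n) = (\<lambda>z. z ` {..<n}) ` topspace (ordered_config M n)" (is "_ = ?Q")
proof -
  have "{z \<in> topspace (ordered_config M n). z ` {..<n} \<in> ?Q} = topspace (ordered_config M n)" by auto
  then have "openin (unordered_config M n) ?Q" by (simp add: openin_unordered_config)
  moreover have "U \<subseteq> ?Q" if "openin (unordered_config M n) U" for U
    using that by (simp add: openin_unordered_config)
  ultimately show ?thesis by (meson openin_subset openin_topspace subset_antisym)
qed

lemma continuous_map_config_set: "continuous_map (ordered_config M n) (unordered_config M n) (\<lambda>z. z ` {..<n})"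
  unfolding continuous_map_def topspace_unordered_config openin_unordered_config by auto

text \<open>The preimage among ordered configurations is the union, over the labels
  \<open>i\<close>, of the open sets where the \<open>i\<close>-th point lies in \<open>G\<close>.
  Open sets of this form suffice to follow single points of an unordered configuration.\<close>

lemma openin_config_meets:
  assumes "openin M G"
  shows "openin (unordered_config M n) {W \<in> topspace (unordered_config M n). W \<inter> G \<noteq> {}}"
proof -
  let ?F = "ordered_config M n"
  have "openin ?F {z \<in> topspace ?F. z i \<in> G}" if "i < n" for i
    using that openin_continuous_map_preimage[OF _ assms, of ?F "\<lambda>z. z i"]
      continuous_map_ordered_config[of ?F M n "\<lambda>z. z"] by simp
  then have "openin ?F (\<Union>i\<in>{..<n}. {z \<in> topspace ?F. z i \<in> G})" by blast
  moreover have "(\<Union>i\<in>{..<n}. {z \<in> topspace ?F. z i \<in> G}) =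
      {z \<in> topspace ?F. z ` {..<n} \<in> {W \<in> topspace (unordered_config M n). W \<inter> G \<noteq> {}}}"
    unfolding topspace_unordered_config by auto
  ultimately show ?thesis unfolding openin_unordered_config by (auto simp: topspace_unordered_config)
qed

lemma config_separation:
  assumes "Hausdorff_space M" "z \<in> topspace (ordered_config M n)"
  obtains U where "\<And>i. i < n \<Longrightarrow> openin M (U i) \<and> z i \<in> U i"
    "\<And>i j. i < n \<Longrightarrow> j < n \<Longrightarrow> i \<noteq> j \<Longrightarrow> U i \<inter> U j = {}"
proof -
  have z: "z i \<in> topspace M" "inj_on z {..<n}" if "i < n" for i
    using assms(2) that by (auto simp: topspace_ordered_config)
  have "\<exists>A B. openin M A \<and> openin M B \<and> z i \<in> A \<and> z j \<in> B \<and> A \<inter> B = {}" if "i < n" "j < n" "i \<noteq> j" for i j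
    using assms(1) z that unfolding Hausdorff_space_def disjnt_def
    by (metis inj_on_eq_iff lessThan_iff)
  then obtain A B where AB: "\<And>i j. i < n \<Longrightarrow> j < n \<Longrightarrow> i \<noteq> j \<Longrightarrow>
      openin M (A i j) \<and> openin M (B i j) \<and> z i \<in> A i j \<and> z j \<in> B i j \<and> A i j \<inter> B i j = {}"
    by metis
  \<comment> \<open>Both \<open>A i j\<close> and \<open>B j i\<close> contain \<open>z i\<close>;
    the pair chosen for \<open>(j, i)\<close> need not be the swap of the pair for
    \<open>(i, j)\<close>, so both are intersected.\<close>
  define U where "U i = topspace M \<inter> (\<Inter>j\<in>{..<n}-{i}. A i j \<inter> B j i)" for i
  show thesis
  proof
    show "openin M (U i) \<and> z i \<in> U i" if "i < n" for i
    proof (cases "{..<n}-{i} = {}")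
      case True
      then have "U i = topspace M" unfolding U_def True by simp
      then show ?thesis using z(1)[OF that] by simp
    next
      case False
      then show ?thesis unfolding U_def using that AB z by (auto intro!: openin_Int openin_INT)
    qed
    show "U i \<inter> U j = {}" if "i < n" "j < n" "i \<noteq> j" for i j
    proof -
      have "U i \<subseteq> A i j" "U j \<subseteq> B i j" using that unfolding U_def by auto
      then show ?thesis using AB[OF that] by blast
    qed
  qed
qed

text \<open>Pigeonhole: when \<open>n\<close> disjoint sets are all met by a set of \<open>n\<close>
  points, each contains exactly one of the points. The sets \<open>U i\<close> thereby label the
  points of \<open>W\<close>.\<close>

lemma config_meets_unique:
  assumes "W \<in> topspace (unordered_config M n)" and W: "\<And>i. i < n \<Longrightarrow> W \<inter> U i \<noteq> {}"
    and disj: "\<And>i j. i < n \<Longrightarrow> j < n \<Longrightarrow> i \<noteq> j \<Longrightarrow> U i \<inter> U j = {}"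
  obtains w where "\<And>i. i < n \<Longrightarrow> W \<inter> U i = {w i}" "inj_on w {..<n}" "w ` {..<n} = W"
proof -
  define w where "w i = (SOME w. w \<in> W \<inter> U i)" for i
  have w: "w i \<in> W" "w i \<in> U i" if "i < n" for i
    using W[OF that] some_in_eq[of "W \<inter> U i"] unfolding w_def by auto
  have inj: "inj_on w {..<n}"
    using w disj by (intro inj_onI) (metis disjoint_iff lessThan_iff)
  obtain z where z: "W = z ` {..<n}" "inj_on z {..<n}"
    using assms(1) by (auto simp: topspace_unordered_config topspace_ordered_config)
  have eq: "w ` {..<n} = W"
    by (rule card_subset_eq) (use w z inj in \<open>auto simp: card_image\<close>)
  have "W \<inter> U i = {w i}" if "i < n" for i
    using eq w that disj by (auto dest!: sym[OF eq, THEN equalityD1, THEN subsetD]) (metis IntI empty_iff)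
  with inj eq that show thesis by blast
qed

text \<open>As long as every \<open>U i\<close> is met, the labelling by these sets is continuous:
  the point with label \<open>i\<close> lies in \<open>G\<close> exactly if the configuration meets
  \<open>G \<inter> U i\<close>.\<close>

lemma local_config_lift:
  assumes op: "\<And>i. i < n \<Longrightarrow> openin M (U i)"
    and disj: "\<And>i j. i < n \<Longrightarrow> j < n \<Longrightarrow> i \<noteq> j \<Longrightarrow> U i \<inter> U j = {}"
    and S: "continuous_map T (unordered_config M n) S"
    and hit: "\<And>x i. x \<in> topspace T \<Longrightarrow> i < n \<Longrightarrow> S x \<inter> U i \<noteq> {}"
  obtains L where "continuous_map T (ordered_config M n) L" "\<And>x. x \<in> topspace T \<Longrightarrow> L x ` {..<n} = S x"
proof -
  have Sx: "S x \<in> topspace (unordered_config M n)" if "x \<in> topspace T" for x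
    using S that by (auto simp: continuous_map_def)
  have "\<exists>w. (\<forall>i<n. S x \<inter> U i = {w i}) \<and> inj_on w {..<n} \<and> w ` {..<n} = S x" if x: "x \<in> topspace T" for x
  proof -
    obtain w where "\<And>i. i < n \<Longrightarrow> S x \<inter> U i = {w i}" "inj_on w {..<n}" "w ` {..<n} = S x"
      using config_meets_unique[of "S x" M n U, OF Sx[OF x] hit[OF x] disj] by blast
    then show ?thesis by blast
  qed
  then obtain w where w: "\<And>x i. x \<in> topspace T \<Longrightarrow> i < n \<Longrightarrow> S x \<inter> U i = {w x i}"
    "\<And>x. x \<in> topspace T \<Longrightarrow> inj_on (w x) {..<n} \<and> w x ` {..<n} = S x"
    by metis
  have sub: "S x \<subseteq> topspace M" if "x \<in> topspace T" for x
    using Sx[OF that] by (auto simp: topspace_unordered_config topspace_ordered_config)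
  show thesis
  proof (rule that[of "\<lambda>x. restrict (w x) {..<n}"])
    have "continuous_map T M (\<lambda>x. w x i)" if i: "i < n" for i
      unfolding continuous_map_def
    proof (intro conjI allI impI)
      show "(\<lambda>x. w x i) \<in> topspace T \<rightarrow> topspace M"
        using w(2) sub i by blast
      fix G assume G: "openin M G"
      have "{x \<in> topspace T. w x i \<in> G} =
        {x \<in> topspace T. S x \<in> {W \<in> topspace (unordered_config M n). W \<inter> (G \<inter> U i) \<noteq> {}}}"
      proof -
        have "w x i \<in> G \<longleftrightarrow> S x \<inter> (G \<inter> U i) \<noteq> {}" if "x \<in> topspace T" for x
        proof -
          have "S x \<inter> (G \<inter> U i) = (S x \<inter> U i) \<inter> G" by blast
          then show ?thesis unfolding w(1)[OF that i] by auto
        qed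
        then show ?thesis using Sx by blast
      qed
      then show "openin T {x \<in> topspace T. w x i \<in> G}"
        using openin_continuous_map_preimage[OF S openin_config_meets[of M "G \<inter> U i"]] op[OF i] G
        by (simp add: openin_Int)
    qed
    then show "continuous_map T (ordered_config M n) (\<lambda>x. restrict (w x) {..<n})"
      unfolding continuous_map_ordered_config using w(2) by simp
  qed (use w(2) in auto)
qed

section \<open>Uniqueness and existence of lifts\<close>

lemma Hausdorff_space_ordered_config: "Hausdorff_space M \<Longrightarrow> Hausdorff_space (ordered_config M n)"
  unfolding ordered_config_def
  by (simp add: Hausdorff_space_product_topology Hausdorff_space_subtopology)

text \<open>The set of agreement is closed by the Hausdorff property. It is open because near a
  common value the points of both lifts stay in disjoint neighbourhoods indexed by the labels, where
  equal configurations have equal labelled points.\<close>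

lemma config_lift_unique:
  assumes M: "Hausdorff_space M" and T: "connected_space T"
    and L: "continuous_map T (ordered_config M n) L" "continuous_map T (ordered_config M n) L'"
    and eq: "\<And>x. x \<in> topspace T \<Longrightarrow> L x ` {..<n} = L' x ` {..<n}"
    and x0: "x0 \<in> topspace T" "L x0 = L' x0" and x: "x \<in> topspace T"
  shows "L x = L' x"
proof -
  let ?E = "{x \<in> topspace T. L x = L' x}"
  have "closedin T ?E"
    using closedin_continuous_maps_eq[OF Hausdorff_space_ordered_config[OF M] L] .
  moreover have "openin T ?E"
  proof (subst openin_subopen, intro ballI)
    fix y assume "y \<in> ?E"
    then have y: "y \<in> topspace T" "L y = L' y" by auto
    have "L y \<in> topspace (ordered_config M n)" using L(1) y(1) unfolding continuous_map_def by blast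
    then obtain U where U: "\<And>i. i < n \<Longrightarrow> openin M (U i) \<and> L y i \<in> U i"
      "\<And>i j. i < n \<Longrightarrow> j < n \<Longrightarrow> i \<noteq> j \<Longrightarrow> U i \<inter> U j = {}"
      using config_separation[OF M] by metis
    let ?V = "topspace T \<inter> (\<Inter>i\<in>{..<n}. {x \<in> topspace T. L x i \<in> U i} \<inter> {x \<in> topspace T. L' x i \<in> U i})"
    have "openin T ({x \<in> topspace T. L x i \<in> U i} \<inter> {x \<in> topspace T. L' x i \<in> U i})" if "i < n" for i
      using L U that unfolding continuous_map_ordered_config
      by (intro openin_Int openin_continuous_map_preimage[of T M _ "U i"]) auto
    then have "openin T ?V" by (cases "n = 0") (auto intro!: openin_Int[OF openin_topspace] openin_INT simp del: Int_iff)
    moreover have "y \<in> ?V" using y U(1) by auto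
    moreover have "?V \<subseteq> ?E"
    proof
      fix x assume x: "x \<in> ?V"
      have z: "L x \<in> topspace (ordered_config M n)" "L' x \<in> topspace (ordered_config M n)"
        using L x by (auto simp: continuous_map_def)
      have "L x i = L' x i" if "i < n" for i
      proof -
        have "L x i \<in> L x ` {..<n}" using that by auto
        also have "\<dots> = L' x ` {..<n}" using eq[of x] x by blast
        finally obtain j where j: "j < n" "L x i = L' x j" by auto
        have "L x i \<in> U i" "L' x j \<in> U j" using x that j(1) by auto
        then have "i = j" using U(2)[OF that j(1)] j(2) by force
        then show ?thesis using j(2) by simp
      qed
      then have "L x = L' x" using z unfolding topspace_ordered_config by (auto intro: PiE_ext)
      then show "x \<in> ?E" using x by simp
    qed
    ultimately show "\<exists>V. openin T V \<and> y \<in> V \<and> V \<subseteq> ?E" by blast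
  qed
  ultimately have "?E = topspace T"
    using T x0 unfolding connected_space_clopen_in by blast
  then show ?thesis using x by auto
qed

lemma relabel_config:
  assumes "bij_betw \<sigma> {..<n} {..<n}"
  shows "continuous_map (ordered_config M n) (ordered_config M n) (\<lambda>z. \<lambda>i\<in>{..<n}. z (\<sigma> i))"
    "(\<lambda>i\<in>{..<n}. z (\<sigma> i)) ` {..<n} = z ` {..<n}"
proof -
  have s: "\<sigma> i < n" if "i < n" for i using assms that by (auto simp: bij_betw_def)
  have "\<forall>i<n. continuous_map (ordered_config M n) M (\<lambda>z. z i)"
    using continuous_map_ordered_config[of "ordered_config M n" M n "\<lambda>z. z"] by simp
  then show "continuous_map (ordered_config M n) (ordered_config M n) (\<lambda>z. \<lambda>i\<in>{..<n}. z (\<sigma> i))"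
    unfolding continuous_map_ordered_config using s assms
    by (auto simp: topspace_ordered_config bij_betw_def inj_on_def)
  have "(\<lambda>i\<in>{..<n}. z (\<sigma> i)) ` {..<n} = z ` \<sigma> ` {..<n}" by (auto simp: image_image)
  then show "(\<lambda>i\<in>{..<n}. z (\<sigma> i)) ` {..<n} = z ` {..<n}" using assms by (simp add: bij_betw_def)
qed

lemma same_config_relabel:
  assumes "z \<in> topspace (ordered_config M n)" "z' \<in> topspace (ordered_config M n)" "z ` {..<n} = z' ` {..<n}"
  obtains \<sigma> where "bij_betw \<sigma> {..<n} {..<n}" "z = (\<lambda>i\<in>{..<n}. z' (\<sigma> i))"
proof -
  have inj: "inj_on z {..<n}" "inj_on z' {..<n}" using assms by (auto simp: topspace_ordered_config)
  define \<sigma> where "\<sigma> = inv_into {..<n} z' \<circ> z"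
  have "bij_betw \<sigma> {..<n} {..<n}"
    unfolding \<sigma>_def using inj assms(3)
    by (intro bij_betw_trans[of z _ "z ` {..<n}"]) (auto simp: bij_betw_def inj_on_inv_into bij_betw_inv_into[unfolded bij_betw_def])
  moreover have "z i = z' (\<sigma> i)" if "i < n" for i
    using that assms(3) unfolding \<sigma>_def by (metis comp_apply f_inv_into_f image_eqI lessThan_iff)
  then have "z = (\<lambda>i\<in>{..<n}. z' (\<sigma> i))"
    using assms(1) by (auto simp: topspace_ordered_config PiE_def extensional_def restrict_def)
  ultimately show thesis using that by blast
qed

text \<open>Lifts over the two halves may differ by a permutation on the common slice. Relabelling
  the second one at a single point makes them agree there, and uniqueness of lifts spreads this over
  the slice, which is why the slice must be connected and nonempty.\<close>

lemma glue_config_lifts: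
  fixes A :: "'b::topological_space set" and p :: "'b \<Rightarrow> real"
  assumes M: "Hausdorff_space M" and p: "continuous_on A p"
    and E: "connected {x \<in> A. p x = c}" "{x \<in> A. p x = c} \<noteq> {}"
    and L1: "continuous_map (top_of_set {x \<in> A. p x \<le> c}) (ordered_config M n) L1"
      "\<And>x. x \<in> A \<Longrightarrow> p x \<le> c \<Longrightarrow> L1 x ` {..<n} = S x"
    and L2: "continuous_map (top_of_set {x \<in> A. c \<le> p x}) (ordered_config M n) L2"
      "\<And>x. x \<in> A \<Longrightarrow> c \<le> p x \<Longrightarrow> L2 x ` {..<n} = S x"
  shows "\<exists>L. continuous_map (top_of_set A) (ordered_config M n) L \<and> (\<forall>x\<in>A. L x ` {..<n} = S x)"
proof -
  obtain x0 where x0: "x0 \<in> A" "p x0 = c" using E(2) by auto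
  have "L1 x0 \<in> topspace (ordered_config M n)" "L2 x0 \<in> topspace (ordered_config M n)"
    using L1(1) L2(1) x0 by (auto simp: continuous_map_def)
  then obtain \<sigma> where \<sigma>: "bij_betw \<sigma> {..<n} {..<n}" "L1 x0 = (\<lambda>i\<in>{..<n}. L2 x0 (\<sigma> i))"
    using same_config_relabel[of "L1 x0" M n "L2 x0"] L1(2)[of x0] L2(2)[of x0] x0 by auto
  define L3 where "L3 x = (\<lambda>i\<in>{..<n}. L2 x (\<sigma> i))" for x
  have L3: "continuous_map (top_of_set {x \<in> A. c \<le> p x}) (ordered_config M n) L3"
    using continuous_map_compose[OF L2(1) relabel_config(1)[OF \<sigma>(1)]] unfolding L3_def by (simp add: o_def)
  have q3: "L3 x ` {..<n} = S x" if "x \<in> A" "c \<le> p x" for x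
    unfolding L3_def using relabel_config(2)[OF \<sigma>(1)] L2(2)[OF that] by metis
  have eq: "L1 x = L3 x" if "x \<in> A" "p x = c" for x
  proof (rule config_lift_unique[OF M, of "top_of_set {x \<in> A. p x = c}"])
    show "continuous_map (top_of_set {x \<in> A. p x = c}) (ordered_config M n) L1"
      by (rule continuous_map_compose_on[OF L1(1), where g = "\<lambda>x. x"]) auto
    show "continuous_map (top_of_set {x \<in> A. p x = c}) (ordered_config M n) L3"
      by (rule continuous_map_compose_on[OF L3, where g = "\<lambda>x. x"]) auto
    show "connected_space (top_of_set {x \<in> A. p x = c})"
      using E(1) by (simp add: connectedin_def[of euclidean, simplified, symmetric])
    show "L1 x ` {..<n} = L3 x ` {..<n}" if "x \<in> topspace (top_of_set {x \<in> A. p x = c})" for x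
      using that L1(2)[of x] q3[of x] by simp
    show "L1 x0 = L3 x0" using \<sigma>(2) by (simp add: L3_def)
  qed (use x0 that in auto)
  have "continuous_map (top_of_set A) (ordered_config M n) (\<lambda>x. if p x \<le> c then L1 x else L3 x)"
    using p by (intro continuous_map_top_of_set_cases_le L1(1) L3) (auto simp: eq)
  then show ?thesis using L1(2) q3 by (intro exI[of _ "\<lambda>x. if p x \<le> c then L1 x else L3 x"]) auto
qed

proposition config_square_lift:
  assumes M: "Hausdorff_space M" and S: "continuous_map (top_of_set unit_square) (unordered_config M n) S"
    and z0: "z0 \<in> topspace (ordered_config M n)" "z0 ` {..<n} = S (0, 0)"
  obtains L where "continuous_map (top_of_set unit_square) (ordered_config M n) L"
    "\<And>x. x \<in> unit_square \<Longrightarrow> L x ` {..<n} = S x" "L (0, 0) = z0"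
proof -
  let ?P = "\<lambda>a b c d. \<exists>L. continuous_map (top_of_set ({a..b} \<times> {c..d})) (ordered_config M n) L \<and>
     (\<forall>x\<in>{a..b} \<times> {c..d}. L x ` {..<n} = S x)"
  have "?P 0 1 0 1"
  proof (rule rectangle_induct[where P = ?P])
    fix a b c d e :: real
    assume le: "a \<le> b" "b \<le> e" "c \<le> d" and "?P a b c d" "?P b e c d"
    then obtain L1 L2 where L:
      "continuous_map (top_of_set ({a..b} \<times> {c..d})) (ordered_config M n) L1" "\<forall>x\<in>{a..b} \<times> {c..d}. L1 x ` {..<n} = S x"
      "continuous_map (top_of_set ({b..e} \<times> {c..d})) (ordered_config M n) L2" "\<forall>x\<in>{b..e} \<times> {c..d}. L2 x ` {..<n} = S x"
      by blast
    have e: "{x \<in> {a..e} \<times> {c..d}. fst x \<le> b} = {a..b} \<times> {c..d}" "{x \<in> {a..e} \<times> {c..d}. b \<le> fst x} = {b..e} \<times> {c..d}"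
      "{x \<in> {a..e} \<times> {c..d}. fst x = b} = {b} \<times> {c..d}" using le by auto
    show "?P a e c d"
    proof (rule glue_config_lifts[OF M, where p = fst and c = b and ?L1.0 = L1 and ?L2.0 = L2])
      show "L1 x ` {..<n} = S x" if "x \<in> {a..e} \<times> {c..d}" "fst x \<le> b" for x
        using L(2) e(1) that by blast
      show "L2 x ` {..<n} = S x" if "x \<in> {a..e} \<times> {c..d}" "b \<le> fst x" for x
        using L(4) e(2) that by blast
    qed (use L(1,3) le in \<open>simp_all add: e connected_Times continuous_on_fst\<close>)
  next
    fix a b c d e :: real
    assume le: "a \<le> b" "c \<le> d" "d \<le> e" and "?P a b c d" "?P a b d e"
    then obtain L1 L2 where L:
      "continuous_map (top_of_set ({a..b} \<times> {c..d})) (ordered_config M n) L1" "\<forall>x\<in>{a..b} \<times> {c..d}. L1 x ` {..<n} = S x"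
      "continuous_map (top_of_set ({a..b} \<times> {d..e})) (ordered_config M n) L2" "\<forall>x\<in>{a..b} \<times> {d..e}. L2 x ` {..<n} = S x"
      by blast
    have e: "{x \<in> {a..b} \<times> {c..e}. snd x \<le> d} = {a..b} \<times> {c..d}" "{x \<in> {a..b} \<times> {c..e}. d \<le> snd x} = {a..b} \<times> {d..e}"
      "{x \<in> {a..b} \<times> {c..e}. snd x = d} = {a..b} \<times> {d}" using le by auto
    show "?P a b c e"
    proof (rule glue_config_lifts[OF M, where p = snd and c = d and ?L1.0 = L1 and ?L2.0 = L2])
      show "L1 x ` {..<n} = S x" if "x \<in> {a..b} \<times> {c..e}" "snd x \<le> d" for x
        using L(2) e(1) that by blast
      show "L2 x ` {..<n} = S x" if "x \<in> {a..b} \<times> {c..e}" "d \<le> snd x" for x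
        using L(4) e(2) that by blast
    qed (use L(1,3) le in \<open>simp_all add: e connected_Times continuous_on_snd\<close>)
  next
    fix u v :: real assume uv: "u \<in> {0..1}" "v \<in> {0..1}"
    then have "S (u, v) \<in> topspace (unordered_config M n)" using S by (auto simp: continuous_map_def)
    then obtain z where z: "z \<in> topspace (ordered_config M n)" "S (u, v) = z ` {..<n}"
      by (auto simp: topspace_unordered_config)
    obtain U where U: "\<And>i. i < n \<Longrightarrow> openin M (U i) \<and> z i \<in> U i"
      "\<And>i j. i < n \<Longrightarrow> j < n \<Longrightarrow> i \<noteq> j \<Longrightarrow> U i \<inter> U j = {}"
      using config_separation[OF M z(1)] by metis
    \<comment> \<open>Over \<open>?O\<close> every configuration meets each of the disjoint sets
      that separate the points over \<open>(u, v)\<close>, so \<open>local_config_lift\<close>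
      applies.\<close>
    let ?O = "unit_square \<inter> (\<Inter>i\<in>{..<n}. {x \<in> unit_square. S x \<inter> U i \<noteq> {}})"
    have "openin (top_of_set unit_square) {x \<in> unit_square. S x \<inter> U i \<noteq> {}}" if "i < n" for i
    proof -
      have "{x \<in> unit_square. S x \<inter> U i \<noteq> {}} = {x \<in> topspace (top_of_set unit_square). S x \<in>
          {W \<in> topspace (unordered_config M n). W \<inter> U i \<noteq> {}}}"
        using S by (auto simp: continuous_map_def)
      then show ?thesis using openin_continuous_map_preimage[OF S openin_config_meets] U(1)[OF that] by simp
    qed
    then have "openin (top_of_set unit_square) ?O" by (cases "n = 0") (auto intro!: openin_Int openin_INT)
    moreover have "(u, v) \<in> ?O" using uv z U by auto
    ultimately obtain \<epsilon> where \<epsilon>: "\<epsilon> > 0" "ball (u, v) \<epsilon> \<inter> unit_square \<subseteq> ?O"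
      by (metis (no_types, lifting) openin_contains_ball)
    show "\<exists>\<delta>>0. \<forall>a b c d. 0 \<le> a \<and> a \<le> u \<and> u \<le> b \<and> b \<le> 1 \<and> b - a < \<delta> \<and> 0 \<le> c \<and> c \<le> v \<and> v \<le> d \<and> d \<le> 1 \<and> d - c < \<delta> \<longrightarrow> ?P a b c d"
    proof (intro exI[of _ "\<epsilon>/2"] conjI allI impI)
      fix a b c d assume h: "0 \<le> a \<and> a \<le> u \<and> u \<le> b \<and> b \<le> 1 \<and> b - a < \<epsilon>/2 \<and> 0 \<le> c \<and> c \<le> v \<and> v \<le> d \<and> d \<le> 1 \<and> d - c < \<epsilon>/2"
      have sub: "{a..b} \<times> {c..d} \<subseteq> ?O"
      proof
        fix x assume x: "x \<in> {a..b} \<times> {c..d}"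
        have "dist (u, v) x \<le> dist u (fst x) + dist v (snd x)"
          using sqrt_sum_squares_le_sum_abs[of "dist u (fst x)" "dist v (snd x)"] by (simp add: dist_prod_def)
        also have "\<dots> < \<epsilon>" using x h by (auto simp: dist_real_def)
        finally show "x \<in> ?O" using \<epsilon>(2) x h by auto
      qed
      have cS: "continuous_map (top_of_set ({a..b} \<times> {c..d})) (unordered_config M n) S"
        by (rule continuous_map_compose_on[OF S, where g = "\<lambda>x. x"]) (use h in auto)
      show "?P a b c d"
      proof (rule local_config_lift[of n M U "top_of_set ({a..b} \<times> {c..d})" S, OF _ U(2) cS])
        fix L assume "continuous_map (top_of_set ({a..b} \<times> {c..d})) (ordered_config M n) L"
          "\<And>x. x \<in> topspace (top_of_set ({a..b} \<times> {c..d})) \<Longrightarrow> L x ` {..<n} = S x"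
        then show ?thesis by (intro exI[of _ L] conjI ballI) simp_all
      qed (use U sub in auto)
    qed (use \<epsilon> in auto)
  qed
  then obtain L where L: "continuous_map (top_of_set unit_square) (ordered_config M n) L"
    and "\<forall>x\<in>unit_square. L x ` {..<n} = S x"
    by (elim exE conjE)
  then have L2: "L x ` {..<n} = S x" if "x \<in> unit_square" for x
    using that by (elim bspec)
  \<comment> \<open>The lift assembled from rectangles has an arbitrary labelling; one global
    permutation makes it start at \<open>z0\<close>.\<close>
  have 0: "(0, 0) \<in> unit_square" by simp
  have "L (0, 0) \<in> topspace (ordered_config M n)" using L 0 by (simp add: continuous_map_def Pi_iff)
  then obtain \<sigma> where \<sigma>: "bij_betw \<sigma> {..<n} {..<n}" "z0 = (\<lambda>i\<in>{..<n}. L (0, 0) (\<sigma> i))"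
    using same_config_relabel[OF z0(1), of "L (0, 0)"] L2[OF 0] z0(2) by metis
  show thesis
  proof (rule that[of "\<lambda>x. \<lambda>i\<in>{..<n}. L x (\<sigma> i)"])
    show "continuous_map (top_of_set unit_square) (ordered_config M n) (\<lambda>x. \<lambda>i\<in>{..<n}. L x (\<sigma> i))"
      using continuous_map_compose[OF L relabel_config(1)[OF \<sigma>(1)]] by (simp add: o_def)
    show "(\<lambda>i\<in>{..<n}. L x (\<sigma> i)) ` {..<n} = S x" if "x \<in> unit_square" for x
      using relabel_config(2)[OF \<sigma>(1)] L2[OF that] by metis
  qed (use \<sigma> in simp)
qed

lemma config_path_lift:
  assumes M: "Hausdorff_space M" and p: "pathin (unordered_config M n) p"
    and z0: "z0 \<in> topspace (ordered_config M n)" "z0 ` {..<n} = p 0"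
  obtains g where "pathin (ordered_config M n) g" "\<And>t. t \<in> {0..1} \<Longrightarrow> g t ` {..<n} = p t" "g 0 = z0"
proof -
  have "continuous_map (top_of_set unit_square) (unordered_config M n) (\<lambda>x. p (snd x))"
    by (rule continuous_map_compose_on[OF p[unfolded pathin_def]]) (auto intro!: continuous_intros)
  from config_square_lift[OF M this z0(1)] z0(2) obtain L where
    L: "continuous_map (top_of_set unit_square) (ordered_config M n) L"
    "\<And>x. x \<in> unit_square \<Longrightarrow> L x ` {..<n} = p (snd x)" "L (0, 0) = z0" by auto
  have "continuous_map (top_of_set {0..1}) (ordered_config M n) (\<lambda>t. L (0, t))"
    by (rule continuous_map_compose_on[OF L(1)]) (auto intro!: continuous_intros)
  then show thesis using L by (intro that[of "\<lambda>t. L (0, t)"]) (auto simp: pathin_def)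
qed

text \<open>The homotopy is lifted, and uniqueness along the four sides identifies the boundary of
  the lift. Only the starting points are assumed equal; equality of the end points is part of the
  conclusion, and it shows that homotopic braids induce the same permutation.\<close>

lemma config_homotopy_lift:
  assumes M: "Hausdorff_space M" and g: "pathin (ordered_config M n) g" "pathin (ordered_config M n) g'" "g 0 = g' 0"
    and h: "path_homotopic (unordered_config M n) (\<lambda>t. g t ` {..<n}) (\<lambda>t. g' t ` {..<n})"
  shows "path_homotopic (ordered_config M n) g g'"
proof -
  let ?F = "ordered_config M n"
  obtain S where S: "continuous_map (top_of_set unit_square) (unordered_config M n) S"
    "\<And>t. t \<in> {0..1} \<Longrightarrow> S (0, t) = g t ` {..<n} \<and> S (1, t) = g' t ` {..<n}"
    "\<And>s. s \<in> {0..1} \<Longrightarrow> S (s, 0) = g 0 ` {..<n} \<and> S (s, 1) = g 1 ` {..<n}"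
    by (rule path_homotopicE[OF h]) (rule that)
  have gin: "g t \<in> topspace ?F" "g' t \<in> topspace ?F" if "t \<in> {0..1}" for t
    using g that pathin_in_topspace by metis+
  obtain L where L: "continuous_map (top_of_set unit_square) ?F L"
    "\<And>x. x \<in> unit_square \<Longrightarrow> L x ` {..<n} = S x" "L (0, 0) = g 0"
    using config_square_lift[OF M S(1), of "g 0"] gin S(2)[of 0] by auto
  have uniq: "L (f t) = k t"
    if "continuous_on {0..1} f" "\<And>t. t \<in> {0..1} \<Longrightarrow> f t \<in> unit_square" "pathin ?F k"
      "\<And>t. t \<in> {0..1} \<Longrightarrow> S (f t) = k t ` {..<n}" "L (f 0) = k 0" "t \<in> {0..1}" for f k t
  proof (rule config_lift_unique[OF M, of "top_of_set {0..1}" n "\<lambda>t. L (f t)" k])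
    show "continuous_map (top_of_set {0..1}) ?F (\<lambda>t. L (f t))"
      by (rule continuous_map_compose_on[OF L(1)]) (use that in auto)
  qed (use that L(2) in \<open>auto simp: pathin_def\<close>)
  have 1: "L (0, t) = g t" if "t \<in> {0..1}" for t
    by (rule uniq) (use that L S g in \<open>auto intro!: continuous_intros\<close>)
  have 2: "L (s, 0) = g 0" if "s \<in> {0..1}" for s
    by (rule uniq[where f = "\<lambda>s. (s, 0)" and k = "\<lambda>_. g 0"]) (use that L S gin in \<open>auto intro!: continuous_intros\<close>)
  have 3: "L (1, t) = g' t" if "t \<in> {0..1}" for t
    by (rule uniq) (use that 2[of 1] S g in \<open>auto intro!: continuous_intros\<close>)
  have 4: "L (s, 1) = g 1" if "s \<in> {0..1}" for s
    by (rule uniq[where f = "\<lambda>s. (s, 1)" and k = "\<lambda>_. g 1"]) (use that 1[of 1] S gin in \<open>auto intro!: continuous_intros\<close>)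
  show ?thesis by (rule path_homotopicI[OF L(1)]) (use 1 2 3 4 in auto)
qed

section \<open>Charts of surfaces\<close>

text \<open>Charts map from the plane into the surface, with complex coordinates for rotations and
  winding numbers. The domain \<open>C\<close> is typically the plane, the upper half-plane, or the
  plane with points removed.\<close>

definition open_embedding :: "complex set \<Rightarrow> 'a topology \<Rightarrow> (complex \<Rightarrow> 'a) \<Rightarrow> bool" where
  "open_embedding C X g \<longleftrightarrow> continuous_map (top_of_set C) X g \<and> open_map (top_of_set C) X g \<and> inj_on g C"

abbreviation upper_half_plane :: "complex set" where
  "upper_half_plane \<equiv> {z. 0 \<le> Im z}"

definition manifold_interior :: "'a topology \<Rightarrow> 'a set" where
  "manifold_interior X = {x. \<exists>e. open_embedding UNIV X e \<and> x \<in> range e}"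

lemma open_embedding_topspace: "open_embedding C X g \<Longrightarrow> z \<in> C \<Longrightarrow> g z \<in> topspace X"
  unfolding open_embedding_def continuous_map_def by (auto simp: Pi_iff)

lemma open_embedding_openin: "open_embedding C X g \<Longrightarrow> openin X (g ` C)"
  unfolding open_embedding_def open_map_def using openin_topspace[of "top_of_set C"] by simp

lemma open_embedding_openin_image:
  "open_embedding C X g \<Longrightarrow> open W \<Longrightarrow> openin X (g ` (C \<inter> W))"
  unfolding open_embedding_def open_map_def by (auto intro: openin_open_Int)

lemma open_embedding_compose:
  assumes "open_embedding C X g" "continuous_on A f" "\<And>x. x \<in> A \<Longrightarrow> f x \<in> C"
  shows "continuous_map (top_of_set A) X (\<lambda>x. g (f x))"
  by (rule continuous_map_compose_on[OF assms(1)[unfolded open_embedding_def, THEN conjunct1] assms(2,3)])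

lemma open_embedding_inv:
  assumes "open_embedding C X g"
  shows "continuous_map (subtopology X (g ` C)) (top_of_set C) (inv_into C g)"
proof -
  have sub: "g ` C \<subseteq> topspace X" using open_embedding_topspace[OF assms] by blast
  have "homeomorphic_map (top_of_set C) (subtopology X (g ` C)) g"
  proof (rule bijective_open_imp_homeomorphic_map)
    show "continuous_map (top_of_set C) (subtopology X (g ` C)) g"
      using assms unfolding open_embedding_def by (intro continuous_map_into_subtopology) auto
    show "open_map (top_of_set C) (subtopology X (g ` C)) g"
      using assms unfolding open_embedding_def by (simp add: open_map_into_subtopology)
  qed (use assms sub in \<open>auto simp: open_embedding_def\<close>)
  then obtain k where k: "homeomorphic_maps (top_of_set C) (subtopology X (g ` C)) g k"
    unfolding homeomorphic_map_maps by blast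
  show ?thesis
  proof (rule continuous_map_eq)
    show "continuous_map (subtopology X (g ` C)) (top_of_set C) k" using k by (simp add: homeomorphic_maps_def)
    fix x assume "x \<in> topspace (subtopology X (g ` C))"
    then obtain z where "z \<in> C" "x = g z" by auto
    then show "k x = inv_into C g x"
      using k assms by (simp add: homeomorphic_maps_def open_embedding_def inv_into_f_f)
  qed
qed

lemma open_embedding_compact_image:
  assumes "open_embedding C X g" "Hausdorff_space X" "compact K" "K \<subseteq> C"
  shows "compactin X (g ` K)" "closedin X (g ` K)"
proof -
  have "compactin (top_of_set C) K" using assms(3,4) by (simp add: compactin_subtopology)
  then show "compactin X (g ` K)"
    using assms(1) image_compactin unfolding open_embedding_def by blast
  then show "closedin X (g ` K)" using assms(2) compactin_imp_closedin by blast
qed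

lemma open_embedding_delete:
  assumes "open_embedding UNIV X e" "closed D"
  shows "open_embedding (- D) (subtopology X (topspace X - e ` D)) e"
  unfolding open_embedding_def
proof (intro conjI)
  have e: "continuous_map euclidean X e" "open_map euclidean X e" "inj e"
    using assms(1) by (auto simp: open_embedding_def)
  show "continuous_map (top_of_set (- D)) (subtopology X (topspace X - e ` D)) e"
    using e(1) open_embedding_topspace[OF assms(1)] injD[OF e(3)]
    by (intro continuous_map_into_subtopology continuous_map_from_subtopology) auto
  show "open_map (top_of_set (- D)) (subtopology X (topspace X - e ` D)) e"
    unfolding open_map_def
  proof (intro allI impI)
    fix U assume U: "openin (top_of_set (- D)) U"
    then have "open U" "U \<subseteq> - D" using assms(2) by (auto simp: open_Compl openin_open_eq)
    then have "openin X (e ` U)" "e ` U \<subseteq> topspace X - e ` D"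
      using e(2,3) openin_subset[of X "e ` U"] unfolding open_map_def by (auto simp: inj_def)
    then show "openin (subtopology X (topspace X - e ` D)) (e ` U)"
      unfolding openin_subtopology by (intro exI[of _ "e ` U"]) auto
  qed
  show "inj_on e (- D)" using e(3) inj_on_subset by blast
qed

text \<open>Pasting over two open sets, the image of the chart and the complement of the image of
  \<open>K\<close>. It extends a construction made in chart coordinates with support in
  \<open>K\<close>, usually by the identity; the parameter space \<open>T\<close> serves
  isotopies.\<close>

proposition chart_gluing:
  assumes g: "open_embedding C X g" and K: "closedin X (g ` K)" "K \<subseteq> C"
    and \<phi>: "continuous_map (prod_topology T (top_of_set C)) Z (\<lambda>(t, z). \<phi> t z)"
    and \<psi>: "continuous_map (prod_topology T (subtopology X (topspace X - g ` K))) Z (\<lambda>(t, x). \<psi> t x)"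
    and agree: "\<And>t z. t \<in> topspace T \<Longrightarrow> z \<in> C \<Longrightarrow> z \<notin> K \<Longrightarrow> \<phi> t z = \<psi> t (g z)"
  shows "continuous_map (prod_topology T X) Z (\<lambda>(t, x). if x \<in> g ` C then \<phi> t (inv_into C g x) else \<psi> t x)"
proof (rule pasting_lemma[where I = UNIV and T = "\<lambda>i::bool. topspace T \<times> (if i then g ` C else topspace X - g ` K)"
      and f = "\<lambda>i (t, x). if i then \<phi> t (inv_into C g x) else \<psi> t x"])
  have inj: "inj_on g C" using g by (simp add: open_embedding_def)
  have sub: "g ` C \<subseteq> topspace X" using open_embedding_topspace[OF g] by blast
  show "openin (prod_topology T X) (topspace T \<times> (if i then g ` C else topspace X - g ` K))" for i
    using open_embedding_openin[OF g] K by (auto simp: openin_prod_Times_iff openin_diff)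
  have s: "subtopology (prod_topology T X) (topspace T \<times> S) = prod_topology T (subtopology X S)" for S
    by (simp add: subtopology_Times)
  have "continuous_map (prod_topology T (subtopology X (g ` C))) (prod_topology T (top_of_set C)) (\<lambda>(t, x). (t, inv_into C g x))"
    using open_embedding_inv[OF g]
    by (simp add: continuous_map_prod_top)
  from continuous_map_compose[OF this \<phi>]
  have "continuous_map (prod_topology T (subtopology X (g ` C))) Z (\<lambda>(t, x). \<phi> t (inv_into C g x))"
    by (simp add: o_def case_prod_unfold)
  then show "continuous_map (subtopology (prod_topology T X) (topspace T \<times> (if i then g ` C else topspace X - g ` K))) Z
      (\<lambda>(t, x). if i then \<phi> t (inv_into C g x) else \<psi> t x)" for i
    using \<psi> by (cases i) (simp_all add: s)
  have ag: "\<phi> t (inv_into C g x) = \<psi> t x" if h: "t \<in> topspace T" "x \<in> g ` C" "x \<notin> g ` K" for t x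
  proof -
    obtain z where z: "z \<in> C" "x = g z" using h(2) by auto
    then have "z \<notin> K" using h(3) by auto
    then show ?thesis using agree[OF h(1) z(1)] z inj by (simp add: inv_into_f_f)
  qed
  then show "(case x of (t, x) \<Rightarrow> if i then \<phi> t (inv_into C g x) else \<psi> t x) =
      (case x of (t, x) \<Rightarrow> if j then \<phi> t (inv_into C g x) else \<psi> t x)"
    if "x \<in> topspace (prod_topology T X) \<inter> (topspace T \<times> (if i then g ` C else topspace X - g ` K)) \<inter>
       (topspace T \<times> (if j then g ` C else topspace X - g ` K))" for i j x
    using that by (cases i; cases j) auto
  show "\<exists>j. j \<in> UNIV \<and> x \<in> topspace T \<times> (if j then g ` C else topspace X - g ` K) \<and>
     (case x of (t, x) \<Rightarrow> if x \<in> g ` C then \<phi> t (inv_into C g x) else \<psi> t x) =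
     (case x of (t, x) \<Rightarrow> if j then \<phi> t (inv_into C g x) else \<psi> t x)" if "x \<in> topspace (prod_topology T X)" for x
    using that K(2) by (intro exI[of _ "snd x \<in> g ` C"]) auto
qed

text \<open>A homeomorphism of the plane onto \<open>ball c r\<close> that preserves directions:
  distance \<open>t\<close> from the origin becomes distance \<open>r t / (1 + t)\<close> from
  \<open>c\<close>. For real \<open>c\<close> it also maps the upper half-plane onto a
  half-disc.\<close>

definition shrink :: "complex \<Rightarrow> real \<Rightarrow> complex \<Rightarrow> complex" where
  "shrink c r z = c + (r / (1 + norm z)) *\<^sub>R z"

lemma shrink_in_ball: "r > 0 \<Longrightarrow> shrink c r z \<in> ball c r"
proof -
  assume "r > 0"
  have p: "1 + norm z > 0" by (simp add: add_pos_nonneg)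
  have "r * norm z < r * (1 + norm z)" using \<open>r > 0\<close> by simp
  then have "r * norm z / (1 + norm z) < r" using p by (simp add: pos_divide_less_eq)
  then show ?thesis using \<open>r > 0\<close> p by (simp add: shrink_def dist_norm)
qed

lemma shrink_0 [simp]: "shrink c r 0 = c"
  by (simp add: shrink_def)

lemma unshrink:
  assumes "r > 0"
  obtains k where "continuous_on (ball c r) k" "\<And>z. k (shrink c r z) = z" "\<And>w. w \<in> ball c r \<Longrightarrow> shrink c r (k w) = w"
proof -
  \<comment> \<open>Solves \<open>s = r t / (1 + t)\<close> for the original distance,
    \<open>t = s / (r - s)\<close>.\<close>
  let ?k = "\<lambda>w. (1 / (r - norm (w - c))) *\<^sub>R (w - c)"
  have pos: "1 + norm z > 0" for z :: complex by (simp add: add_pos_nonneg)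
  show thesis
  proof (rule that[of ?k])
    show "continuous_on (ball c r) ?k" by (intro continuous_intros) (auto simp: dist_norm norm_minus_commute)
    show "?k (shrink c r z) = z" for z
    proof -
      have "r - norm (shrink c r z - c) = r / (1 + norm z)" using assms pos[of z] by (simp add: shrink_def field_simps)
      then show ?thesis using assms pos[of z] by (simp add: shrink_def)
    qed
    show "shrink c r (?k w) = w" if "w \<in> ball c r" for w
    proof -
      have p: "r - norm (w - c) > 0" using that by (simp add: dist_norm norm_minus_commute)
      have "norm (?k w) = norm (w - c) / (r - norm (w - c))" using p by simp
      then have "1 + norm (?k w) = r / (r - norm (w - c))" using p by (simp add: add_divide_eq_iff)
      then show ?thesis using p assms by (simp add: shrink_def)
    qed
  qed
qed

lemma continuous_on_shrink: "continuous_on A (shrink c r)"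
proof -
  have "1 + norm z \<noteq> 0" for z :: complex by (metis add_pos_nonneg less_irrefl norm_ge_zero zero_less_one)
  then show ?thesis unfolding shrink_def by (intro continuous_intros) auto
qed

lemma open_embedding_shrink:
  assumes g: "open_embedding D X g" and r: "r > 0" and C: "\<And>z. z \<in> C \<longleftrightarrow> shrink c r z \<in> D"
  shows "open_embedding C X (\<lambda>z. g (shrink c r z))"
proof -
  obtain k where k: "continuous_on (ball c r) k" "\<And>z. k (shrink c r z) = z" "\<And>w. w \<in> ball c r \<Longrightarrow> shrink c r (k w) = w"
    using unshrink[OF r] by metis
  show ?thesis
    unfolding open_embedding_def
  proof (intro conjI)
    show "continuous_map (top_of_set C) X (\<lambda>z. g (shrink c r z))"
      using C by (intro open_embedding_compose[OF g continuous_on_shrink]) auto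
    have "inj_on g D" using g by (simp add: open_embedding_def)
    then show "inj_on (\<lambda>z. g (shrink c r z)) C"
      using C k(2) by (intro inj_onI) (metis inj_onD)
    show "open_map (top_of_set C) X (\<lambda>z. g (shrink c r z))"
      unfolding open_map_def
    proof (intro allI impI)
      fix U assume "openin (top_of_set C) U"
      then obtain W where W: "open W" "U = C \<inter> W" by (auto simp: openin_open)
      have "open (ball c r \<inter> k -` W)" using k(1) W(1) by (simp add: continuous_open_preimage)
      moreover have "(\<lambda>z. g (shrink c r z)) ` U = g ` (D \<inter> (ball c r \<inter> k -` W))"
      proof -
        have "shrink c r ` U = D \<inter> (ball c r \<inter> k -` W)"
        proof (intro equalityI subsetI)
          fix w assume "w \<in> shrink c r ` U"
          then obtain z where z: "z \<in> U" "w = shrink c r z" by auto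
          then show "w \<in> D \<inter> (ball c r \<inter> k -` W)" using C k(2) shrink_in_ball[OF r, of c z] W(2) by simp
        next
          fix w assume w: "w \<in> D \<inter> (ball c r \<inter> k -` W)"
          then have "k w \<in> U" using W(2) C k(3) by simp
          then show "w \<in> shrink c r ` U" using k(3)[of w] w by (metis IntD1 IntD2 image_eqI)
        qed
        then show ?thesis by (metis image_image)
      qed
      ultimately show "openin X ((\<lambda>z. g (shrink c r z)) ` U)"
        using open_embedding_openin_image[OF g] by metis
    qed
  qed
qed

lemma open_embedding_preimage_ball:
  assumes g: "open_embedding D X g" and z: "z \<in> D" and N: "openin X N" "g z \<in> N"
  obtains r where "r > 0" "g ` (D \<inter> ball z r) \<subseteq> N"
proof -
  have "openin (top_of_set D) {x \<in> topspace (top_of_set D). g x \<in> N}"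
    using g N(1) unfolding open_embedding_def continuous_map_def by blast
  moreover have "z \<in> {x \<in> topspace (top_of_set D). g x \<in> N}" using z N by simp
  ultimately obtain r where "r > 0" "ball z r \<inter> D \<subseteq> {x \<in> topspace (top_of_set D). g x \<in> N}"
    unfolding openin_contains_ball by (metis (no_types, lifting))
  then show thesis using that[of r] by auto
qed

lemma centered_chart:
  assumes g: "open_embedding D X g" and z: "ball z d \<subseteq> D" "d > 0" and N: "openin X N" "g z \<in> N"
  obtains e where "open_embedding UNIV X e" "e 0 = g z" "range e \<subseteq> N"
proof -
  have "z \<in> D" using z by auto
  then obtain r where r: "r > 0" "g ` (D \<inter> ball z r) \<subseteq> N" using open_embedding_preimage_ball[OF g _ N] by metis
  define s where "s = min r d"
  have s: "s > 0" "ball z s \<subseteq> D" "ball z s \<subseteq> ball z r" using r z by (auto simp: s_def)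
  have in_s: "shrink z s w \<in> ball z s" for w using shrink_in_ball[OF s(1)] .
  show thesis
  proof (rule that[of "\<lambda>w. g (shrink z s w)"])
    show "open_embedding UNIV X (\<lambda>w. g (shrink z s w))"
      using in_s s(2) by (intro open_embedding_shrink[OF g s(1)]) blast
    show "range (\<lambda>w. g (shrink z s w)) \<subseteq> N" using r(2) s in_s by blast
  qed simp
qed

lemma interior_chart:
  assumes "x \<in> manifold_interior X" "openin X N" "x \<in> N"
  obtains e where "open_embedding UNIV X e" "e 0 = x" "range e \<subseteq> N"
proof -
  obtain g z where "open_embedding UNIV X g" "x = g z" using assms(1) by (auto simp: manifold_interior_def)
  then show thesis using centered_chart[of UNIV X g z 1 N] assms that by auto
qed

lemma manifold_interior_half_chart:
  assumes "open_embedding upper_half_plane X g" "Im z > 0"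
  shows "g z \<in> manifold_interior X"
proof -
  have "ball z (Im z) \<subseteq> upper_half_plane"
  proof
    fix w assume "w \<in> ball z (Im z)"
    then have "\<bar>Im (z - w)\<bar> < Im z" using abs_Im_le_cmod[of "z - w"] by (simp add: dist_norm)
    then show "w \<in> upper_half_plane" by simp
  qed
  moreover have "g z \<in> topspace X" using open_embedding_topspace[OF assms(1)] assms(2) by simp
  ultimately obtain e where "open_embedding UNIV X e" "e 0 = g z" "range e \<subseteq> topspace X"
    using centered_chart[OF assms(1), of z "Im z" "topspace X"] assms(2) by blast
  then show ?thesis unfolding manifold_interior_def by (metis (mono_tags, lifting) mem_Collect_eq rangeI)
qed

text \<open>Normalizes charts to two models, the whole plane and the whole half-plane, centred at
  \<open>x\<close> with image in \<open>N\<close>. A chart point of positive height has a disc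
  around it inside the domain; at height zero, \<open>shrink\<close> has a real centre and preserves
  the sign of the imaginary part.\<close>

proposition surface_chart:
  assumes M: "surface_with_boundary M" and N: "openin M N" and x: "x \<in> N"
  shows "(\<exists>e. open_embedding UNIV M e \<and> e 0 = x \<and> range e \<subseteq> N) \<or>
    (\<exists>g. open_embedding upper_half_plane M g \<and> g 0 = x \<and> g ` upper_half_plane \<subseteq> N)"
proof -
  have "x \<in> topspace M" using N x openin_subset by blast
  then obtain U V where UV: "openin M U" "x \<in> U" "openin (top_of_set closed_half_plane) V"
    "subtopology M U homeomorphic_space top_of_set V"
    using M unfolding surface_with_boundary_def by blast
  then obtain f k where fk: "homeomorphic_maps (top_of_set V) (subtopology M U) f k"
    using homeomorphic_space_sym unfolding homeomorphic_space_def by blast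
  obtain W where W: "open W" "V = closed_half_plane \<inter> W" using UV(3) by (auto simp: openin_open)
  define D where "D = {z. (Re z, Im z) \<in> V}"
  define g where "g z = f (Re z, Im z)" for z
  have cf: "continuous_map (top_of_set V) M f" and open_f: "open_map (top_of_set V) (subtopology M U) f"
    using fk continuous_map_into_fulltopology homeomorphic_imp_open_map homeomorphic_maps_map
    unfolding homeomorphic_maps_def by blast+
  have g: "open_embedding D M g"
    unfolding open_embedding_def
  proof (intro conjI)
    show "continuous_map (top_of_set D) M g"
      unfolding g_def using cf by (rule continuous_map_compose_on) (auto simp: D_def intro!: continuous_intros)
    show "inj_on g D"
      using fk by (intro inj_onI) (auto simp: D_def g_def homeomorphic_maps_def complex_eq_iff dest!: arg_cong[of _ _ k])
    show "open_map (top_of_set D) M g"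
      unfolding open_map_def
    proof (intro allI impI)
      fix A assume "openin (top_of_set D) A"
      then obtain B where B: "open B" "A = D \<inter> B" by (auto simp: openin_open)
      have "open ((\<lambda>p. Complex (fst p) (snd p)) -` B)"
        unfolding Complex_eq by (rule open_vimage[OF B(1)]) (auto intro!: continuous_intros)
      then have "openin (top_of_set V) (V \<inter> (\<lambda>p. Complex (fst p) (snd p)) -` B)" by (rule openin_open_Int)
      moreover have "g ` A = f ` (V \<inter> (\<lambda>p. Complex (fst p) (snd p)) -` B)"
      proof -
        have "(\<lambda>z. (Re z, Im z)) ` A = V \<inter> (\<lambda>p. Complex (fst p) (snd p)) -` B"
          unfolding B(2) D_def by (force simp: image_iff intro: bexI[of _ "Complex _ _"])
        then show ?thesis unfolding g_def by (metis image_image)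
      qed
      ultimately have "openin (subtopology M U) (g ` A)" using open_f unfolding open_map_def by metis
      then show "openin M (g ` A)" using UV(1) openin_trans_full by blast
    qed
  qed
  have "x \<in> topspace (subtopology M U)" using UV(1,2) openin_subset by auto
  then have k: "k x \<in> V" "f (k x) = x" using fk unfolding homeomorphic_maps_def continuous_map_def by auto
  define z where "z = Complex (fst (k x)) (snd (k x))"
  have z: "z \<in> D" "g z = x" using k by (auto simp: z_def D_def g_def)
  have D: "w \<in> D \<longleftrightarrow> 0 \<le> Im w \<and> (Re w, Im w) \<in> W" for w by (auto simp: D_def W(2) closed_half_plane_def)
  have "open ((\<lambda>w. (Re w, Im w)) -` W)" by (rule open_vimage[OF W(1)]) (auto intro!: continuous_intros)
  moreover have "z \<in> (\<lambda>w. (Re w, Im w)) -` W" using z(1) D by simp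
  ultimately obtain d where d: "d > 0" "ball z d \<subseteq> (\<lambda>w. (Re w, Im w)) -` W"
    by (rule openE)
  show ?thesis
  proof (cases "Im z = 0")
    case False
    then have pos: "Im z > 0" using z(1) D by force
    have "ball z (min d (Im z)) \<subseteq> D"
    proof
      fix w assume w: "w \<in> ball z (min d (Im z))"
      then have "\<bar>Im (z - w)\<bar> < Im z" using abs_Im_le_cmod[of "z - w"] by (simp add: dist_norm)
      then show "w \<in> D" using w d D by auto
    qed
    moreover have "min d (Im z) > 0" "g z \<in> N" using d(1) pos x z(2) by auto
    ultimately obtain e where "open_embedding UNIV M e" "e 0 = g z" "range e \<subseteq> N"
      using centered_chart[OF g _ _ N] by blast
    then show ?thesis using z(2) by blast
  next
    case True
    obtain r where r: "r > 0" "g ` (D \<inter> ball z r) \<subseteq> N" using open_embedding_preimage_ball[OF g z(1) N] x z(2) by metis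
    define s where "s = min r d"
    have s: "s > 0" "ball z s \<subseteq> ball z r" "ball z s \<subseteq> ball z d" using r d by (auto simp: s_def)
    have iff: "w \<in> upper_half_plane \<longleftrightarrow> shrink z s w \<in> D" for w
    proof -
      have "0 < s / (1 + norm w)" using s(1) by (simp add: add_pos_nonneg)
      then have "0 \<le> s / (1 + norm w) * Im w \<longleftrightarrow> 0 \<le> Im w" unfolding zero_le_mult_iff by linarith
      then have "0 \<le> Im (shrink z s w) \<longleftrightarrow> 0 \<le> Im w" using True by (simp add: shrink_def)
      moreover have "shrink z s w \<in> ball z d" by (rule subsetD[OF s(3) shrink_in_ball[OF s(1)]])
      then have "(Re (shrink z s w), Im (shrink z s w)) \<in> W" using d(2) by (auto simp del: mem_ball)
      ultimately show ?thesis using D by simp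
    qed
    have "open_embedding upper_half_plane M (\<lambda>w. g (shrink z s w))"
      by (rule open_embedding_shrink[OF g s(1) iff])
    moreover have "(\<lambda>w. g (shrink z s w)) ` upper_half_plane \<subseteq> N"
    proof (intro image_subsetI)
      fix w assume "w \<in> upper_half_plane"
      then have "shrink z s w \<in> D \<inter> ball z r" using iff subsetD[OF s(2) shrink_in_ball[OF s(1)]] by simp
      then show "g (shrink z s w) \<in> N" using r(2) by blast
    qed
    ultimately show ?thesis using z(2) by (intro disjI2 exI[of _ "\<lambda>w. g (shrink z s w)"]) simp
  qed
qed

lemma continuous_map_id_pair: "y \<in> topspace T \<Longrightarrow> continuous_map X (prod_topology T X) (\<lambda>x. (y, x))"
  by (simp add: continuous_map_pairwise o_def)

lemma chart_gluing_simple: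
  assumes g: "open_embedding C X g" and K: "closedin X (g ` K)" "K \<subseteq> C"
    and \<phi>: "continuous_map (top_of_set C) Z \<phi>"
    and \<psi>: "continuous_map (subtopology X (topspace X - g ` K)) Z \<psi>"
    and agree: "\<And>z. z \<in> C \<Longrightarrow> z \<notin> K \<Longrightarrow> \<phi> z = \<psi> (g z)"
  shows "continuous_map X Z (\<lambda>x. if x \<in> g ` C then \<phi> (inv_into C g x) else \<psi> x)"
proof -
  let ?T = "top_of_set {0::real}"
  have "continuous_map (prod_topology ?T (top_of_set C)) Z (\<lambda>(t, z). \<phi> z)"
    "continuous_map (prod_topology ?T (subtopology X (topspace X - g ` K))) Z (\<lambda>(t, x). \<psi> x)"
    using continuous_map_compose[OF continuous_map_snd \<phi>] continuous_map_compose[OF continuous_map_snd \<psi>]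
    by (simp_all only: case_prod_unfold o_def)
  from chart_gluing[OF g K this] agree
  have "continuous_map (prod_topology ?T X) Z (\<lambda>(t, x). if x \<in> g ` C then \<phi> (inv_into C g x) else \<psi> x)" by simp
  from continuous_map_compose[OF continuous_map_id_pair[of 0] this] show ?thesis by (simp add: o_def)
qed

section \<open>Connectedness of punctured surfaces and of configuration spaces\<close>

lemma not_collinear_if_interior:
  fixes C :: "complex set"
  assumes "interior C \<noteq> {}"
  shows "\<not> collinear C"
  using aff_dim_nonempty_interior[OF assms] by (simp add: collinear_aff_dim)

lemma half_plane_facts:
  "convex upper_half_plane" "\<not> collinear upper_half_plane" "closed upper_half_plane"
proof -
  show "convex upper_half_plane" by (simp add: convex_halfspace_Im_ge)
  show "closed upper_half_plane" by (simp add: closed_halfspace_Im_ge)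
  have "open {z. 0 < Im z}" by (simp add: open_halfspace_Im_gt)
  then have "{z. 0 < Im z} \<subseteq> interior upper_half_plane" by (intro interior_maximal) auto
  moreover have "\<i> \<in> {z. 0 < Im z}" by simp
  ultimately show "\<not> collinear upper_half_plane" using not_collinear_if_interior by blast
qed

lemma path_connected_chart_diff_finite:
  assumes g: "open_embedding C M g" and C: "convex C" "\<not> collinear C" and S: "finite S"
  shows "path_connectedin M (g ` C - S)" "g ` C - S \<noteq> {}"
proof -
  have inj: "inj_on g C" using g by (simp add: open_embedding_def)
  define S' where "S' = C \<inter> g -` S"
  have "finite S'" unfolding S'_def using finite_vimage_IntI[OF S inj] by (simp add: Int_commute)
  then have pc: "path_connected (C - S')" using path_connected_convex_diff_countable[OF C] countable_finite by blast
  have eq: "g ` C - S = g ` (C - S')" unfolding S'_def by auto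
  have "path_connectedin (top_of_set C) (C - S')" using pc by (simp add: path_connectedin_subtopology)
  then show "path_connectedin M (g ` C - S)"
    unfolding eq using g path_connectedin_continuous_map_image unfolding open_embedding_def by blast
  have "infinite C"
  proof
    assume "finite C"
    then have "\<exists>a. C \<subseteq> {a}" using connected_finite_iff_sing[of C] C(1) convex_connected by fastforce
    then show False using C(2) by (metis collinear_sing collinear_subset)
  qed
  then have "C - S' \<noteq> {}" using \<open>finite S'\<close> by (metis Diff_eq_empty_iff finite_subset)
  then show "g ` C - S \<noteq> {}" unfolding eq by simp
qed

lemma surface_nice_neighbourhood:
  assumes "surface_with_boundary M" "openin M N" "x \<in> N" "finite S"
  obtains W where "openin M W" "x \<in> W" "W \<subseteq> N" "path_connectedin M (W - S)" "W - S \<noteq> {}"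
proof -
  obtain C g where g: "open_embedding C M g" "g 0 = x" "g ` C \<subseteq> N" "0 \<in> C" "convex C" "\<not> collinear C"
  proof -
    have "\<exists>C g. open_embedding C M g \<and> g 0 = x \<and> g ` C \<subseteq> N \<and> 0 \<in> C \<and> convex C \<and> \<not> collinear C"
      using surface_chart[OF assms(1-3)]
    proof (elim disjE exE conjE)
      fix e assume "open_embedding UNIV M e" "e 0 = x" "range e \<subseteq> N"
      moreover have "\<not> collinear (UNIV :: complex set)" by (rule not_collinear_if_interior) simp
      ultimately show ?thesis by (intro exI[of _ UNIV] exI[of _ e]) simp
    next
      fix g assume "open_embedding upper_half_plane M g" "g 0 = x" "g ` upper_half_plane \<subseteq> N"
      then show ?thesis using half_plane_facts by (intro exI[of _ upper_half_plane] exI[of _ g]) simp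
    qed
    then show thesis using that by (elim exE conjE)
  qed
  show thesis
    by (rule that[of "g ` C"]) (use g open_embedding_openin[OF g(1)] path_connected_chart_diff_finite[OF g(1,5,6) assms(4)] in auto)
qed

text \<open>The clopen set is taken in \<open>M\<close>, not in the punctured surface:
  \<open>A\<close> consists of the points, possibly in \<open>S\<close>, with a neighbourhood whose
  part outside \<open>S\<close> lies in the path component of \<open>x0\<close>. Thus connectedness
  of \<open>M\<close> applies directly, and small chart neighbourhoods remain path connected and
  nonempty when \<open>S\<close> is removed.\<close>

proposition surface_minus_finite_path_connected:
  assumes M: "surface_with_boundary M" and con: "connected_space M" and S: "finite S"
  shows "path_connected_space (subtopology M (topspace M - S))"
  unfolding path_connected_space_iff_path_component
proof (intro ballI)
  let ?Y = "subtopology M (topspace M - S)"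
  fix x0 y assume x0: "x0 \<in> topspace ?Y" and y: "y \<in> topspace ?Y"
  define A where "A = {x. \<exists>W. openin M W \<and> x \<in> W \<and> W - S \<subseteq> Collect (path_component_of ?Y x0)}"
  have step: "W - S \<subseteq> Collect (path_component_of ?Y x0)"
    if W: "openin M W" "path_connectedin M (W - S)" and z: "z \<in> W - S" "path_component_of ?Y x0 z" for W z
  proof
    fix w assume w: "w \<in> W - S"
    have "W - S \<subseteq> topspace M - S" using openin_subset[OF W(1)] by blast
    then have "path_connectedin ?Y (W - S)" using W(2) by (simp add: path_connectedin_subtopology)
    then have "path_component_of ?Y z w" using z(1) w unfolding path_component_of by blast
    then show "w \<in> Collect (path_component_of ?Y x0)" using z(2) path_component_of_trans[of ?Y x0 z w] by simp
  qed
  have opA: "openin M A"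
    by (subst openin_subopen) (auto simp: A_def)
  have "openin M (topspace M - A)"
  proof (subst openin_subopen, intro ballI)
    fix x assume x: "x \<in> topspace M - A"
    then have "x \<in> topspace M" by simp
    then obtain W where W: "openin M W" "x \<in> W" "W \<subseteq> topspace M" "path_connectedin M (W - S)" "W - S \<noteq> {}"
      by (rule surface_nice_neighbourhood[OF M openin_topspace _ S]) (rule that)
    have no: "\<not> path_component_of ?Y x0 z" if "z \<in> W - S" for z
      using step[OF W(1,4) that] x W(1,2) unfolding A_def by blast
    have "W \<subseteq> topspace M - A"
    proof
      fix w assume w: "w \<in> W"
      have "w \<notin> A"
      proof
        assume "w \<in> A"
        then obtain V where V: "openin M V" "w \<in> V" "V - S \<subseteq> Collect (path_component_of ?Y x0)" by (auto simp: A_def)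
        have "openin M (W \<inter> V)" "w \<in> W \<inter> V" using W(1) V(1,2) w by auto
        then obtain W' where "openin M W'" "w \<in> W'" "W' \<subseteq> W \<inter> V" "path_connectedin M (W' - S)" "W' - S \<noteq> {}"
          by (rule surface_nice_neighbourhood[OF M _ _ S]) (rule that)
        then obtain z where "z \<in> W - S" "z \<in> V - S" by blast
        then show False using no V(3) by blast
      qed
      then show "w \<in> topspace M - A" using w W(3) by blast
    qed
    then show "\<exists>T. openin M T \<and> x \<in> T \<and> T \<subseteq> topspace M - A" using W by blast
  qed
  then have "closedin M A" using openin_subset[OF opA] by (simp add: closedin_def)
  then have "A = {} \<or> A = topspace M" using con opA unfolding connected_space_clopen_in by simp
  moreover have "x0 \<in> A"
  proof -
    have "x0 \<in> topspace M" using x0 by simp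
    then obtain W where W: "openin M W" "x0 \<in> W" "W \<subseteq> topspace M" "path_connectedin M (W - S)" "W - S \<noteq> {}"
      by (rule surface_nice_neighbourhood[OF M openin_topspace _ S]) (rule that)
    have p: "path_component_of ?Y x0 x0" by (simp only: path_component_of_refl x0)
    have "x0 \<in> W - S" using W(2) x0 by simp
    then have "W - S \<subseteq> Collect (path_component_of ?Y x0)" by (rule step[OF W(1,4) _ p])
    then show ?thesis using W(1,2) unfolding A_def by blast
  qed
  ultimately have "A = topspace M" by auto
  then have "y \<in> A" using y by simp
  then show "path_component_of ?Y x0 y" using y by (auto simp: A_def)
qed

text \<open>The points are moved one at a time, each along a path in the complement of all the
  others. The tuple \<open>v k\<close> has its first \<open>k\<close> points moved already;
  disjointness of the two configurations keeps every \<open>v k\<close> injective.\<close>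

proposition config_path:
  assumes M: "surface_with_boundary M" "connected_space M"
    and z: "z \<in> topspace (ordered_config M n)" and w: "w \<in> topspace (ordered_config M n)"
    and disj: "z ` {..<n} \<inter> w ` {..<n} = {}"
  shows "path_component_of (ordered_config M n) z w"
proof -
  let ?F = "ordered_config M n"
  define v where "v k = (\<lambda>i\<in>{..<n}. if i < k then w i else z i)" for k
  have inj: "inj_on z {..<n}" "inj_on w {..<n}" and top: "z i \<in> topspace M" "w i \<in> topspace M" if "i < n" for i
    using z w that by (auto simp: topspace_ordered_config)
  have ne: "z i \<noteq> w j" if "i < n" "j < n" for i j using disj that by blast
  have vinj: "inj_on (v k) {..<n}" for k
  proof (rule inj_onI)
    fix i j assume ij: "i \<in> {..<n}" "j \<in> {..<n}" "v k i = v k j"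
    then show "i = j"
      using inj_onD[OF inj(1)[of i], of i j] inj_onD[OF inj(2)[of i], of i j] ne[of i j] ne[of j i]
      by (auto simp: v_def split: if_splits)
  qed
  have "path_component_of ?F z (v k)" if "k \<le> n" for k
    using that
  proof (induction k)
    case 0
    have "v 0 = z" using z by (auto simp: v_def topspace_ordered_config PiE_def extensional_def restrict_def)
    then show ?case using z by (simp add: path_component_of_refl)
  next
    case (Suc k)
    then have k: "k < n" by simp
    define S where "S = v k ` ({..<n} - {k})"
    have "finite S" by (simp add: S_def)
    have vi: "v k i = (if i < k then w i else z i)" if "i < n" for i using that by (simp add: v_def)
    have nS: "z k \<noteq> v k i \<and> w k \<noteq> v k i" if "i < n" "i \<noteq> k" for i
      using vi[OF that(1)] ne[OF k that(1)] ne[OF that(1) k] that k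
        inj_onD[OF inj(1)[OF k], of k i] inj_onD[OF inj(2)[OF k], of k i] by (cases "i < k") auto
    then have "z k \<notin> S" "w k \<notin> S" unfolding S_def by blast+
    then have "z k \<in> topspace (subtopology M (topspace M - S))" "w k \<in> topspace (subtopology M (topspace M - S))"
      using top k by auto
    then obtain \<gamma> where \<gamma>: "pathin (subtopology M (topspace M - S)) \<gamma>" "\<gamma> 0 = z k" "\<gamma> 1 = w k"
      using surface_minus_finite_path_connected[OF M \<open>finite S\<close>]
      unfolding path_connected_space_iff_path_component path_component_of_def by blast
    define p where "p t = (v k)(k := \<gamma> t)" for t
    have \<gamma>S: "\<gamma> t \<notin> S" if "t \<in> {0..1}" for t using pathin_in_topspace[OF \<gamma>(1) that] by simp
    have \<gamma>M: "continuous_map (top_of_set {0..1}) M \<gamma>"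
      using \<gamma>(1) by (simp add: pathin_def continuous_map_in_subtopology)
    have "pathin ?F p"
      unfolding pathin_def continuous_map_ordered_config
    proof (intro conjI allI impI ballI)
      show "continuous_map (top_of_set {0..1}) M (\<lambda>t. p t i)" if "i < n" for i
        using \<gamma>M top that by (cases "i = k") (auto simp: p_def v_def)
      fix t :: real assume t: "t \<in> topspace (top_of_set {0..1})"
      show "p t \<in> extensional {..<n}" using k by (auto simp: p_def v_def extensional_def)
      show "inj_on (p t) {..<n}"
      proof (rule inj_onI)
        fix i j assume ij: "i \<in> {..<n}" "j \<in> {..<n}" "p t i = p t j"
        have "\<gamma> t \<noteq> v k l" if "l < n" "l \<noteq> k" for l using \<gamma>S[of t] t that unfolding S_def by auto
        then show "i = j" using ij inj_onD[OF vinj, of k i j] by (auto simp: p_def split: if_splits) metis+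
      qed
    qed
    moreover have "p 0 = v k" using \<gamma>(2) k by (auto simp: p_def v_def)
    moreover have "p 1 = v (Suc k)" using \<gamma>(3) k by (auto simp: p_def v_def fun_eq_iff less_Suc_eq)
    ultimately have "path_component_of ?F (v k) (v (Suc k))" unfolding path_component_of_def by blast
    then show ?case using Suc path_component_of_trans[of ?F z "v k"] by simp
  qed
  moreover have "v n = w" using w by (auto simp: v_def topspace_ordered_config PiE_def extensional_def restrict_def)
  ultimately show ?thesis by (metis order_refl)
qed

section \<open>Pushing a compact surface into its interior\<close>

text \<open>In the chart, points move upwards by \<open>max 0 (1 - norm z) / 2\<close>. The
  displacement is vertical and its length is 1/2-Lipschitz, so two points with the same image
  satisfy \<open>norm (z - w) \<le> norm (z - w) / 2\<close>. Outside the unit disc nothing moves,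
  so the map extends by the identity.\<close>

lemma half_plane_push:
  assumes M: "Hausdorff_space M" and g: "open_embedding upper_half_plane M g"
  obtains f where "continuous_map M M f" "inj_on f (topspace M)"
    "\<And>x. x \<notin> g ` upper_half_plane \<Longrightarrow> f x = x"
    "\<And>x. x \<in> topspace M \<Longrightarrow> f x = x \<or> f x \<in> manifold_interior M"
    "\<And>x. x \<in> g ` (upper_half_plane \<inter> ball 0 1) \<Longrightarrow> f x \<in> manifold_interior M"
proof -
  let ?C = upper_half_plane
  define \<phi> :: "complex \<Rightarrow> complex" where "\<phi> z = z + of_real (max 0 (1 - norm z) / 2) * \<i>" for z
  have im: "Im (\<phi> z) = Im z + max 0 (1 - norm z) / 2" for z by (simp add: \<phi>_def)
  have re: "Re (\<phi> z) = Re z" for z by (simp add: \<phi>_def)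
  have inj\<phi>: "z = w" if "\<phi> z = \<phi> w" for z w
  proof -
    have "norm (z - w) = \<bar>Im z - Im w\<bar>" using arg_cong[OF that, of Re] re by (simp add: cmod_def)
    moreover have "\<bar>max 0 (1 - norm z) - max 0 (1 - norm w)\<bar> \<le> norm (z - w)"
      using norm_triangle_ineq3[of z w] by linarith
    moreover have "Im z - Im w = (max 0 (1 - norm w) - max 0 (1 - norm z)) / 2"
      using arg_cong[OF that, of Im] im by (simp add: field_simps)
    then have "\<bar>Im z - Im w\<bar> = \<bar>max 0 (1 - norm z) - max 0 (1 - norm w)\<bar> / 2"
      by (metis abs_divide abs_minus_commute abs_numeral)
    ultimately have "norm (z - w) \<le> norm (z - w) / 2"
      using divide_right_mono[of "\<bar>max 0 (1 - norm z) - max 0 (1 - norm w)\<bar>" "norm (z - w)" 2] by simp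
    then show ?thesis by simp
  qed
  have C\<phi>: "\<phi> z \<in> ?C" if "z \<in> ?C" for z using that im[of z] by simp
  define f where "f x = (if x \<in> g ` ?C then g (\<phi> (inv_into ?C g x)) else x)" for x
  have injg: "inj_on g ?C" using g by (simp add: open_embedding_def)
  have fg: "f (g z) = g (\<phi> z)" if "z \<in> ?C" for z using that injg by (simp add: f_def inv_into_f_f)
  have "compact (?C \<inter> cball 0 1)" using half_plane_facts(3) by (simp add: closed_Int_compact)
  then have "closedin M (g ` (?C \<inter> cball 0 1))" using open_embedding_compact_image[OF g M] by blast
  then have "continuous_map M M f"
    unfolding f_def
  proof (rule chart_gluing_simple[OF g])
    show "continuous_map (top_of_set ?C) M (\<lambda>z. g (\<phi> z))"
      by (rule open_embedding_compose[OF g]) (use C\<phi> in \<open>auto simp: \<phi>_def intro!: continuous_intros\<close>)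
    show "continuous_map (subtopology M (topspace M - g ` (?C \<inter> cball 0 1))) M (\<lambda>x. x)"
      by (simp add: continuous_map_from_subtopology)
    show "g (\<phi> z) = g z" if "z \<in> ?C" "z \<notin> ?C \<inter> cball 0 1" for z using that by (simp add: \<phi>_def)
  qed auto
  moreover have "inj_on f (topspace M)"
  proof (rule inj_onI)
    fix x y assume e: "f x = f y"
    have out: "f x \<in> g ` ?C \<longleftrightarrow> x \<in> g ` ?C" for x
    proof (cases "x \<in> g ` ?C")
      case True
      then obtain z where z: "z \<in> ?C" "x = g z" by blast
      then have "f x \<in> g ` ?C" using fg[OF z(1)] imageI[OF C\<phi>[OF z(1)], of g] by simp
      then show ?thesis using True by simp
    qed (simp add: f_def)
    show "x = y"
    proof (cases "x \<in> g ` ?C")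
      case True
      moreover from this have "y \<in> g ` ?C" using e out by metis
      ultimately obtain z w where zw: "z \<in> ?C" "w \<in> ?C" "x = g z" "y = g w" by blast
      then have "g (\<phi> z) = g (\<phi> w)" using e fg by metis
      then have "\<phi> z = \<phi> w" using inj_onD[OF injg] C\<phi> zw by metis
      then show ?thesis using inj\<phi> zw by metis
    next
      case False
      then have "y \<notin> g ` ?C" using e out by metis
      then show ?thesis using e False by (simp add: f_def)
    qed
  qed
  moreover have int: "f (g z) \<in> manifold_interior M" if "z \<in> ?C" "norm z < 1" for z
  proof -
    have "Im (\<phi> z) > 0" using im[of z] that by (simp add: add_nonneg_pos)
    then show ?thesis using manifold_interior_half_chart[OF g] fg[OF that(1)] by simp
  qed
  moreover have "f x = x \<or> f x \<in> manifold_interior M" for x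
  proof (cases "x \<in> g ` ?C")
    case True
    then obtain z where z: "z \<in> ?C" "x = g z" by blast
    show ?thesis
    proof (cases "norm z < 1")
      case False
      then have "\<phi> z = z" by (simp add: \<phi>_def)
      then show ?thesis using z fg by simp
    qed (use int z in blast)
  qed (simp add: f_def)
  moreover have "f x = x" if "x \<notin> g ` ?C" for x using that by (simp only: f_def if_False)
  moreover have "f x \<in> manifold_interior M" if h: "x \<in> g ` (?C \<inter> ball 0 1)" for x
  proof -
    obtain z where "z \<in> ?C" "norm z < 1" "x = g z" using h by auto
    then show ?thesis using int by simp
  qed
  ultimately show thesis
    by (intro that[of f])
qed

text \<open>By compactness, finitely many half-disc pushes reach all points outside the interior,
  and they are composed. The charts avoid \<open>K\<close>, which therefore stays in place; later
  \<open>K\<close> is a disc containing the strands of the braid \<open>y\<close>.\<close>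

proposition push_into_interior:
  assumes M: "surface_with_boundary M" "compact_space M" and K: "closedin M K" "K \<subseteq> manifold_interior M"
  obtains f where "continuous_map M M f" "inj_on f (topspace M)"
    "\<And>x. x \<in> topspace M \<Longrightarrow> f x \<in> manifold_interior M" "\<And>x. x \<in> K \<Longrightarrow> f x = x"
proof -
  let ?C = upper_half_plane and ?I = "manifold_interior M"
  have T2: "Hausdorff_space M" using M(1) by (simp add: surface_with_boundary_def)
  define \<G> where "\<G> = {g. open_embedding ?C M g \<and> g ` ?C \<inter> K = {}}"
  \<comment> \<open>A point that is not yet in the interior must still be at its old place, or else
    a later push in the chart around that place could miss it; hence the alternative
    \<open>f x = x\<close> in the invariant.\<close>
  have fin: "\<exists>f. continuous_map M M f \<and> inj_on f (topspace M) \<and> (\<forall>x\<in>K. f x = x) \<and> (\<forall>x\<in>topspace M. f x = x \<or> f x \<in> ?I) \<and>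
       (\<forall>g\<in>G. \<forall>x\<in>g ` (?C \<inter> ball 0 1). f x \<in> ?I)" if "finite G" "G \<subseteq> \<G>" for G
    using that
  proof (induction G rule: finite_induct)
    case empty
    show ?case by (intro exI[of _ "\<lambda>x. x"]) simp
  next
    case (insert g G)
    then obtain f where f: "continuous_map M M f" "inj_on f (topspace M)" "\<forall>x\<in>K. f x = x"
      "\<forall>x\<in>topspace M. f x = x \<or> f x \<in> ?I" "\<forall>g\<in>G. \<forall>x\<in>g ` (?C \<inter> ball 0 1). f x \<in> ?I"
      by auto
    have g: "open_embedding ?C M g" "g ` ?C \<inter> K = {}" using insert by (auto simp: \<G>_def)
    obtain h where h: "continuous_map M M h" "inj_on h (topspace M)"
      "\<And>x. x \<notin> g ` ?C \<Longrightarrow> h x = x"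
      "\<And>x. x \<in> topspace M \<Longrightarrow> h x = x \<or> h x \<in> ?I" "\<And>x. x \<in> g ` (?C \<inter> ball 0 1) \<Longrightarrow> h x \<in> ?I"
      by (rule half_plane_push[OF T2 g(1)]) (rule that)
    have ft: "f x \<in> topspace M" if "x \<in> topspace M" for x using f(1) that by (auto simp: continuous_map_def)
    have hI: "h x \<in> ?I" if "x \<in> topspace M" "x \<in> ?I" for x using h(4)[OF that(1)] that(2) by auto
    have gt: "x \<in> topspace M" if "x \<in> g' ` (?C \<inter> ball 0 1)" "g' \<in> insert g G" for x g'
      using that insert.prems open_embedding_topspace[of ?C M g'] by (auto simp: \<G>_def)
    show ?case
    proof (intro exI[of _ "\<lambda>x. h (f x)"] conjI ballI)
      show "continuous_map M M (\<lambda>x. h (f x))" using continuous_map_compose[OF f(1) h(1)] by (simp add: o_def)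
      show "inj_on (\<lambda>x. h (f x)) (topspace M)"
        using f(2) h(2) ft by (intro inj_onI) (metis inj_onD)
      show "h (f x) = x" if "x \<in> K" for x using that f(3) h(3)[of x] g(2) by fastforce
      show "h (f x) = x \<or> h (f x) \<in> ?I" if "x \<in> topspace M" for x
        using f(4) h(4)[OF that] hI[OF ft[OF that]] that by metis
      show "h (f x) \<in> ?I" if g': "g' \<in> insert g G" and x: "x \<in> g' ` (?C \<inter> ball 0 1)" for g' x
      proof (cases "f x \<in> ?I")
        case True
        then show ?thesis using hI ft gt[OF x g'] by blast
      next
        case False
        then have "f x = x" "g' = g" using f(4,5) gt[OF x g'] g' x by blast+
        then show ?thesis using h(5) x by simp
      qed
    qed
  qed
  let ?B = "topspace M - ?I"
  have "openin M ?I"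
  proof (subst openin_subopen, intro ballI)
    fix x assume "x \<in> ?I"
    then obtain e where e: "open_embedding UNIV M e" "x \<in> range e" by (auto simp: manifold_interior_def)
    then have "range e \<subseteq> ?I" by (auto simp: manifold_interior_def)
    then show "\<exists>T. openin M T \<and> x \<in> T \<and> T \<subseteq> ?I" using e open_embedding_openin[OF e(1)] by blast
  qed
  then have B: "compactin M ?B" using M(2) closedin_compact_space by blast
  have cover: "?B \<subseteq> \<Union>((\<lambda>g. g ` (?C \<inter> ball 0 1)) ` \<G>)"
  proof
    fix x assume x: "x \<in> ?B"
    then have "openin M (topspace M - K)" "x \<in> topspace M - K" using K by auto
    from surface_chart[OF M(1) this] obtain g where g: "open_embedding ?C M g" "g 0 = x" "g ` ?C \<subseteq> topspace M - K"
      using x unfolding manifold_interior_def by blast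
    then have "g \<in> \<G>" by (auto simp: \<G>_def)
    moreover have "x \<in> g ` (?C \<inter> ball 0 1)" using g(2) by (intro image_eqI[of _ _ 0]) auto
    ultimately show "x \<in> \<Union>((\<lambda>g. g ` (?C \<inter> ball 0 1)) ` \<G>)" by blast
  qed
  have "openin M U" if h: "U \<in> (\<lambda>g. g ` (?C \<inter> ball 0 1)) ` \<G>" for U
  proof -
    obtain g where "open_embedding ?C M g" "U = g ` (?C \<inter> ball 0 1)" using h unfolding \<G>_def by blast
    then show ?thesis using open_embedding_openin_image[of ?C M g "ball 0 1"] by simp
  qed
  then have "\<exists>\<F>. finite \<F> \<and> \<F> \<subseteq> (\<lambda>g. g ` (?C \<inter> ball 0 1)) ` \<G> \<and> ?B \<subseteq> \<Union>\<F>"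
    by (rule compactinD[OF B _ cover])
  then obtain G where G: "finite G" "G \<subseteq> \<G>" "?B \<subseteq> \<Union>((\<lambda>g. g ` (?C \<inter> ball 0 1)) ` G)"
    by (metis finite_subset_image)
  obtain f where f: "continuous_map M M f" "inj_on f (topspace M)" "\<forall>x\<in>K. f x = x"
      "\<forall>x\<in>topspace M. f x = x \<or> f x \<in> ?I" "\<forall>g\<in>G. \<forall>x\<in>g ` (?C \<inter> ball 0 1). f x \<in> ?I"
    using fin[OF G(1,2)] by blast
  have "f x \<in> ?I" if x: "x \<in> topspace M" for x
  proof (cases "x \<in> ?I")
    case True
    then show ?thesis using f(4) x by metis
  next
    case False
    then obtain g where "g \<in> G" "x \<in> g ` (?C \<inter> ball 0 1)" using G(3) x by blast
    then show ?thesis using f(5) by blast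
  qed
  then show thesis using that[OF f(1,2)] f(3) by blast
qed

section \<open>Trivializing moving points over a disc\<close>

text \<open>An automorphism of the product bundle with base \<open>T\<close> and fibre
  \<open>M\<close>. The inverse family \<open>k\<close> is part of the data, with its own joint
  continuity.\<close>

definition isotopy :: "'t topology \<Rightarrow> 'a topology \<Rightarrow> ('t \<Rightarrow> 'a \<Rightarrow> 'a) \<Rightarrow> ('t \<Rightarrow> 'a \<Rightarrow> 'a) \<Rightarrow> bool" where
  "isotopy T M h k \<longleftrightarrow> continuous_map (prod_topology T M) M (\<lambda>p. h (fst p) (snd p)) \<and>
     continuous_map (prod_topology T M) M (\<lambda>p. k (fst p) (snd p)) \<and>
     (\<forall>t\<in>topspace T. \<forall>m\<in>topspace M. k t (h t m) = m \<and> h t (k t m) = m)"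

lemma isotopyD:
  assumes "isotopy T M h k" "t \<in> topspace T" "m \<in> topspace M"
  shows "k t (h t m) = m" "h t (k t m) = m" "h t m \<in> topspace M" "k t m \<in> topspace M"
proof -
  show "k t (h t m) = m" "h t (k t m) = m" using assms by (simp_all add: isotopy_def)
  have "(t, m) \<in> topspace (prod_topology T M)" using assms by simp
  then show "h t m \<in> topspace M" "k t m \<in> topspace M"
    using assms(1) unfolding isotopy_def continuous_map_def by (fastforce simp: Pi_iff)+
qed

lemma isotopy_inverse: "isotopy T M h k \<Longrightarrow> isotopy T M k h"
  by (simp add: isotopy_def)

lemma isotopy_apply_continuous:
  assumes "isotopy T M h k" "continuous_map S T r" "continuous_map S M y"
  shows "continuous_map S M (\<lambda>s. h (r s) (y s))"
proof -
  have "continuous_map S (prod_topology T M) (\<lambda>s. (r s, y s))" using assms(2,3) by (rule continuous_map_pairedI)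
  from continuous_map_compose[OF this assms(1)[unfolded isotopy_def, THEN conjunct1]]
  show ?thesis by (simp add: o_def)
qed

lemma isotopy_pullback:
  assumes "isotopy T M h k" "continuous_map S T r"
  shows "isotopy S M (\<lambda>s. h (r s)) (\<lambda>s. k (r s))"
proof -
  have r: "continuous_map (prod_topology S M) T (\<lambda>p. r (fst p))"
    using continuous_map_compose[OF continuous_map_fst assms(2)] by (simp add: o_def)
  have rt: "r s \<in> topspace T" if "s \<in> topspace S" for s using assms(2) that by (auto simp: continuous_map_def)
  show ?thesis
    unfolding isotopy_def
    using isotopy_apply_continuous[OF assms(1) r continuous_map_snd]
      isotopy_apply_continuous[OF isotopy_inverse[OF assms(1)] r continuous_map_snd] isotopyD(1,2)[OF assms(1) rt]
    by simp
qed

lemma isotopy_compose: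
  assumes "isotopy T M h k" "isotopy T M h' k'"
  shows "isotopy T M (\<lambda>t m. h t (h' t m)) (\<lambda>t m. k' t (k t m))"
  unfolding isotopy_def
proof (intro conjI ballI)
  show "continuous_map (prod_topology T M) M (\<lambda>p. h (fst p) (h' (fst p) (snd p)))"
    by (rule isotopy_apply_continuous[OF assms(1) continuous_map_fst isotopy_apply_continuous[OF assms(2) continuous_map_fst continuous_map_snd]])
  show "continuous_map (prod_topology T M) M (\<lambda>p. k' (fst p) (k (fst p) (snd p)))"
    by (rule isotopy_apply_continuous[OF isotopy_inverse[OF assms(2)] continuous_map_fst
          isotopy_apply_continuous[OF isotopy_inverse[OF assms(1)] continuous_map_fst continuous_map_snd]])
  fix t m assume "t \<in> topspace T" "m \<in> topspace M"
  then show "k' t (k t (h t (h' t m))) = m" "h t (h' t (k' t (k t m))) = m"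
    using isotopyD[OF assms(1)] isotopyD[OF assms(2)] by simp_all
qed

text \<open>Each \<open>h t\<close> is a homeomorphism and carries planar charts to planar
  charts.\<close>

lemma isotopy_interior:
  assumes "isotopy T M h k" "t \<in> topspace T" "m \<in> manifold_interior M"
  shows "h t m \<in> manifold_interior M"
proof -
  obtain e z where e: "open_embedding UNIV M e" "m = e z" using assms(3) by (auto simp: manifold_interior_def)
  have c: "continuous_map M T (\<lambda>_. t)" using assms(2) by simp
  have "homeomorphic_maps M M (h t) (k t)"
    unfolding homeomorphic_maps_def
    using isotopy_apply_continuous[OF assms(1) c continuous_map_id] isotopy_apply_continuous[OF isotopy_inverse[OF assms(1)] c continuous_map_id]
      isotopyD(1,2)[OF assms(1,2)] by simp
  then have ht: "homeomorphic_map M M (h t)" unfolding homeomorphic_map_maps by blast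
  have "open_embedding UNIV M (\<lambda>z. h t (e z))"
    unfolding open_embedding_def
  proof (intro conjI)
    show "continuous_map (top_of_set UNIV) M (\<lambda>z. h t (e z))"
      using continuous_map_compose[OF _ homeomorphic_imp_continuous_map[OF ht], of "top_of_set UNIV" e] e(1) by (simp add: o_def open_embedding_def)
    show "open_map (top_of_set UNIV) M (\<lambda>z. h t (e z))"
      using open_map_compose[OF _ homeomorphic_imp_open_map[OF ht], of "top_of_set UNIV" e] e(1) by (simp add: o_def open_embedding_def)
    show "inj (\<lambda>z. h t (e z))"
    proof (rule injI)
      fix z w assume "h t (e z) = h t (e w)"
      then have "k t (h t (e z)) = k t (h t (e w))" by simp
      then have "e z = e w" using isotopyD(1)[OF assms(1,2)] open_embedding_topspace[OF e(1)] by simp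
      then show "z = w" using e(1) by (simp add: open_embedding_def inj_eq)
    qed
  qed
  then show ?thesis using e(2) unfolding manifold_interior_def by blast
qed

lemma prod_topology_restrict:
  assumes "B \<subseteq> A"
  shows "subtopology (prod_topology (top_of_set A) M) (B \<times> topspace M) = prod_topology (top_of_set B) M"
  using assms by (simp add: subtopology_Times subtopology_subtopology Int_absorb1)

lemma isotopy_glue:
  fixes A :: "'b::topological_space set" and p :: "'b \<Rightarrow> real"
  assumes p: "continuous_on A p"
    and 1: "isotopy (top_of_set {x \<in> A. p x \<le> c}) M h1 k1" and 2: "isotopy (top_of_set {x \<in> A. c \<le> p x}) M h2 k2"
    and eq: "\<And>x m. x \<in> A \<Longrightarrow> p x = c \<Longrightarrow> m \<in> topspace M \<Longrightarrow> h1 x m = h2 x m \<and> k1 x m = k2 x m"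
  shows "isotopy (top_of_set A) M (\<lambda>x. if p x \<le> c then h1 x else h2 x) (\<lambda>x. if p x \<le> c then k1 x else k2 x)"
proof -
  let ?X = "prod_topology (top_of_set A) M"
  have p': "continuous_map ?X euclideanreal (\<lambda>x. p (fst x))"
    using continuous_map_compose[OF continuous_map_fst, of "top_of_set A" euclideanreal p M] p by (simp add: o_def)
  have s: "{x \<in> topspace ?X. p (fst x) \<le> c} = {x \<in> A. p x \<le> c} \<times> topspace M"
    "{x \<in> topspace ?X. c \<le> p (fst x)} = {x \<in> A. c \<le> p x} \<times> topspace M" by auto
  have sub: "subtopology ?X {x \<in> topspace ?X. p (fst x) \<le> c} = prod_topology (top_of_set {x \<in> A. p x \<le> c}) M"
    "subtopology ?X {x \<in> topspace ?X. c \<le> p (fst x)} = prod_topology (top_of_set {x \<in> A. c \<le> p x}) M"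
    unfolding s by (rule prod_topology_restrict; blast)+
  have glue: "continuous_map ?X M (\<lambda>x. if p (fst x) \<le> c then f1 x else f2 x)"
    if "continuous_map (prod_topology (top_of_set {x \<in> A. p x \<le> c}) M) M f1"
      "continuous_map (prod_topology (top_of_set {x \<in> A. c \<le> p x}) M) M f2"
      "\<And>x. x \<in> A \<times> topspace M \<Longrightarrow> p (fst x) = c \<Longrightarrow> f1 x = f2 x" for f1 f2
    by (rule continuous_map_cases_le[OF p']) (use that sub in auto)
  have i: "(\<lambda>q. (if p (fst q) \<le> c then a (fst q) else b (fst q)) (snd q)) = (\<lambda>q. if p (fst q) \<le> c then a (fst q) (snd q) else b (fst q) (snd q))"
    for a b :: "'b \<Rightarrow> 'a \<Rightarrow> 'a" by auto
  show ?thesis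
    unfolding isotopy_def i
  proof (intro conjI ballI)
    show "continuous_map ?X M (\<lambda>q. if p (fst q) \<le> c then h1 (fst q) (snd q) else h2 (fst q) (snd q))"
      using 1 2 eq unfolding isotopy_def by (intro glue) auto
    show "continuous_map ?X M (\<lambda>q. if p (fst q) \<le> c then k1 (fst q) (snd q) else k2 (fst q) (snd q))"
      using 1 2 eq unfolding isotopy_def by (intro glue) auto
    fix t m assume t: "t \<in> topspace (top_of_set A)" "m \<in> topspace M"
    show "(if p t \<le> c then k1 t else k2 t) ((if p t \<le> c then h1 t else h2 t) m) = m"
      "(if p t \<le> c then h1 t else h2 t) ((if p t \<le> c then k1 t else k2 t) m) = m"
      using isotopyD(1,2)[OF 1, of t m] isotopyD(1,2)[OF 2, of t m] t by (cases "p t \<le> c"; simp)+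
  qed
qed

section \<open>Dragging a point along by an isotopy\<close>

text \<open>Translation by \<open>a\<close>, damped by a tent function: the origin goes to
  \<open>a\<close>, and everything outside the unit disc is fixed.\<close>

definition radial_push :: "complex \<Rightarrow> complex \<Rightarrow> complex" where
  "radial_push a z = z + of_real (max 0 (1 - norm z)) * a"

text \<open>For \<open>norm a \<le> 1/2\<close> the displacement is a 1/2-Lipschitz function of
  \<open>z\<close>. One inequality yields both injectivity, with \<open>a = a'\<close>, and joint
  continuity of the inverse, with \<open>a\<close> varying.\<close>

lemma radial_push_expand:
  assumes "norm a \<le> 1/2"
  shows "norm (z - z') \<le> 2 * (norm (radial_push a z - radial_push a' z') + norm (a - a'))"
proof -
  let ?m = "\<lambda>z::complex. max 0 (1 - norm z)"
  have eq: "z - z' = (radial_push a z - radial_push a' z') - of_real (?m z - ?m z') * a - of_real (?m z') * (a - a')"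
    by (simp add: radial_push_def algebra_simps)
  have "\<bar>?m z - ?m z'\<bar> \<le> norm (z - z')" using norm_triangle_ineq3[of z z'] by linarith
  then have 1: "norm (of_real (?m z - ?m z') * a) \<le> norm (z - z') * (1/2)"
    unfolding norm_mult norm_of_real using assms by (intro mult_mono) auto
  have 2: "norm (of_real (?m z') * (a - a')) \<le> 1 * norm (a - a')"
    unfolding norm_mult norm_of_real by (intro mult_right_mono) auto
  have "norm (z - z') \<le> norm (radial_push a z - radial_push a' z') + norm (of_real (?m z - ?m z') * a) + norm (of_real (?m z') * (a - a'))"
    by (subst eq) (meson add_mono norm_triangle_ineq4 order_refl order_trans)
  then show ?thesis using 1 2 by (simp add: algebra_simps)
qed

lemma radial_push_inverse:
  obtains \<psi> where "continuous_on (cball 0 (1/2) \<times> UNIV) (\<lambda>p. \<psi> (fst p) (snd p))"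
    "\<And>a z. norm a \<le> 1/2 \<Longrightarrow> \<psi> a (radial_push a z) = z" "\<And>a z. norm a \<le> 1/2 \<Longrightarrow> radial_push a (\<psi> a z) = z"
proof -
  have "\<exists>z. radial_push a z = w" if "norm a \<le> 1/2" for a w
  proof -
    \<comment> \<open>A preimage of \<open>w\<close> is a fixed point of \<open>?f\<close>, a
      contraction with factor 1/2.\<close>
    let ?f = "\<lambda>z. w - of_real (max 0 (1 - norm z)) * a"
    have "dist (?f x) (?f y) \<le> 1/2 * dist x y" for x y :: complex
    proof -
      have "norm (?f x - ?f y) = \<bar>max 0 (1 - norm y) - max 0 (1 - norm x)\<bar> * norm a"
      proof -
        have "?f x - ?f y = of_real (max 0 (1 - norm y) - max 0 (1 - norm x)) * a" by (simp add: algebra_simps)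
        then show ?thesis by (simp only: norm_mult norm_of_real)
      qed
      also have "\<dots> \<le> norm (x - y) * (1/2)"
        using that norm_triangle_ineq3[of x y] by (intro mult_mono) auto
      finally show ?thesis by (simp add: dist_norm)
    qed
    then obtain z where "?f z = z" using banach_fix_type[of "1/2" ?f] by auto
    then have "radial_push a z = w" by (simp add: radial_push_def algebra_simps)
    then show ?thesis by blast
  qed
  then obtain \<psi> where \<psi>: "\<And>a w. norm a \<le> 1/2 \<Longrightarrow> radial_push a (\<psi> a w) = w" by metis
  have inv: "\<psi> a (radial_push a z) = z" if "norm a \<le> 1/2" for a z
    using radial_push_expand[OF that, of "\<psi> a (radial_push a z)" z a] \<psi>[OF that] by simp
  have "continuous_on (cball 0 (1/2) \<times> UNIV) (\<lambda>p. \<psi> (fst p) (snd p))"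
    unfolding continuous_on_iff
  proof (intro ballI allI impI)
    fix x :: "complex \<times> complex" and e :: real assume x: "x \<in> cball 0 (1/2) \<times> UNIV" and e: "e > 0"
    show "\<exists>d>0. \<forall>x'\<in>cball 0 (1/2) \<times> UNIV. dist x' x < d \<longrightarrow> dist (\<psi> (fst x') (snd x')) (\<psi> (fst x) (snd x)) < e"
    proof (intro exI[of _ "e/4"] conjI ballI impI)
      fix x' :: "complex \<times> complex" assume x': "x' \<in> cball 0 (1/2) \<times> UNIV" "dist x' x < e/4"
      have n: "norm (fst x) \<le> 1/2" "norm (fst x') \<le> 1/2" using x x' by auto
      have "dist (\<psi> (fst x') (snd x')) (\<psi> (fst x) (snd x)) \<le> 2 * (dist (snd x') (snd x) + dist (fst x') (fst x))"
        using radial_push_expand[OF n(2), of "\<psi> (fst x') (snd x')" "\<psi> (fst x) (snd x)" "fst x"] \<psi> n by (simp add: dist_norm)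
      then show "dist (\<psi> (fst x') (snd x')) (\<psi> (fst x) (snd x)) < e"
        using x'(2) dist_fst_le[of x' x] dist_snd_le[of x' x] by argo
    qed (use e in auto)
  qed
  then show thesis using that[of \<psi>] \<psi> inv by blast
qed

lemma chart_isotopy:
  assumes M: "Hausdorff_space M" and e: "open_embedding UNIV M e"
  obtains h k where "isotopy (top_of_set (cball 0 (1/2))) M h k"
    "\<And>a. norm a \<le> 1/2 \<Longrightarrow> h a (e 0) = e a" "\<And>a m. m \<notin> range e \<Longrightarrow> h a m = m"
proof -
  let ?T = "top_of_set (cball (0::complex) (1/2))"
  obtain \<psi> where \<psi>: "continuous_on (cball 0 (1/2) \<times> UNIV) (\<lambda>p. \<psi> (fst p) (snd p))"
    "\<And>a z. norm a \<le> 1/2 \<Longrightarrow> \<psi> a (radial_push a z) = z" "\<And>a z. norm a \<le> 1/2 \<Longrightarrow> radial_push a (\<psi> a z) = z"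
    by (rule radial_push_inverse) (rule that)
  have inj: "inj e" using e by (simp add: open_embedding_def)
  have push_out: "radial_push a z = z" if "z \<notin> cball 0 1" for a z using that by (simp add: radial_push_def)
  have \<psi>_out: "\<psi> a z = z" if "norm a \<le> 1/2" "z \<notin> cball 0 1" for a z
    using \<psi>(2)[OF that(1), of z] push_out[OF that(2)] by simp
  have ext: "continuous_map (prod_topology ?T M) M (\<lambda>p. if snd p \<in> range e then e (\<theta> (fst p) (inv_into UNIV e (snd p))) else snd p)"
    if \<theta>: "continuous_on (cball 0 (1/2) \<times> UNIV) (\<lambda>p. \<theta> (fst p) (snd p))"
      "\<And>a z. norm a \<le> 1/2 \<Longrightarrow> z \<notin> cball 0 1 \<Longrightarrow> \<theta> a z = z" for \<theta>
  proof -
    have "closedin M (e ` cball 0 1)" using open_embedding_compact_image(2)[OF e M] by simp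
    then have "continuous_map (prod_topology ?T M) M (\<lambda>(a, m). if m \<in> range e then e (\<theta> a (inv_into UNIV e m)) else m)"
    proof (rule chart_gluing[OF e, of _ ?T M "\<lambda>a z. e (\<theta> a z)" "\<lambda>_ m. m"])
      show "continuous_map (prod_topology ?T (top_of_set UNIV)) M (\<lambda>(a, z). e (\<theta> a z))"
        unfolding prod_topology_top_of_set case_prod_unfold by (rule open_embedding_compose[OF e \<theta>(1)]) simp
      show "continuous_map (prod_topology ?T (subtopology M (topspace M - e ` cball 0 1))) M (\<lambda>(_, m). m)"
        using continuous_map_compose[OF continuous_map_snd continuous_map_from_subtopology[OF continuous_map_id]]
        by (simp add: o_def case_prod_unfold)
    qed (use \<theta>(2) in auto)
    then show ?thesis by (simp add: case_prod_unfold)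
  qed
  define h where "h a m = (if m \<in> range e then e (radial_push a (inv_into UNIV e m)) else m)" for a m
  define k where "k a m = (if m \<in> range e then e (\<psi> a (inv_into UNIV e m)) else m)" for a m
  have cont: "continuous_on (cball 0 (1/2) \<times> UNIV) (\<lambda>p. radial_push (fst p) (snd p))"
    unfolding radial_push_def by (intro continuous_intros)
  have he: "h a (e z) = e (radial_push a z)" "k a (e z) = e (\<psi> a z)" for a z
    using inj by (simp_all add: h_def k_def)
  show thesis
  proof (rule that[of h k])
    show "isotopy ?T M h k"
      unfolding isotopy_def
    proof (intro conjI ballI)
      show "continuous_map (prod_topology ?T M) M (\<lambda>p. h (fst p) (snd p))"
        unfolding h_def by (rule ext[OF cont push_out])
      show "continuous_map (prod_topology ?T M) M (\<lambda>p. k (fst p) (snd p))"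
        unfolding k_def by (rule ext[OF \<psi>(1) \<psi>_out])
      fix a m assume "a \<in> topspace ?T"
      then have a: "norm a \<le> 1/2" by simp
      show "k a (h a m) = m"
      proof (cases "m \<in> range e")
        case True
        then obtain z where "m = e z" by blast
        then show ?thesis using he \<psi>(2)[OF a] by simp
      qed (simp add: h_def k_def)
      show "h a (k a m) = m"
      proof (cases "m \<in> range e")
        case True
        then obtain z where "m = e z" by blast
        then show ?thesis using he \<psi>(3)[OF a] by simp
      qed (simp add: h_def k_def)
    qed
    show "h a (e 0) = e a" for a by (simp add: he radial_push_def)
    show "h a m = m" if "m \<notin> range e" for a m using that by (simp add: h_def)
  qed
qed

text \<open>The moving point \<open>x s\<close> is carried along from a fixed point \<open>b\<close>
  by an isotopy that keeps \<open>Z\<close> fixed. In bundle terms, \<open>M\<close> together with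
  the moving point becomes a product over \<open>A\<close>.\<close>

definition trivializes :: "'a topology \<Rightarrow> 'a set \<Rightarrow> 't::topological_space set \<Rightarrow> ('t \<Rightarrow> 'a) \<Rightarrow> bool" where
  "trivializes M Z A x \<longleftrightarrow> (\<exists>h k b. isotopy (top_of_set A) M h k \<and> b \<in> topspace M \<and>
     (\<forall>s\<in>A. h s b = x s \<and> (\<forall>z\<in>Z. h s z = z)))"

text \<open>On the second half, \<open>h2 s\<close> is replaced by \<open>h1 (r s)\<close> followed
  by \<open>k2 (r s)\<close> and \<open>h2 s\<close>, where \<open>r\<close> retracts this half onto
  the seam. On the seam the composite is \<open>h1\<close>, and elsewhere it sends \<open>b1\<close>
  through \<open>x (r s)\<close> and \<open>b2\<close> to \<open>x s\<close>.\<close>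

lemma trivializes_glue:
  fixes A :: "'b::topological_space set" and p :: "'b \<Rightarrow> real"
  assumes p: "continuous_on A p" and Z: "Z \<subseteq> topspace M"
    and r: "continuous_on {s \<in> A. c \<le> p s} r" "\<And>s. s \<in> A \<Longrightarrow> c \<le> p s \<Longrightarrow> r s \<in> A \<and> p (r s) = c"
      "\<And>s. s \<in> A \<Longrightarrow> p s = c \<Longrightarrow> r s = s"
    and 1: "trivializes M Z {s \<in> A. p s \<le> c} x" and 2: "trivializes M Z {s \<in> A. c \<le> p s} x"
  shows "trivializes M Z A x"
proof -
  let ?A1 = "{s \<in> A. p s \<le> c}" and ?A2 = "{s \<in> A. c \<le> p s}"
  obtain h1 k1 b1 where 1: "isotopy (top_of_set ?A1) M h1 k1" "b1 \<in> topspace M"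
    "\<And>s. s \<in> A \<Longrightarrow> p s \<le> c \<Longrightarrow> h1 s b1 = x s" "\<And>s z. s \<in> A \<Longrightarrow> p s \<le> c \<Longrightarrow> z \<in> Z \<Longrightarrow> h1 s z = z"
    using 1 unfolding trivializes_def by (auto simp only: mem_Collect_eq)
  obtain h2 k2 b2 where 2: "isotopy (top_of_set ?A2) M h2 k2" "b2 \<in> topspace M"
    "\<And>s. s \<in> A \<Longrightarrow> c \<le> p s \<Longrightarrow> h2 s b2 = x s" "\<And>s z. s \<in> A \<Longrightarrow> c \<le> p s \<Longrightarrow> z \<in> Z \<Longrightarrow> h2 s z = z"
    using 2 unfolding trivializes_def by (auto simp only: mem_Collect_eq)
  have r1: "continuous_map (top_of_set ?A2) (top_of_set ?A1) r" and r2: "continuous_map (top_of_set ?A2) (top_of_set ?A2) r"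
    using r(1,2) by (auto simp: continuous_map_in_subtopology)
  define h3 where "h3 s m = h2 s (k2 (r s) (h1 (r s) m))" for s m
  define k3 where "k3 s m = k1 (r s) (h2 (r s) (k2 s m))" for s m
  have 3: "isotopy (top_of_set ?A2) M h3 k3"
    using isotopy_compose[OF 2(1) isotopy_compose[OF isotopy_inverse[OF isotopy_pullback[OF 2(1) r2]] isotopy_pullback[OF 1(1) r1]]]
    unfolding h3_def k3_def .
  have eq: "h1 s m = h3 s m \<and> k1 s m = k3 s m" if s: "s \<in> A" "p s = c" and m: "m \<in> topspace M" for s m
  proof -
    have t: "s \<in> topspace (top_of_set ?A1)" "s \<in> topspace (top_of_set ?A2)" using s by auto
    show ?thesis unfolding h3_def k3_def r(3)[OF s]
      using isotopyD[OF 1(1) t(1) m] isotopyD(2)[OF 2(1) t(2)] m by simp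
  qed
  have I: "isotopy (top_of_set A) M (\<lambda>s. if p s \<le> c then h1 s else h3 s) (\<lambda>s. if p s \<le> c then k1 s else k3 s)"
    by (rule isotopy_glue[OF p 1(1) 3 eq])
  show ?thesis
    unfolding trivializes_def
  proof (intro exI conjI ballI, rule I, rule 1(2))
    fix s assume s: "s \<in> A"
    have k2: "k2 (r s) (x (r s)) = b2" if "c \<le> p s"
      using r(2)[OF s that] 2(3)[of "r s"] isotopyD(1)[OF 2(1), of "r s" b2] 2(2) by simp
    show "(if p s \<le> c then h1 s else h3 s) b1 = x s"
      using s 1(3)[of s] 1(3)[of "r s"] k2 2(3)[of s] r(2)[OF s] by (auto simp: h3_def)
    fix z assume z: "z \<in> Z"
    have "k2 (r s) z = z" if "c \<le> p s"
      using r(2)[OF s that] 2(4)[of "r s" z] isotopyD(1)[OF 2(1), of "r s" z] z Z by auto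
    then show "(if p s \<le> c then h1 s else h3 s) z = z"
      using s z 1(4)[of s z] 1(4)[of "r s" z] 2(4)[of s z] r(2)[OF s] by (auto simp: h3_def)
  qed
qed

lemma small_rectangle:
  fixes u v :: real
  assumes "a \<le> u \<and> u \<le> b \<and> b - a < \<epsilon>/2" "c \<le> v \<and> v \<le> d \<and> d - c < \<epsilon>/2"
  shows "{a..b} \<times> {c..d} \<subseteq> ball (u, v) \<epsilon>"
proof
  fix x assume x: "x \<in> {a..b} \<times> {c..d}"
  have "dist (u, v) x \<le> dist u (fst x) + dist v (snd x)"
    using sqrt_sum_squares_le_sum_abs[of "dist u (fst x)" "dist v (snd x)"] by (simp add: dist_prod_def)
  also have "\<dots> < \<epsilon>" using x assms by (auto simp: dist_real_def)
  finally show "x \<in> ball (u, v) \<epsilon>" by simp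
qed

text \<open>Locally the moving point stays in one chart that avoids \<open>Z\<close>, where
  \<open>chart_isotopy\<close> follows it; the local isotopies are glued rectangle by
  rectangle.\<close>

proposition trivializes_square:
  assumes M: "Hausdorff_space M" and Z: "closedin M Z"
    and x: "continuous_map (top_of_set unit_square) M x"
    and xi: "\<And>s. s \<in> unit_square \<Longrightarrow> x s \<in> manifold_interior M" and xZ: "\<And>s. s \<in> unit_square \<Longrightarrow> x s \<notin> Z"
  shows "trivializes M Z unit_square x"
proof -
  have ZM: "Z \<subseteq> topspace M" using Z closedin_subset by blast
  let ?P = "\<lambda>a b c d. trivializes M Z ({a..b} \<times> {c..d}) x"
  show ?thesis
  proof (rule rectangle_induct[where P = ?P])
    fix a b c d e :: real
    assume le: "a \<le> b" "b \<le> e" "c \<le> d" and h: "?P a b c d" "?P b e c d"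
    have e: "{x \<in> {a..e} \<times> {c..d}. fst x \<le> b} = {a..b} \<times> {c..d}" "{x \<in> {a..e} \<times> {c..d}. b \<le> fst x} = {b..e} \<times> {c..d}"
      using le by auto
    show "?P a e c d"
      by (rule trivializes_glue[OF _ ZM, where p = fst and c = b and r = "\<lambda>s. (b, snd s)"])
        (use h le in \<open>auto simp: e intro!: continuous_intros\<close>)
  next
    fix a b c d e :: real
    assume le: "a \<le> b" "c \<le> d" "d \<le> e" and h: "?P a b c d" "?P a b d e"
    have e: "{x \<in> {a..b} \<times> {c..e}. snd x \<le> d} = {a..b} \<times> {c..d}" "{x \<in> {a..b} \<times> {c..e}. d \<le> snd x} = {a..b} \<times> {d..e}"
      using le by auto
    show "?P a b c e"
      by (rule trivializes_glue[OF _ ZM, where p = snd and c = d and r = "\<lambda>s. (fst s, d)"])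
        (use h le in \<open>auto simp: e intro!: continuous_intros\<close>)
  next
    fix u v :: real assume uv: "u \<in> {0..1}" "v \<in> {0..1}"
    then have uv': "(u, v) \<in> unit_square" by simp
    then have "x (u, v) \<in> topspace M - Z" using x xZ by (auto simp: continuous_map_def)
    moreover have "openin M (topspace M - Z)" using Z by blast
    ultimately obtain e where e: "open_embedding UNIV M e" "e 0 = x (u, v)" "range e \<subseteq> topspace M - Z"
      using interior_chart[OF xi[OF uv']] by metis
    obtain h k where hk: "isotopy (top_of_set (cball 0 (1/2))) M h k"
      "\<And>a. norm a \<le> 1/2 \<Longrightarrow> h a (e 0) = e a" "\<And>a m. m \<notin> range e \<Longrightarrow> h a m = m"
      by (rule chart_isotopy[OF M e(1)]) (rule that)
    \<comment> \<open>\<open>chart_isotopy\<close> drags the centre only to chart points of modulus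
      at most 1/2, hence the smaller ball.\<close>
    have "openin M (e ` ball 0 (1/2))" using open_embedding_openin_image[OF e(1), of "ball 0 (1/2)"] by simp
    then have "openin (top_of_set unit_square) {s \<in> topspace (top_of_set unit_square). x s \<in> e ` ball 0 (1/2)}"
      by (rule openin_continuous_map_preimage[OF x])
    then have "openin (top_of_set unit_square) {s \<in> unit_square. x s \<in> e ` ball 0 (1/2)}" by simp
    moreover have "x (u, v) \<in> e ` ball 0 (1/2)" using e(2) by (intro image_eqI[of _ _ 0]) auto
    then have "(u, v) \<in> {s \<in> unit_square. x s \<in> e ` ball 0 (1/2)}" using uv' by simp
    ultimately obtain \<epsilon> where \<epsilon>: "\<epsilon> > 0" "ball (u, v) \<epsilon> \<inter> unit_square \<subseteq> {s \<in> unit_square. x s \<in> e ` ball 0 (1/2)}"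
      by (metis (no_types, lifting) openin_contains_ball)
    show "\<exists>\<delta>>0. \<forall>a b c d. 0 \<le> a \<and> a \<le> u \<and> u \<le> b \<and> b \<le> 1 \<and> b - a < \<delta> \<and> 0 \<le> c \<and> c \<le> v \<and> v \<le> d \<and> d \<le> 1 \<and> d - c < \<delta> \<longrightarrow> ?P a b c d"
    proof (intro exI[of _ "\<epsilon>/2"] conjI allI impI)
      fix a b c d assume r: "0 \<le> a \<and> a \<le> u \<and> u \<le> b \<and> b \<le> 1 \<and> b - a < \<epsilon>/2 \<and> 0 \<le> c \<and> c \<le> v \<and> v \<le> d \<and> d \<le> 1 \<and> d - c < \<epsilon>/2"
      let ?R = "{a..b} \<times> {c..d}"
      have R1: "?R \<subseteq> unit_square" using r by auto
      have R: "x s \<in> e ` ball 0 (1/2)" if "s \<in> ?R" for s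
        using \<epsilon>(2) small_rectangle[of a u b \<epsilon> c v d] r R1 that by blast
      have xR: "continuous_map (top_of_set ?R) (subtopology M (range e)) x"
        by (intro continuous_map_into_subtopology continuous_map_from_subtopology_mono[OF x R1]) (use R in force)
      have inv: "inv_into UNIV e (x s) \<in> ball 0 (1/2)" "e (inv_into UNIV e (x s)) = x s" if "s \<in> ?R" for s
        using R[OF that] e(1) by (auto simp: open_embedding_def)
      have "continuous_map (top_of_set ?R) (top_of_set UNIV) (\<lambda>s. inv_into UNIV e (x s))"
        using continuous_map_compose[OF xR open_embedding_inv[OF e(1)]] by (simp add: o_def)
      then have q: "continuous_map (top_of_set ?R) (top_of_set (cball 0 (1/2))) (\<lambda>s. inv_into UNIV e (x s))"
        using inv(1) by (force simp: continuous_map_in_subtopology)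
      show "?P a b c d"
        unfolding trivializes_def
      proof (intro exI conjI ballI)
        show "isotopy (top_of_set ?R) M (\<lambda>s. h (inv_into UNIV e (x s))) (\<lambda>s. k (inv_into UNIV e (x s)))" by (rule isotopy_pullback[OF hk(1) q])
        show "e 0 \<in> topspace M" using open_embedding_topspace[OF e(1)] by simp
        fix s assume s: "s \<in> ?R"
        show "h (inv_into UNIV e (x s)) (e 0) = x s" using hk(2)[of "inv_into UNIV e (x s)"] inv[OF s] by simp
        fix z assume "z \<in> Z"
        then have "z \<notin> range e" using e(3) by blast
        then show "h (inv_into UNIV e (x s)) z = z" by (rule hk(3))
      qed
    qed (use \<epsilon> in auto)
  qed
qed

section \<open>Polar coordinates and trivializations over discs\<close>

lemma cis_2pi_eq:
  assumes "cis (2 * pi * t) = cis (2 * pi * t')" "t \<in> {0..1}" "t' \<in> {0..1}"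
  shows "t = t' \<or> (t = 0 \<and> t' = 1) \<or> (t = 1 \<and> t' = 0)"
proof -
  have "sin (2 * pi * t) = sin (2 * pi * t') \<and> cos (2 * pi * t) = cos (2 * pi * t')"
    using assms(1) by (auto simp: complex_eq_iff)
  then obtain n :: int where "2 * pi * t = 2 * pi * t' + 2 * pi * n" using sin_cos_eq_iff by blast
  then have "2 * pi * t = 2 * pi * (t' + n)" by (simp add: algebra_simps)
  then have n: "t = t' + n" by simp
  then have "real_of_int n \<le> 1" "real_of_int n \<ge> -1" using assms(2,3) by auto
  then have "n = -1 \<or> n = 0 \<or> n = 1" by linarith
  then show ?thesis using n assms(2,3) by auto
qed

lemma unit_circle_param:
  assumes "norm z = 1"
  obtains t where "t \<in> {0..1}" "z = cis (2 * pi * t)"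
proof -
  obtain s where s: "0 \<le> s" "s < 2 * pi" "Re z = cos s" "Im z = sin s"
    using sincos_total_2pi[of "Re z" "Im z"] assms by (metis cmod_power2 one_power2)
  have "z = cis (2 * pi * (s / (2 * pi)))" using s(3,4) by (simp add: complex_eq_iff)
  moreover have "s / (2 * pi) \<in> {0..1}" using s(1,2) by simp
  ultimately show thesis using that by blast
qed

text \<open>Polar coordinates are a continuous surjection from the compact square to the Hausdorff
  disc, hence a quotient map. The conditions on \<open>f\<close> say that it is constant on the
  fibres.\<close>

lemma polar_descend:
  assumes f: "continuous_map (top_of_set unit_square) X f"
    and per: "\<And>\<kappa>. \<kappa> \<in> {0..1} \<Longrightarrow> f (\<kappa>, 0) = f (\<kappa>, 1)" and c: "\<And>t. t \<in> {0..1} \<Longrightarrow> f (0, t) = f (0, 0)"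
  obtains g where "continuous_map (top_of_set (cball (0::complex) 1)) X g"
    "\<And>\<kappa> t. \<kappa> \<in> {0..1} \<Longrightarrow> t \<in> {0..1} \<Longrightarrow> g (of_real \<kappa> * cis (2 * pi * t)) = f (\<kappa>, t)"
proof -
  let ?p = "\<lambda>x. of_real (fst x) * cis (2 * pi * snd x)"
  have q: "quotient_map (top_of_set unit_square) (top_of_set (cball 0 1)) ?p"
  proof (rule continuous_imp_quotient_map)
    have "continuous_on unit_square ?p" by (intro continuous_intros)
    then show "continuous_map (top_of_set unit_square) (top_of_set (cball 0 1)) ?p"
      by (auto simp: continuous_map_in_subtopology norm_mult)
    show "compact_space (top_of_set unit_square)" by (simp add: compact_space_subtopology compact_Times)
    show "Hausdorff_space (top_of_set (cball (0::complex) 1))" by (simp add: Hausdorff_space_subtopology)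
    have "cball 0 1 \<subseteq> ?p ` unit_square"
    proof
      fix z :: complex assume z: "z \<in> cball 0 1"
      show "z \<in> ?p ` unit_square"
      proof (cases "z = 0")
        case True
        then show ?thesis by (intro image_eqI[of _ _ "(0, 0)"]) auto
      next
        case False
        then have "norm (z / of_real (norm z)) = 1" by (simp add: norm_divide)
        then obtain t where t: "t \<in> {0..1}" "z / of_real (norm z) = cis (2 * pi * t)" by (rule unit_circle_param)
        then have "z = ?p (norm z, t)" using False by (simp add: field_simps)
        then show ?thesis using t(1) z by (intro image_eqI[of _ _ "(norm z, t)"]) auto
      qed
    qed
    then show "?p ` topspace (top_of_set unit_square) = topspace (top_of_set (cball 0 1))" by (auto simp: norm_mult)
  qed
  have w: "f x = f y" if xy: "x \<in> topspace (top_of_set unit_square)" "y \<in> topspace (top_of_set unit_square)" "?p x = ?p y" for x y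
  proof -
    have n: "fst x = fst y" using arg_cong[OF xy(3), of norm] xy(1,2) by (auto simp: norm_mult)
    show ?thesis
    proof (cases "fst x = 0")
      case True
      then show ?thesis using n c[of "snd x"] c[of "snd y"] xy(1,2) by (metis mem_Times_iff prod.collapse topspace_euclidean_subtopology)
    next
      case False
      then have "cis (2 * pi * snd x) = cis (2 * pi * snd y)" using xy(3) n by simp
      then have "snd x = snd y \<or> (snd x = 0 \<and> snd y = 1) \<or> (snd x = 1 \<and> snd y = 0)"
        by (rule cis_2pi_eq) (use xy(1,2) in auto)
      then show ?thesis using n per[of "fst x"] xy(1) by (metis mem_Times_iff prod.collapse topspace_euclidean_subtopology)
    qed
  qed
  show thesis
  proof (rule quotient_map_lift_exists[OF q f])
    show "f x = f y" if "x \<in> topspace (top_of_set unit_square)" "y \<in> topspace (top_of_set unit_square)" "?p x = ?p y" for x y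
      using that by (rule w)
    fix g assume g: "continuous_map (top_of_set (cball 0 1)) X g" "\<And>x. x \<in> topspace (top_of_set unit_square) \<Longrightarrow> g (?p x) = f x"
    show thesis by (rule that[OF g(1)]) (use g(2) in force)
  qed
qed

lemma trivialization_disc:
  assumes M: "Hausdorff_space M" and Z: "closedin M Z"
    and x: "continuous_map (top_of_set (cball (0::complex) 1)) M x"
    and xi: "\<And>z. norm z \<le> 1 \<Longrightarrow> x z \<in> manifold_interior M" and xZ: "\<And>z. norm z \<le> 1 \<Longrightarrow> x z \<notin> Z"
  obtains h k where "isotopy (top_of_set (cball (0::complex) 1)) M h k" "\<And>z. norm z \<le> 1 \<Longrightarrow> h z (x 1) = x z"
    "\<And>z p. norm z \<le> 1 \<Longrightarrow> p \<in> Z \<Longrightarrow> h z p = p" "\<And>m. m \<in> topspace M \<Longrightarrow> k 1 m = m"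
proof -
  let ?D = "cball (0::complex) 1"
  \<comment> \<open>The disc sits in the square with corners at \<open>-1\<close> and
    \<open>1\<close> in both coordinates, and \<open>r\<close> retracts the plane onto the disc;
    \<open>s2\<close> and \<open>sq\<close> translate between that square and
    \<open>unit_square\<close>.\<close>
  define r :: "complex \<Rightarrow> complex" where "r w = w / of_real (max 1 (norm w))" for w
  define s2 where "s2 q = Complex (2 * fst q - 1) (2 * snd q - 1)" for q :: "real \<times> real"
  define sq where "sq z = ((Re z + 1) / 2, (Im z + 1) / 2)" for z
  have r: "norm (r w) \<le> 1" "norm w \<le> 1 \<Longrightarrow> r w = w" for w
    by (auto simp: r_def norm_divide max_def divide_le_eq)
  have cr: "continuous_on A r" for A
    unfolding r_def by (intro continuous_intros) auto
  have x': "continuous_map (top_of_set unit_square) M (\<lambda>q. x (r (s2 q)))"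
    by (rule continuous_map_compose_on[OF x])
      (use r(1) in \<open>auto simp: s2_def Complex_eq intro!: continuous_intros continuous_on_compose2[OF cr]\<close>)
  have "trivializes M Z unit_square (\<lambda>q. x (r (s2 q)))"
    by (rule trivializes_square[OF M Z x']) (use xi xZ r(1) in auto)
  then obtain h k b where hk: "isotopy (top_of_set unit_square) M h k" "b \<in> topspace M"
    "\<And>s. s \<in> unit_square \<Longrightarrow> h s b = x (r (s2 s))" "\<And>s z. s \<in> unit_square \<Longrightarrow> z \<in> Z \<Longrightarrow> h s z = z"
    unfolding trivializes_def by (auto simp del: mem_Times_iff)
  have sqin: "sq z \<in> unit_square" if "norm z \<le> 1" for z
    using that abs_Re_le_cmod[of z] abs_Im_le_cmod[of z] by (auto simp: sq_def)
  have sq: "s2 (sq z) = z" for z by (simp add: s2_def sq_def complex_eq_iff add_divide_distrib)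
  have csq: "continuous_map (top_of_set ?D) (top_of_set unit_square) sq"
    using sqin by (auto simp: continuous_map_in_subtopology sq_def intro!: continuous_intros)
  have c1: "continuous_map (top_of_set ?D) (top_of_set unit_square) (\<lambda>_. sq 1)" using sqin[of 1] by simp
  \<comment> \<open>Composing with the inverse homeomorphism at \<open>sq 1\<close> makes the family
    the identity over the point 1, so that the point carried along is \<open>x 1\<close> instead of
    \<open>b\<close>.\<close>
  let ?h = "\<lambda>z m. h (sq z) (k (sq 1) m)" and ?k = "\<lambda>z m. h (sq 1) (k (sq z) m)"
  have I: "isotopy (top_of_set ?D) M ?h ?k"
    by (rule isotopy_compose[OF isotopy_pullback[OF hk(1) csq] isotopy_inverse[OF isotopy_pullback[OF hk(1) c1]]])
  have t1: "sq 1 \<in> topspace (top_of_set unit_square)" using sqin[of 1] by simp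
  have ZM: "Z \<subseteq> topspace M" using Z closedin_subset by blast
  have xs: "h (sq z) b = x z" if "norm z \<le> 1" for z using hk(3)[OF sqin[OF that]] sq r(2)[OF that] by simp
  show thesis
  proof (rule that[OF I])
    show "h (sq z) (k (sq 1) (x 1)) = x z" if "norm z \<le> 1" for z
      using xs[of 1] isotopyD(1)[OF hk(1) t1 hk(2)] xs[OF that] by simp
    show "h (sq z) (k (sq 1) p) = p" if "norm z \<le> 1" "p \<in> Z" for z p
    proof -
      have "k (sq 1) p = p" using isotopyD(1)[OF hk(1) t1, of p] hk(4)[OF sqin[of 1] that(2)] that(2) ZM by auto
      then show ?thesis using hk(4)[OF sqin[OF that(1)] that(2)] by simp
    qed
    show "h (sq 1) (k (sq 1) m) = m" if "m \<in> topspace M" for m using isotopyD(2)[OF hk(1) t1 that] .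
  qed
qed

text \<open>Once \<open>x\<close> is trivialized, the transported point \<open>k z (y z)\<close>
  avoids the fixed point \<open>x 1\<close>. It is trivialized relative to that point, and the two
  families are composed.\<close>

lemma trivialization_disc2:
  assumes M: "Hausdorff_space M"
    and x: "continuous_map (top_of_set (cball (0::complex) 1)) M x" "continuous_map (top_of_set (cball (0::complex) 1)) M y"
    and xi: "\<And>z. norm z \<le> 1 \<Longrightarrow> x z \<in> manifold_interior M" "\<And>z. norm z \<le> 1 \<Longrightarrow> y z \<in> manifold_interior M"
    and ne: "\<And>z. norm z \<le> 1 \<Longrightarrow> x z \<noteq> y z"
  obtains h k where "isotopy (top_of_set (cball (0::complex) 1)) M h k" "\<And>z. norm z \<le> 1 \<Longrightarrow> h z (x 1) = x z"
    "\<And>z. norm z \<le> 1 \<Longrightarrow> h z (y 1) = y z"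
proof -
  let ?D = "cball (0::complex) 1"
  obtain h k where hk: "isotopy (top_of_set ?D) M h k" "\<And>z. norm z \<le> 1 \<Longrightarrow> h z (x 1) = x z"
    "\<And>z p. norm z \<le> 1 \<Longrightarrow> p \<in> {} \<Longrightarrow> h z p = p" "\<And>m. m \<in> topspace M \<Longrightarrow> k 1 m = m"
    by (rule trivialization_disc[OF M closedin_empty x(1) xi(1)]) (simp, simp, rule that)
  have top: "x z \<in> topspace M" "y z \<in> topspace M" if "norm z \<le> 1" for z
    using x that by (auto simp: continuous_map_def Pi_iff)
  have y': "continuous_map (top_of_set ?D) M (\<lambda>z. k z (y z))"
    using isotopy_apply_continuous[OF isotopy_inverse[OF hk(1)] continuous_map_id x(2)] by simp
  have cl: "closedin M {x 1}" using M top(1)[of 1] by (simp add: closedin_Hausdorff_sing_eq)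
  have n: "k z (y z) \<notin> {x 1}" if "norm z \<le> 1" for z
    using isotopyD(2)[OF hk(1), of z "y z"] hk(2)[OF that] ne[OF that] top(2)[OF that] that by auto
  have i: "k z (y z) \<in> manifold_interior M" if "norm z \<le> 1" for z
    using isotopy_interior[OF isotopy_inverse[OF hk(1)] _ xi(2)[OF that]] that by simp
  obtain h' k' where hk': "isotopy (top_of_set ?D) M h' k'" "\<And>z. norm z \<le> 1 \<Longrightarrow> h' z (k 1 (y 1)) = k z (y z)"
    "\<And>z p. norm z \<le> 1 \<Longrightarrow> p \<in> {x 1} \<Longrightarrow> h' z p = p" "\<And>m. m \<in> topspace M \<Longrightarrow> k' 1 m = m"
    by (rule trivialization_disc[OF M cl y' i n]) (simp, simp, rule that)
  show thesis
  proof (rule that[OF isotopy_compose[OF hk(1) hk'(1)]])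
    show "h z (h' z (x 1)) = x z" if "norm z \<le> 1" for z using hk'(3)[OF that] hk(2)[OF that] by simp
    show "h z (h' z (y 1)) = y z" if "norm z \<le> 1" for z
      using hk'(2)[OF that] hk(4)[OF top(2)[of 1]] isotopyD(2)[OF hk(1), of z "y z"] top(2)[OF that] that by simp
  qed
qed

text \<open>Over the disc the sections of the bundle with fibre \<open>M - P\<close> are all homotopic; since \<open>y'\<close> is constant on the
  boundary circle, this trivializes the loop traced by \<open>y\<close> in the fibre over that circle.\<close>

proposition section_null_homotopic:
  assumes I: "isotopy (top_of_set (cball (0::complex) 1)) M h k"
    and P: "P \<subseteq> topspace M" "\<And>z p. norm z = 1 \<Longrightarrow> p \<in> P \<Longrightarrow> h z p = p"
    and con: "path_connected_space (subtopology M (topspace M - P))"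
    and y: "continuous_map (top_of_set (cball (0::complex) 1)) M y" "\<And>z p. norm z \<le> 1 \<Longrightarrow> p \<in> P \<Longrightarrow> y z \<noteq> h z p"
    and y': "continuous_map (top_of_set (cball (0::complex) 1)) M y'" "\<And>z p. norm z \<le> 1 \<Longrightarrow> p \<in> P \<Longrightarrow> y' z \<noteq> h z p"
      "\<And>z. norm z = 1 \<Longrightarrow> y' z = c"
  obtains Y where "continuous_map (top_of_set (cball (0::complex) 1)) (subtopology M (topspace M - P)) Y"
    "\<And>z. norm z = 1 \<Longrightarrow> Y z = y z"
proof -
  let ?D = "cball (0::complex) 1" and ?X = "subtopology M (topspace M - P)"
  have top: "y z \<in> topspace M" "y' z \<in> topspace M" if "norm z \<le> 1" for z
    using y(1) y'(1) that by (auto simp: continuous_map_def Pi_iff)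
  have lift: "continuous_map (top_of_set ?D) ?X (\<lambda>z. k z (u z))"
    if u: "continuous_map (top_of_set ?D) M u" "\<And>z p. norm z \<le> 1 \<Longrightarrow> p \<in> P \<Longrightarrow> u z \<noteq> h z p" for u
  proof (rule continuous_map_into_subtopology)
    show "continuous_map (top_of_set ?D) M (\<lambda>z. k z (u z))"
      using isotopy_apply_continuous[OF isotopy_inverse[OF I] continuous_map_id u(1)] by simp
    show "(\<lambda>z. k z (u z)) \<in> topspace (top_of_set ?D) \<rightarrow> topspace M - P"
    proof
      fix z assume z: "z \<in> topspace (top_of_set ?D)"
      have uz: "u z \<in> topspace M" using u(1) z by (auto simp: continuous_map_def)
      have "h z (k z (u z)) = u z" by (rule isotopyD(2)[OF I z uz])
      then have "k z (u z) \<notin> P" using u(2)[of z "k z (u z)"] z by auto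
      then show "k z (u z) \<in> topspace M - P" using isotopyD(4)[OF I z uz] by simp
    qed
  qed
  \<comment> \<open>In the coordinates of the trivialization both sections become maps from the disc
    to the fixed space \<open>M - P\<close>. Such maps are homotopic because the disc is
    contractible and \<open>M - P\<close> is path connected.\<close>
  define a where "a z = k z (y z)" for z
  define a' where "a' z = k z (y' z)" for z
  have ca: "continuous_map (top_of_set ?D) ?X a" and ca': "continuous_map (top_of_set ?D) ?X a'"
    unfolding a_def a'_def using lift y y' by auto
  have "a' 1 \<in> topspace ?X" "a 1 \<in> topspace ?X" using ca ca' by (auto simp: continuous_map_def Pi_iff)
  then obtain \<gamma> where \<gamma>: "pathin ?X \<gamma>" "\<gamma> 0 = a' 1" "\<gamma> 1 = a 1"
    using con unfolding path_connected_space_iff_path_component path_component_of_def by blast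
  let ?w = "\<lambda>q :: real \<times> real. cis (2 * pi * snd q) :: complex"
  have seg: "norm (1 + of_real l * (cis s - 1)) \<le> 1" if "0 \<le> l" "l \<le> 1" for l s
  proof -
    have "1 + of_real l * (cis s - 1) = of_real (1 - l) * 1 + of_real l * cis s" by (simp add: algebra_simps)
    also have "norm \<dots> \<le> (1 - l) + l"
    proof -
      have "norm (of_real (1 - l) :: complex) = 1 - l" "norm (of_real l :: complex) = l" using that by (simp_all only: norm_of_real abs_of_nonneg diff_ge_0_iff_ge)
      then show ?thesis
        using norm_triangle_ineq[of "of_real (1 - l) * 1" "of_real l * cis s"] by (simp only: norm_mult norm_cis norm_one mult_1_right)
    qed
    finally show ?thesis by simp
  qed
  \<comment> \<open>Over the boundary circle, parametrized by \<open>?w\<close>, \<open>G\<close>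
    contracts \<open>a'\<close> along chords to its value at 1, follows \<open>\<gamma>\<close>, and
    expands to \<open>a\<close>. It takes equal values at angles 0 and 1, as a homotopy of closed
    loops must.\<close>
  define G where "G q = (if fst q \<le> 1/3 then a' (1 + of_real (1 - 3 * fst q) * (?w q - 1))
      else if fst q \<le> 2/3 then \<gamma> (3 * fst q - 1) else a (1 + of_real (3 * fst q - 2) * (?w q - 1)))" for q :: "real \<times> real"
  have cG: "continuous_map (top_of_set unit_square) ?X G"
    unfolding G_def
  proof (rule continuous_map_top_of_set_cases_le)
    show "continuous_map (top_of_set {q \<in> unit_square. fst q \<le> 1/3}) ?X (\<lambda>q. a' (1 + of_real (1 - 3 * fst q) * (?w q - 1)))"
    proof (rule continuous_map_compose_on[OF ca'])
      show "1 + of_real (1 - 3 * fst q) * (?w q - 1) \<in> ?D" if "q \<in> {q \<in> unit_square. fst q \<le> 1/3}" for q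
        unfolding mem_cball_0 by (rule seg) (use that in auto)
    qed (intro continuous_intros)
    show "continuous_map (top_of_set {q \<in> unit_square. 1/3 \<le> fst q}) ?X
        (\<lambda>q. if fst q \<le> 2/3 then \<gamma> (3 * fst q - 1) else a (1 + of_real (3 * fst q - 2) * (?w q - 1)))"
    proof (rule continuous_map_top_of_set_cases_le)
      show "continuous_map (top_of_set {q \<in> {q \<in> unit_square. 1/3 \<le> fst q}. fst q \<le> 2/3}) ?X (\<lambda>q. \<gamma> (3 * fst q - 1))"
        by (rule continuous_map_compose_on[OF \<gamma>(1)[unfolded pathin_def]]) (auto intro!: continuous_intros)
      show "continuous_map (top_of_set {q \<in> {q \<in> unit_square. 1/3 \<le> fst q}. 2/3 \<le> fst q}) ?X
          (\<lambda>q. a (1 + of_real (3 * fst q - 2) * (?w q - 1)))"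
      proof (rule continuous_map_compose_on[OF ca])
        show "1 + of_real (3 * fst q - 2) * (?w q - 1) \<in> ?D" if "q \<in> {q \<in> {q \<in> unit_square. 1/3 \<le> fst q}. 2/3 \<le> fst q}" for q
          unfolding mem_cball_0 by (rule seg) (use that in auto)
      qed (intro continuous_intros)
      show "\<gamma> (3 * fst q - 1) = a (1 + of_real (3 * fst q - 2) * (?w q - 1))" if "fst q = 2/3" for q
        unfolding that using \<gamma>(3) by simp
    qed (auto intro!: continuous_intros)
    show "a' (1 + of_real (1 - 3 * fst q) * (?w q - 1)) =
        (if fst q \<le> 2/3 then \<gamma> (3 * fst q - 1) else a (1 + of_real (3 * fst q - 2) * (?w q - 1)))" if "fst q = 1/3" for q
      unfolding that using \<gamma>(2) by simp
  qed (auto intro!: continuous_intros)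
  \<comment> \<open>Back in the original coordinates the homotopy starts at the constant
    \<open>c\<close>, ends with \<open>y\<close>, and stays off \<open>P\<close> because
    \<open>h\<close> fixes \<open>P\<close> over the circle. Its constant end lets it descend to a
    disc.\<close>
  define f where "f q = h (?w q) (G q)" for q
  have w1: "norm (?w q) = 1" for q by simp
  have cf: "continuous_map (top_of_set unit_square) ?X f"
  proof (rule continuous_map_into_subtopology)
    have "continuous_map (top_of_set unit_square) (top_of_set ?D) ?w"
      by (auto simp: continuous_map_in_subtopology intro!: continuous_intros)
    then show "continuous_map (top_of_set unit_square) M f"
      unfolding f_def by (rule isotopy_apply_continuous[OF I _ continuous_map_into_fulltopology[OF cG]])
    show "f \<in> topspace (top_of_set unit_square) \<rightarrow> topspace M - P"
    proof
      fix q assume "q \<in> topspace (top_of_set unit_square)"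
      then have Gq: "G q \<in> topspace M - P" using cG by (auto simp: continuous_map_def Pi_iff)
      have wq: "?w q \<in> topspace (top_of_set ?D)" by simp
      have "f q \<notin> P"
      proof
        assume "f q \<in> P"
        then have "h (?w q) (f q) = f q" using P(2)[OF w1] by blast
        then have "k (?w q) (h (?w q) (f q)) = k (?w q) (h (?w q) (G q))" by (simp add: f_def)
        then have "f q = G q" using isotopyD(1)[OF I wq] Gq P(1) \<open>f q \<in> P\<close> by (metis Diff_iff subsetD)
        then show False using Gq \<open>f q \<in> P\<close> by simp
      qed
      then show "f q \<in> topspace M - P" using isotopyD(3)[OF I wq] Gq by (simp add: f_def)
    qed
  qed
  have f0: "f (0, t) = c" for t
  proof -
    have "f (0, t) = h (?w (0, t)) (k (?w (0, t)) (y' (?w (0, t))))" by (simp add: f_def G_def a'_def)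
    also have "\<dots> = y' (?w (0, t))" by (rule isotopyD(2)[OF I]) (use top(2)[of "?w (0, t)"] in auto)
    finally show ?thesis using y'(3)[OF w1[of "(0, t)"]] by simp
  qed
  have f1: "f (1, t) = y (?w (1, t))" for t
  proof -
    have "f (1, t) = h (?w (1, t)) (k (?w (1, t)) (y (?w (1, t))))" by (simp add: f_def G_def a_def)
    also have "\<dots> = y (?w (1, t))" by (rule isotopyD(2)[OF I]) (use top(1)[of "?w (1, t)"] in auto)
    finally show ?thesis .
  qed
  have per: "f (\<kappa>, 0) = f (\<kappa>, 1)" for \<kappa> by (simp add: f_def G_def)
  have f0': "f (0, t) = f (0, 0)" for t by (simp only: f0)
  obtain Y where Y: "continuous_map (top_of_set ?D) ?X Y"
    "\<And>\<kappa> t. \<kappa> \<in> {0..1} \<Longrightarrow> t \<in> {0..1} \<Longrightarrow> Y (of_real \<kappa> * cis (2 * pi * t)) = f (\<kappa>, t)"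
    by (rule polar_descend[OF cf per f0']) (rule that)
  have "Y z = y z" if z: "norm z = 1" for z
  proof -
    obtain t where "t \<in> {0..1}" "z = cis (2 * pi * t)" using z by (rule unit_circle_param)
    then show ?thesis using Y(2)[of 1 t] f1[of t] by simp
  qed
  then show thesis using that[OF Y(1)] by blast
qed

section \<open>Null-homotopies of a loop around a point\<close>

text \<open>The logarithms \<open>L1\<close> and \<open>L2\<close> record that
  \<open>\<alpha>\<close> winds once around \<open>u\<close> and not around \<open>v\<close>. The
  quotient \<open>(z - u) / (z - v)\<close> can be cut off to 1 far out, so it extends to a map from
  the twice punctured surface to the nonzero numbers. Composed with \<open>Y\<close> it has a
  logarithm on the whole disc, in conflict with \<open>L1 - L2\<close>.\<close>

lemma no_null_homotopy_around_point:
  assumes M: "Hausdorff_space M" and e: "open_embedding UNIV M e"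
    and Y: "continuous_map (top_of_set (cball (0::complex) 1)) (subtopology M (topspace M - e ` {u, v})) Y"
    and Y\<alpha>: "\<And>t. t \<in> {0..1} \<Longrightarrow> Y (cis (2 * pi * t)) = e (\<alpha> t)"
    and \<alpha>: "\<And>t. t \<in> {0..1} \<Longrightarrow> norm (\<alpha> t) \<le> R"
    and L1: "continuous_on {0..1} L1" "\<And>t. t \<in> {0..1} \<Longrightarrow> exp (L1 t) = \<alpha> t - u" "L1 1 = L1 0 + 2 * pi * \<i>"
    and L2: "continuous_on {0..1} L2" "\<And>t. t \<in> {0..1} \<Longrightarrow> exp (L2 t) = \<alpha> t - v" "L2 1 = L2 0"
    and R: "norm u \<le> R" "norm v \<le> R"
  shows False
proof -
  let ?D = "cball (0::complex) 1" and ?X = "subtopology M (topspace M - e ` {u, v})" and ?C = "- {u, v}"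
  \<comment> \<open>The cutoff is 1 up to modulus \<open>R + 1\<close> and 0 from
    \<open>R + 2\<close> on: \<open>\<theta>\<close> is the true quotient along the loop and equals
    1 outside \<open>K\<close>.\<close>
  define \<sigma> where "\<sigma> z = complex_of_real (max 0 (min 1 (R + 2 - norm z)))" for z :: complex
  define \<theta> where "\<theta> z = (z - \<sigma> z * u) / (z - \<sigma> z * v)" for z
  have \<sigma>1: "\<sigma> z = 1" if "norm z \<le> R" for z using that by (simp add: \<sigma>_def)
  \<comment> \<open>At a zero, \<open>z\<close> has modulus at most \<open>norm w\<close>, hence at
    most \<open>R\<close>; there the cutoff is 1, so that \<open>z = w\<close>.\<close>
  have ne: "z - \<sigma> z * w \<noteq> 0" if "norm w \<le> R" "z \<noteq> w" for z w
  proof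
    assume "z - \<sigma> z * w = 0"
    then have z: "z = \<sigma> z * w" by simp
    have "norm (\<sigma> z) \<le> 1" by (simp add: \<sigma>_def)
    then have "norm z \<le> R" using arg_cong[OF z, of norm] mult_right_mono[of "norm (\<sigma> z)" 1 "norm w"] that(1) by (simp add: norm_mult)
    then show False using z \<sigma>1 that(2) by simp
  qed
  have c\<theta>: "continuous_on ?C \<theta>"
    unfolding \<theta>_def \<sigma>_def by (intro continuous_intros) (use ne R in \<open>auto simp: \<sigma>_def\<close>)
  have g: "open_embedding ?C ?X e" by (rule open_embedding_delete[OF e]) simp
  define K where "K = cball 0 (R + 2) - {u, v}"
  have "closedin M (e ` cball 0 (R + 2))" using open_embedding_compact_image(2)[OF e M] by simp
  then have "closedin ?X (e ` cball 0 (R + 2) \<inter> (topspace M - e ` {u, v}))" by (metis closedin_subtopology)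
  moreover have "e ` cball 0 (R + 2) \<inter> (topspace M - e ` {u, v}) = e ` K"
    using e open_embedding_topspace[OF e] unfolding open_embedding_def inj_on_def K_def by auto
  ultimately have K: "closedin ?X (e ` K)" "K \<subseteq> ?C" by (auto simp: K_def)
  define \<Theta> where "\<Theta> x = (if x \<in> e ` ?C then \<theta> (inv_into ?C e x) else 1)" for x
  have "continuous_map ?X (top_of_set (- {0})) \<Theta>"
    unfolding \<Theta>_def
  proof (rule chart_gluing_simple[OF g K])
    show "continuous_map (top_of_set ?C) (top_of_set (- {0})) \<theta>"
      using c\<theta> ne R by (auto simp: continuous_map_in_subtopology \<theta>_def)
    show "\<theta> z = 1" if "z \<in> ?C" "z \<notin> K" for z
    proof -
      have "norm z > R + 2" using that by (auto simp: K_def)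
      moreover from this have "z \<noteq> 0" using R(1) by (metis add_nonneg_nonneg norm_ge_zero norm_zero not_less order_trans zero_le_numeral)
      ultimately show ?thesis by (simp add: \<theta>_def \<sigma>_def)
    qed
  qed simp
  from continuous_map_compose[OF Y this] have "continuous_map (top_of_set ?D) (top_of_set (- {0})) (\<lambda>z. \<Theta> (Y z))" by (simp add: o_def)
  then have "continuous_on ?D (\<lambda>z. \<Theta> (Y z))" "\<And>z. z \<in> ?D \<Longrightarrow> \<Theta> (Y z) \<noteq> 0" by (auto simp: continuous_map_in_subtopology)
  then obtain l where l: "continuous_on ?D l" "\<And>z. z \<in> ?D \<Longrightarrow> \<Theta> (Y z) = exp (l z)"
    by (rule continuous_logarithm_on_cball) (assumption, rule that)
  define d where "d t = l (cis (2 * pi * t)) - (L1 t - L2 t)" for t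
  have cd: "continuous_on {0..1} d"
    unfolding d_def by (intro continuous_intros L1(1) L2(1) continuous_on_compose2[OF l(1)]) auto
  have ed: "exp (d t) = 1" if t: "t \<in> {0..1}" for t
  proof -
    have a: "\<alpha> t \<in> ?C" using L1(2)[OF t] L2(2)[OF t] by (metis Compl_iff diff_self exp_not_eq_zero insertE singletonD)
    have "exp (l (cis (2 * pi * t))) = \<Theta> (e (\<alpha> t))" using l(2)[of "cis (2 * pi * t)"] Y\<alpha>[OF t] by simp
    also have "\<dots> = \<theta> (\<alpha> t)"
      unfolding \<Theta>_def using a g by (simp add: open_embedding_def inv_into_f_f)
    also have "\<dots> = exp (L1 t - L2 t)" using \<sigma>1[OF \<alpha>[OF t]] L1(2)[OF t] L2(2)[OF t] by (simp add: \<theta>_def exp_diff)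
    finally show ?thesis by (simp add: d_def exp_diff)
  qed
  \<comment> \<open>Two logarithms of one function differ by multiples of
    \<open>2 * pi * \<i>\<close>, a discrete set. A constant difference is impossible: along the
    loop \<open>l\<close> returns to its value, while \<open>L1 - L2\<close> gains
    \<open>2 * pi * \<i>\<close>.\<close>
  have "d constant_on {0..1}"
  proof (rule continuous_discrete_range_constant[OF _ cd])
    fix x :: real assume x: "x \<in> {0..1}"
    show "\<exists>\<epsilon>>0. \<forall>y. y \<in> {0..1} \<and> d y \<noteq> d x \<longrightarrow> \<epsilon> \<le> norm (d y - d x)"
    proof (intro exI[of _ 1] conjI allI impI)
      fix y assume y: "y \<in> {0..1} \<and> d y \<noteq> d x"
      have "exp (d y - d x) = 1" using ed[OF x] ed[of y] y by (simp add: exp_diff)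
      then obtain m :: int where m: "Re (d y - d x) = 0" "Im (d y - d x) = of_int (2 * m) * pi" using exp_eq_1 by blast
      then have "m \<noteq> 0" using y by (auto simp: complex_eq_iff)
      then have "1 \<le> \<bar>real_of_int (2 * m)\<bar>" by linarith
      then have "1 * 1 \<le> \<bar>real_of_int (2 * m)\<bar> * pi" using pi_gt3 by (intro mult_mono) auto
      then have "1 \<le> \<bar>Im (d y - d x)\<bar>" using m(2) by (simp add: abs_mult)
      then show "1 \<le> norm (d y - d x)" using abs_Im_le_cmod order_trans by blast
    qed simp
  qed simp
  then have "d 0 = d 1" by (auto simp: constant_on_def)
  then show False using L1(3) L2(3) by (simp add: d_def)
qed

text \<open>Chart points other than \<open>u\<close> are pushed radially to distance at least
  \<open>L\<close> from \<open>u\<close>, and points outside the chart stay. Applied to a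
  null-homotopy that misses \<open>e u\<close>, this gives a cap: a disc whose boundary is the round
  circle of radius \<open>L\<close> and which misses the inside of that circle.\<close>

lemma push_null_homotopy_outside:
  assumes M: "Hausdorff_space M" and e: "open_embedding UNIV M e"
    and Y: "continuous_map (top_of_set (cball (0::complex) 1)) (subtopology M (topspace M - {e u})) Y"
    and Y\<alpha>: "\<And>t. t \<in> {0..1} \<Longrightarrow> Y (cis (2 * pi * t)) = e (u + of_real (\<rho> t) * cis (2 * pi * t) * w)"
    and \<rho>: "\<And>t. t \<in> {0..1} \<Longrightarrow> 0 < \<rho> t" "\<And>t. t \<in> {0..1} \<Longrightarrow> \<rho> t * norm w \<le> L" and w: "w \<noteq> 0" and L: "L > 0"
  obtains G where "continuous_map (top_of_set (cball (0::complex) 1)) M G" "\<And>z. norm z \<le> 1 \<Longrightarrow> G z \<notin> e ` ball u L"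
    "\<And>z. norm z = 1 \<Longrightarrow> G z = e (u + of_real L * z)"
proof -
  let ?D = "cball (0::complex) 1" and ?X = "subtopology M (topspace M - {e u})" and ?C = "- {u}"
  have inj: "inj e" using e by (simp add: open_embedding_def)
  have g: "open_embedding ?C ?X e" using open_embedding_delete[OF e, of "{u}"] by simp
  define K where "K = cball u L - {u}"
  have "closedin M (e ` cball u L)" using open_embedding_compact_image(2)[OF e M] by simp
  then have "closedin ?X (e ` cball u L \<inter> (topspace M - {e u}))" by (metis closedin_subtopology)
  moreover have "e ` cball u L \<inter> (topspace M - {e u}) = e ` K"
    using inj open_embedding_topspace[OF e] unfolding inj_on_def K_def by auto
  ultimately have K: "closedin ?X (e ` K)" "K \<subseteq> ?C" by (auto simp: K_def)
  define \<phi> where "\<phi> z = u + of_real (max L (norm (z - u)) / norm (z - u)) * (z - u)" for z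
  have n\<phi>: "norm (\<phi> z - u) \<ge> L" if "z \<noteq> u" for z
  proof -
    have "norm (\<phi> z - u) = \<bar>max L (norm (z - u))\<bar>" using that by (simp add: \<phi>_def norm_mult norm_divide)
    then show ?thesis by simp
  qed
  define \<eta> where "\<eta> x = (if x \<in> e ` ?C then e (\<phi> (inv_into ?C e x)) else x)" for x
  have \<eta>e: "\<eta> (e z) = e (\<phi> z)" if "z \<noteq> u" for z
    using that g unfolding \<eta>_def by (simp add: open_embedding_def inv_into_f_f)
  have c\<eta>: "continuous_map ?X M \<eta>"
    unfolding \<eta>_def
  proof (rule chart_gluing_simple[OF g K])
    have "continuous_on ?C \<phi>" unfolding \<phi>_def by (intro continuous_intros) auto
    then show "continuous_map (top_of_set ?C) M (\<lambda>z. e (\<phi> z))" by (rule open_embedding_compose[OF e]) simp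
    show "continuous_map (subtopology ?X (topspace ?X - e ` K)) M (\<lambda>x. x)"
      by (intro continuous_map_from_subtopology) simp
    show "e (\<phi> z) = e z" if "z \<in> ?C" "z \<notin> K" for z
    proof -
      have "max L (norm (z - u)) = norm (z - u)" "norm (z - u) \<noteq> 0" using that by (auto simp: K_def dist_norm norm_minus_commute)
      then show ?thesis by (simp add: \<phi>_def)
    qed
  qed
  \<comment> \<open>Dividing the argument by \<open>v\<close> cancels the direction of
    \<open>w\<close>, so that the boundary circle is traversed in its standard
    parametrization.\<close>
  define v where "v = w / of_real (norm w)"
  have v: "norm v = 1" using w by (simp add: v_def norm_divide)
  define G where "G z = \<eta> (Y (z / v))" for z
  have "continuous_map (top_of_set ?D) ?X (\<lambda>z. Y (z / v))"
    by (rule continuous_map_compose_on[OF Y]) (use v in \<open>auto simp: norm_divide intro!: continuous_intros\<close>)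
  from continuous_map_compose[OF this c\<eta>] have cG: "continuous_map (top_of_set ?D) M G" by (simp add: o_def G_def[abs_def])
  moreover have "G z \<notin> e ` ball u L" if "norm z \<le> 1" for z
  proof -
    have "Y (z / v) \<in> topspace M - {e u}" using Y v that by (auto simp: continuous_map_def Pi_iff norm_divide)
    then have ne: "Y (z / v) \<noteq> e u" by simp
    show ?thesis
    proof (cases "Y (z / v) \<in> range e")
      case True
      then obtain x where x: "Y (z / v) = e x" by blast
      then have xu: "x \<noteq> u" using ne by auto
      then have Gz: "G z = e (\<phi> x)" using \<eta>e x by (simp add: G_def)
      have "\<phi> x \<notin> ball u L" using n\<phi>[OF xu] by (simp add: dist_norm norm_minus_commute)
      then show ?thesis using Gz inj by (auto simp: inj_eq)
    next
      case False
      then have "G z = Y (z / v)" unfolding G_def \<eta>_def by auto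
      then show ?thesis using False by auto
    qed
  qed
  moreover have "G z = e (u + of_real L * z)" if z: "norm z = 1" for z
  proof -
    have "norm (z / v) = 1" using z v by (simp add: norm_divide)
    then obtain t where t: "t \<in> {0..1}" "z / v = cis (2 * pi * t)" by (rule unit_circle_param)
    define q where "q = of_real (\<rho> t) * cis (2 * pi * t) * w"
    have nq: "norm q = \<rho> t * norm w" using \<rho>(1)[OF t(1)] by (simp add: q_def norm_mult)
    have q0: "q \<noteq> 0" using w \<rho>(1)[OF t(1)] by (simp add: q_def)
    have "\<phi> (u + q) = u + of_real (L / norm q) * q" using \<rho>(2)[OF t(1)] nq by (simp add: \<phi>_def max_def)
    also have "of_real (L / norm q) * q = of_real L * z"
    proof -
      have "v \<noteq> 0" using v by auto
      then have z': "z = cis (2 * pi * t) * v" using t(2) by (simp add: field_simps)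
      have "\<rho> t \<noteq> 0" using \<rho>(1)[OF t(1)] by simp
      then have "of_real (L / (\<rho> t * norm w)) * (of_real (\<rho> t) * cis (2 * pi * t) * w) = of_real L * (cis (2 * pi * t) * (w / of_real (norm w)))"
        using w by (simp add: field_simps)
      then show ?thesis unfolding nq unfolding q_def z' v_def .
    qed
    finally show ?thesis using Y\<alpha>[OF t(1)] t(2) \<eta>e[of "u + q"] q0 by (simp add: G_def q_def)
  qed
  ultimately show thesis using that[of G] by blast
qed

text \<open>The cap \<open>G\<close> extends the chart to a map from the Riemann sphere. Moebius rotations keep all but one point of the
  configuration away from the cap, and the rotation by \<open>4\<pi>\<close> is contractible in \<open>SU(2)\<close>.\<close>

proposition double_rotation_null_homotopic:
  assumes e: "open_embedding UNIV M e"
    and G: "continuous_map (top_of_set (cball (0::complex) 1)) M G" "\<And>z. norm z \<le> 1 \<Longrightarrow> G z \<notin> e ` ball u L"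
      "\<And>z. norm z = 1 \<Longrightarrow> G z = e (u + of_real L * z)"
    and d: "\<And>i. i < n \<Longrightarrow> norm (d i) \<le> B" "\<And>i j. i < n \<Longrightarrow> j < n \<Longrightarrow> i \<noteq> j \<Longrightarrow> \<delta> \<le> norm (d i - d j)"
    and \<delta>: "\<delta> > 0" and L: "L \<ge> B + norm u" "L > 0" "2 * (1 + B)^2 * (1 + norm u) < \<delta> * L" and B: "B \<ge> 0"
  shows "path_homotopic (ordered_config M n) (\<lambda>t. \<lambda>i\<in>{..<n}. e (cis (4 * pi * t) * d i)) (\<lambda>_. \<lambda>i\<in>{..<n}. e (d i))"
proof -
  have inj: "inj e" using e by (simp add: open_embedding_def)
  \<comment> \<open>\<open>F\<close> uses homogeneous coordinates on the Riemann sphere: ratios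
    within distance \<open>L\<close> of \<open>u\<close> go through the chart, all others through
    the cap. With \<open>q\<close> the ratio minus \<open>u\<close>, the cap coordinate is
    \<open>L / cnj q\<close>, an inversion in the circle, which equals \<open>q / L\<close> where
    \<open>norm q = L\<close>.\<close>
  define F where "F x = (if norm (fst x - u * snd x) \<le> L * norm (snd x) then e (fst x / snd x)
     else G (of_real L * cnj (snd x / (fst x - u * snd x))))" for x :: "complex \<times> complex"
  have cF: "continuous_map (top_of_set (- {(0, 0)})) M F"
    unfolding F_def
  proof (rule continuous_map_top_of_set_cases_le)
    let ?A = "- {(0::complex, 0::complex)}"
    have 1: "snd x \<noteq> 0" if "x \<in> {x \<in> ?A. norm (fst x - u * snd x) \<le> L * norm (snd x)}" for x
      using that by (cases x) auto
    show "continuous_map (top_of_set {x \<in> ?A. norm (fst x - u * snd x) \<le> L * norm (snd x)}) M (\<lambda>x. e (fst x / snd x))"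
      by (rule open_embedding_compose[OF e]) (use 1 in \<open>auto intro!: continuous_intros\<close>)
    have 2: "fst x - u * snd x \<noteq> 0" if "x \<in> {x \<in> ?A. L * norm (snd x) \<le> norm (fst x - u * snd x)}" for x
    proof
      assume h: "fst x - u * snd x = 0"
      then have "L * norm (snd x) \<le> 0" using that by simp
      then have "snd x = 0" using L(2) by (simp add: mult_le_0_iff)
      then show False using h that by (cases x) auto
    qed
    show "continuous_map (top_of_set {x \<in> ?A. L * norm (snd x) \<le> norm (fst x - u * snd x)}) M
        (\<lambda>x. G (of_real L * cnj (snd x / (fst x - u * snd x))))"
    proof (rule continuous_map_compose_on[OF G(1)])
      show "continuous_on {x \<in> ?A. L * norm (snd x) \<le> norm (fst x - u * snd x)} (\<lambda>x. of_real L * cnj (snd x / (fst x - u * snd x)))"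
        by (intro continuous_intros) (use 2 in auto)
      show "of_real L * cnj (snd x / (fst x - u * snd x)) \<in> cball 0 1" if "x \<in> {x \<in> ?A. L * norm (snd x) \<le> norm (fst x - u * snd x)}" for x
        using 2[OF that] that L(2) by (simp add: norm_mult norm_divide divide_le_eq del: complex_cnj_divide complex_cnj_diff complex_cnj_mult)
    qed
    show "e (fst x / snd x) = G (of_real L * cnj (snd x / (fst x - u * snd x)))"
      if x: "x \<in> ?A" "norm (fst x - u * snd x) = L * norm (snd x)" for x
    proof -
      have s: "snd x \<noteq> 0" using 1[of x] x by simp
      define q where "q = fst x / snd x - u"
      have q: "fst x - u * snd x = q * snd x" using s by (simp add: q_def field_simps)
      have nq: "norm q = L" using x(2) s unfolding q by (simp add: norm_mult)
      have q0: "q \<noteq> 0" using nq L(2) by auto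
      have "snd x / (fst x - u * snd x) = 1 / q" unfolding q using s by simp
      then have "of_real L * cnj (snd x / (fst x - u * snd x)) = of_real L / cnj q" by simp
      also have "\<dots> = q / of_real L"
      proof -
        have "of_real L * of_real L = q * cnj q" using complex_norm_square[of q] nq by (simp add: power2_eq_square)
        then show ?thesis using q0 L(2) by (simp add: field_simps)
      qed
      finally have z: "of_real L * cnj (snd x / (fst x - u * snd x)) = q / of_real L" .
      have "norm (q / of_real L) = 1" using nq L(2) by (simp add: norm_divide)
      then show ?thesis unfolding z using G(3) L(2) by (simp add: q_def)
    qed
  qed (intro continuous_intros)+
  \<comment> \<open>\<open>a\<close>, \<open>b\<close> form the first row of an SU(2) matrix: a
    rotation with parameter \<open>pi * snd x\<close> about an axis tilted by
    \<open>pi * fst x\<close>, times the diagonal matrix of \<open>cis (pi * snd x)\<close> and its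
    conjugate. At tilt 0 the product is the square of the diagonal matrix and acts on ratios by
    \<open>cis (4 * pi * snd x)\<close>; at tilt \<open>pi\<close> the two factors cancel.\<close>
  define a where "a x = (of_real (cos (pi * snd x)) + \<i> * of_real (sin (pi * snd x) * cos (pi * fst x))) * cis (pi * snd x)" for x :: "real \<times> real"
  define b where "b x = of_real (sin (pi * snd x) * sin (pi * fst x)) * cis (- pi * snd x)" for x :: "real \<times> real"
  have ab: "a x * cnj (a x) + b x * cnj (b x) = 1" for x
  proof -
    let ?c = "cos (pi * snd x)" and ?s = "sin (pi * snd x)" and ?c' = "cos (pi * fst x)" and ?s' = "sin (pi * fst x)"
    have "a x * cnj (a x) = of_real ((norm (a x))\<^sup>2)" "b x * cnj (b x) = of_real ((norm (b x))\<^sup>2)"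
      using complex_norm_square by metis+
    then have *: "a x * cnj (a x) + b x * cnj (b x) = of_real ((norm (a x))\<^sup>2 + (norm (b x))\<^sup>2)" by (simp only: of_real_add)
    have "(norm (a x))\<^sup>2 = ?c\<^sup>2 + (?s * ?c')\<^sup>2" by (simp only: a_def norm_mult norm_cis mult_1_right cmod_power2) simp
    moreover have "(norm (b x))\<^sup>2 = (?s * ?s')\<^sup>2" by (simp only: b_def norm_mult norm_cis mult_1_right norm_of_real power2_abs)
    moreover have "?c\<^sup>2 + (?s * ?c')\<^sup>2 + (?s * ?s')\<^sup>2 = 1"
    proof -
      have "(?s * ?c')\<^sup>2 + (?s * ?s')\<^sup>2 = ?s\<^sup>2 * (?c'\<^sup>2 + ?s'\<^sup>2)" by (simp only: power_mult_distrib distrib_left)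
      then show ?thesis unfolding sin_cos_squared_add2 add.assoc by simp
    qed
    ultimately have "(norm (a x))\<^sup>2 + (norm (b x))\<^sup>2 = 1" by (simp only: add.assoc)
    then show ?thesis unfolding * by simp
  qed
  define P where "P i x = a x * d i + b x" for i x
  define Q where "Q i x = - cnj (b x) * d i + cnj (a x)" for i x
  \<comment> \<open>The determinant of two coordinate vectors is invariant under matrices of
    determinant 1; initially the vectors are \<open>(d i, 1)\<close> and
    \<open>(d j, 1)\<close>.\<close>
  have PQ: "P i x * Q j x - P j x * Q i x = d i - d j" for i j x
  proof -
    have "P i x * Q j x - P j x * Q i x = (a x * cnj (a x) + b x * cnj (b x)) * (d i - d j)"
      by (simp add: P_def Q_def algebra_simps)
    then show ?thesis by (simp add: ab)
  qed
  have nPQ: "P i x * cnj (P i x) + Q i x * cnj (Q i x) = 1 + d i * cnj (d i)" for i x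
  proof -
    have "P i x * cnj (P i x) + Q i x * cnj (Q i x) = (a x * cnj (a x) + b x * cnj (b x)) * (1 + d i * cnj (d i))"
      by (simp add: P_def Q_def algebra_simps)
    then show ?thesis by (simp add: ab)
  qed
  have nPQ': "(norm (P i x))\<^sup>2 + (norm (Q i x))\<^sup>2 = 1 + (norm (d i))\<^sup>2" for i x
  proof -
    have "complex_of_real ((norm (P i x))\<^sup>2 + (norm (Q i x))\<^sup>2) = of_real (1 + (norm (d i))\<^sup>2)"
      using nPQ[of i x] by (simp only: of_real_add complex_norm_square of_real_1)
    then show ?thesis by (simp only: of_real_eq_iff)
  qed
  have PQ0: "(P i x, Q i x) \<in> - {(0, 0)}" for i x
  proof -
    have "(norm (P i x))\<^sup>2 + (norm (Q i x))\<^sup>2 > 0" unfolding nPQ' by (simp add: add_pos_nonneg)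
    then show ?thesis by auto
  qed
  have bound: "norm (P i x) \<le> 1 + B" "norm (Q i x) \<le> 1 + B" if "i < n" for i x
  proof -
    have "(norm (d i))\<^sup>2 \<le> B\<^sup>2" by (rule power_mono[OF d(1)[OF that]]) simp
    moreover have "(1 + B)\<^sup>2 = 1 + B\<^sup>2 + 2 * B" by (simp add: power2_sum)
    ultimately have "1 + (norm (d i))\<^sup>2 \<le> (1 + B)\<^sup>2" using B by linarith
    then have "(norm (P i x))\<^sup>2 \<le> (1 + B)\<^sup>2" "(norm (Q i x))\<^sup>2 \<le> (1 + B)\<^sup>2"
      using nPQ'[of i x] zero_le_power2[of "norm (P i x)"] zero_le_power2[of "norm (Q i x)"] by linarith+
    then show "norm (P i x) \<le> 1 + B" "norm (Q i x) \<le> 1 + B" using B by (auto intro: power2_le_imp_le)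
  qed
  \<comment> \<open>Two points in the cap would both have second coordinate at most
    \<open>(1 + B) * (1 + norm u) / L\<close> in modulus, so their determinant
    \<open>d i - d j\<close> would be at most \<open>2 * (1 + B)^2 * (1 + norm u) / L\<close>, less
    than \<open>\<delta>\<close> by the choice of \<open>L\<close>. Hence the cap never holds two
    points at once, which matters because \<open>G\<close> may fail to be injective.\<close>
  have one: "\<not> (L * norm (Q i x) \<le> norm (P i x - u * Q i x) \<and> L * norm (Q j x) \<le> norm (P j x - u * Q j x))"
    if ij: "i < n" "j < n" "i \<noteq> j" for i j x
  proof
    assume h: "L * norm (Q i x) \<le> norm (P i x - u * Q i x) \<and> L * norm (Q j x) \<le> norm (P j x - u * Q j x)"
    have *: "L * norm (Q k x) \<le> (1 + B) * (1 + norm u)" if k: "k < n" "L * norm (Q k x) \<le> norm (P k x - u * Q k x)" for k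
    proof -
      have "norm (P k x - u * Q k x) \<le> norm (P k x) + norm u * norm (Q k x)" by (metis norm_mult norm_triangle_ineq4)
      also have "\<dots> \<le> (1 + B) + norm u * (1 + B)" using bound[OF k(1), of x] by (intro add_mono mult_left_mono) auto
      finally show ?thesis using k(2) by (simp add: algebra_simps)
    qed
    have "\<delta> * L \<le> norm (d i - d j) * L" using d(2)[OF ij] L(2) by (intro mult_right_mono) auto
    also have "\<dots> \<le> (norm (P i x) * norm (Q j x) + norm (P j x) * norm (Q i x)) * L"
      unfolding PQ[symmetric, of i j x] using L(2) by (intro mult_right_mono) (metis norm_mult norm_triangle_ineq4, simp)
    also have "\<dots> = norm (P i x) * (L * norm (Q j x)) + norm (P j x) * (L * norm (Q i x))" by (simp add: algebra_simps)
    also have "\<dots> \<le> (1 + B) * ((1 + B) * (1 + norm u)) + (1 + B) * ((1 + B) * (1 + norm u))"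
    proof (rule add_mono)
      show "norm (P i x) * (L * norm (Q j x)) \<le> (1 + B) * ((1 + B) * (1 + norm u))"
        by (rule mult_mono[OF bound(1)[OF ij(1)] *[OF ij(2)]]) (use h B L(2) in auto)
      show "norm (P j x) * (L * norm (Q i x)) \<le> (1 + B) * ((1 + B) * (1 + norm u))"
        by (rule mult_mono[OF bound(1)[OF ij(2)] *[OF ij(1)]]) (use h B L(2) in auto)
    qed
    also have "\<dots> = 2 * (1 + B)^2 * (1 + norm u)" by (simp add: power2_eq_square algebra_simps)
    finally show False using L(3) by simp
  qed
  define S where "S x = (\<lambda>i\<in>{..<n}. F (P i x, Q i x))" for x
  have cS: "continuous_map (top_of_set unit_square) (ordered_config M n) S"
    unfolding continuous_map_ordered_config
  proof (intro conjI allI impI ballI)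
    fix i assume i: "i < n"
    have "continuous_map (top_of_set unit_square) M (\<lambda>x. F (P i x, Q i x))"
      by (rule continuous_map_compose_on[OF cF]) (use PQ0 in \<open>auto simp: P_def Q_def a_def b_def intro!: continuous_intros\<close>)
    then show "continuous_map (top_of_set unit_square) M (\<lambda>x. S x i)" using i by (simp add: S_def)
  next
    fix x assume "x \<in> topspace (top_of_set unit_square)"
    show "S x \<in> extensional {..<n}" by (simp add: S_def)
    have ne: "F (P i x, Q i x) \<noteq> F (P j x, Q j x)" if ij: "i < n" "j < n" "i \<noteq> j" and le: "norm (P i x - u * Q i x) \<le> L * norm (Q i x)" for i j
    proof (cases "norm (P j x - u * Q j x) \<le> L * norm (Q j x)")
      case True
      have dne: "d i \<noteq> d j" using d(2)[OF ij] \<delta> by auto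
      have "Q i x \<noteq> 0" "Q j x \<noteq> 0" using le True PQ0[of i x] PQ0[of j x] by auto
      then have "P i x / Q i x \<noteq> P j x / Q j x" using PQ[of i x j] dne by (auto simp: frac_eq_eq)
      then show ?thesis using le True inj by (simp add: F_def inj_eq)
    next
      case False
      then have j: "L * norm (Q j x) < norm (P j x - u * Q j x)" by simp
      then have i: "norm (P i x - u * Q i x) < L * norm (Q i x)" using one[OF ij, of x] by force
      then have Q: "Q i x \<noteq> 0" by auto
      have "P i x - u * Q i x = (P i x / Q i x - u) * Q i x" using Q by (simp add: field_simps)
      then have "norm (P i x / Q i x - u) * norm (Q i x) < L * norm (Q i x)" using i by (simp add: norm_mult)
      then have "P i x / Q i x \<in> ball u L" using Q by (simp add: dist_norm norm_minus_commute)
      then have "F (P i x, Q i x) \<in> e ` ball u L" using le by (simp add: F_def)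
      moreover have "norm (of_real L * cnj (Q j x / (P j x - u * Q j x))) \<le> 1"
        using j L(2) by (simp add: norm_mult norm_divide divide_le_eq del: complex_cnj_divide complex_cnj_diff complex_cnj_mult)
      then have "F (P j x, Q j x) \<notin> e ` ball u L" using G(2) False by (simp add: F_def)
      ultimately show ?thesis by metis
    qed
    show "inj_on (S x) {..<n}"
    proof (rule inj_onI, rule ccontr)
      fix i j assume ij: "i \<in> {..<n}" "j \<in> {..<n}" "S x i = S x j" "i \<noteq> j"
      then have "norm (P i x - u * Q i x) \<le> L * norm (Q i x) \<or> norm (P j x - u * Q j x) \<le> L * norm (Q j x)"
        using one[of i j x] by force
      then show False using ne[of i j] ne[of j i] ij by (auto simp: S_def)
    qed
  qed
  have F1: "F (z, 1) = e z" if "norm z \<le> B" for z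
    using norm_triangle_ineq4[of z u] that L(1) by (simp add: F_def)
  show ?thesis
  proof (rule path_homotopicI[OF cS])
    fix t :: real assume "t \<in> {0..1}"
    have "F (P i (0, t), Q i (0, t)) = e (cis (4 * pi * t) * d i)" if "i < n" for i
    proof -
      have "of_real (cos (pi * t)) + \<i> * of_real (sin (pi * t)) = cis (pi * t)" by (simp add: complex_eq_iff)
      then have a0: "a (0, t) = cis (2 * pi * t)" by (simp add: a_def cis_mult mult.assoc)
      have b0: "b (0, t) = 0" by (simp add: b_def)
      let ?c = "cis (2 * pi * t)"
      have q: "Q i (0, t) = cnj ?c" "P i (0, t) = ?c * d i" by (simp_all add: Q_def P_def a0 b0)
      have "?c * d i / cnj ?c = cis (4 * pi * t) * d i"
      proof -
        have "?c * d i / cnj ?c = ?c * ?c * d i" by (simp add: cis_cnj divide_inverse)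
        also have "?c * ?c = cis (4 * pi * t)" by (simp add: cis_mult mult.assoc)
        finally show ?thesis .
      qed
      moreover have "norm (?c * d i - u * cnj ?c) \<le> L"
        using norm_triangle_ineq4[of "?c * d i" "u * cnj ?c"] d(1)[OF that] L(1) by (simp add: norm_mult)
      ultimately show ?thesis by (simp add: F_def q)
    qed
    then show "S (0, t) = (\<lambda>i\<in>{..<n}. e (cis (4 * pi * t) * d i))" by (auto simp: S_def)
    have "of_real (cos (pi * t)) - \<i> * of_real (sin (pi * t)) = cis (- (pi * t))" by (simp add: complex_eq_iff)
    then have "a (1, t) = 1" "b (1, t) = 0" by (simp_all add: a_def b_def cis_mult)
    then show "S (1, t) = (\<lambda>i\<in>{..<n}. e (d i))" using F1 d(1) by (auto simp: S_def P_def Q_def)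
  next
    fix s :: real
    have "a (s, 0) = 1" "b (s, 0) = 0" by (auto simp: a_def b_def complex_eq_iff)
    then show "S (s, 0) = (\<lambda>i\<in>{..<n}. e (cis (4 * pi * 0) * d i))" using F1 d(1) by (auto simp: S_def P_def Q_def)
    have "a (s, 1) = 1" "b (s, 1) = 0" by (auto simp: a_def b_def complex_eq_iff)
    moreover have "cis (4 * pi * 1) = 1" using cis_multiple_2pi[of 2] by (simp add: algebra_simps)
    ultimately show "S (s, 1) = (\<lambda>i\<in>{..<n}. e (cis (4 * pi * 1) * d i))" using F1 d(1) by (auto simp: S_def P_def Q_def)
  qed
qed

section \<open>Rotations realizing a permutation\<close>

text \<open>Every cycle of \<open>p\<close> receives a representative, a length, and positions
  counted from the representative. Preferring \<open>l\<close>, then \<open>j\<close>, as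
  representative puts \<open>l\<close> at position 0, so that its point can be 1, and also
  \<open>j\<close> unless it lies on the cycle of \<open>l\<close>.\<close>

lemma orbit_coordinates:
  fixes p :: "nat \<Rightarrow> nat" and l j :: nat
  assumes p: "p permutes {..<n}"
  obtains rep len \<kappa> :: "nat \<Rightarrow> nat" and N :: nat where "N > 0"
    "\<And>i. rep (p i) = rep i" "\<And>i. len (p i) = len i" "\<And>i. len i > 0" "\<And>i. len i dvd N" "\<And>i. (p ^^ len i) i = i"
    "\<And>i k. 0 < k \<Longrightarrow> (p ^^ k) i = i \<Longrightarrow> len i \<le> k"
    "\<And>i. \<kappa> i < len i" "\<And>i. \<kappa> (p i) = (\<kappa> i + 1) mod len i" "\<And>i. (p ^^ \<kappa> i) (rep i) = i"
    "\<And>i k. rep i = rep k \<Longrightarrow> len i = len k" "\<And>i. rep (rep i) = rep i" "rep l = l" "rep j = l \<or> rep j = j"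
proof -
  have bij: "bij p" using p by (rule permutes_bij)
  have "permutation p" using p permutation_permutes by blast
  then obtain N where N: "p ^^ N = id" "N > 0" using permutation_is_nilpotent by blast
  define orb where "orb i = {(p ^^ k) i |k. True}" for i
  define f where "f A = (if l \<in> A then l else if j \<in> A then j else (LEAST x. x \<in> A))" for A
  define rep where "rep i = f (orb i)" for i
  define len where "len i = (LEAST k. 0 < k \<and> (p ^^ k) i = i)" for i
  define \<kappa> where "\<kappa> i = (LEAST k. (p ^^ k) (rep i) = i)" for i
  have self: "i \<in> orb i" for i unfolding orb_def by (auto intro: exI[of _ 0])
  have orb_sub: "orb x \<subseteq> orb i" if "x \<in> orb i" for x i
    using that unfolding orb_def by (auto simp: funpow_add[symmetric, THEN fun_cong, unfolded o_def])
  have pN: "(p ^^ (N * a)) i = i" for a i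
    using N(1) by (simp add: funpow_mult[symmetric])
  have orb_sym: "i \<in> orb x" if "x \<in> orb i" for x i
  proof -
    obtain k where k: "x = (p ^^ k) i" using \<open>x \<in> orb i\<close> unfolding orb_def by blast
    have "k \<le> N * k" using N(2) by simp
    then have "(p ^^ (N * k - k)) x = (p ^^ (N * k)) i" unfolding k by (metis comp_apply funpow_add le_add_diff_inverse2)
    then have "(p ^^ (N * k - k)) x = i" using pN by simp
    then show ?thesis unfolding orb_def by blast
  qed
  have orb_eq: "orb x = orb i" if "x \<in> orb i" for x i using orb_sub orb_sym that by blast
  have fin: "f A \<in> A" if "A \<noteq> {}" for A :: "nat set"
    unfolding f_def using that by (auto intro: LeastI)
  have rep_in: "rep i \<in> orb i" for i unfolding rep_def using fin[of "orb i"] self[of i] by blast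
  have p_in: "p i \<in> orb i" for i unfolding orb_def by (auto intro: exI[of _ 1])
  have rep_eq: "rep x = rep i" if "x \<in> orb i" for x i unfolding rep_def orb_eq[OF that] ..
  have len: "0 < len i \<and> (p ^^ len i) i = i" for i
    unfolding len_def by (rule LeastI[of _ N]) (use N pN[of 1] in auto)
  have len_le: "len i \<le> k" if "0 < k" "(p ^^ k) i = i" for i k
    unfolding len_def by (rule Least_le) (use that in simp)
  have inj: "(p ^^ a) x = (p ^^ a) y \<longleftrightarrow> x = y" for a x y
    using bij_betw_funpow[of p UNIV a] bij by (metis bij_is_inj inj_eq)
  have per: "(p ^^ k) x = x \<longleftrightarrow> (p ^^ k) i = i" if "x \<in> orb i" for x i k
  proof -
    obtain a where a: "x = (p ^^ a) i" using \<open>x \<in> orb i\<close> unfolding orb_def by blast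
    have "(p ^^ k) x = (p ^^ a) ((p ^^ k) i)" unfolding a by (metis add.commute comp_apply funpow_add)
    then show ?thesis using a inj by metis
  qed
  have len_eq: "len x = len i" if "x \<in> orb i" for x i unfolding len_def using per[OF that] by simp
  have \<kappa>: "(p ^^ \<kappa> i) (rep i) = i" for i
  proof -
    obtain k where "i = (p ^^ k) (rep i)" using orb_sym[OF rep_in[of i]] unfolding orb_def by blast
    then show ?thesis unfolding \<kappa>_def by (metis (mono_tags, lifting) LeastI)
  qed
  have lrep: "len (rep i) = len i" for i using len_eq[OF rep_in] .
  have mod: "(p ^^ (k mod len i)) (rep i) = (p ^^ k) (rep i)" for k i
    using funpow_mod_eq[of "len i" p "rep i" k] len[of "rep i"] lrep by simp
  have \<kappa>len: "\<kappa> i < len i" for i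
  proof -
    have "(p ^^ (\<kappa> i mod len i)) (rep i) = i" using mod \<kappa> by simp
    then have "\<kappa> i \<le> \<kappa> i mod len i" unfolding \<kappa>_def by (rule Least_le)
    then show ?thesis using len[of i] mod_less_divisor[of "len i" "\<kappa> i"] by linarith
  qed
  have uniq: "a = b" if "a < len i" "b < len i" "(p ^^ a) (rep i) = (p ^^ b) (rep i)" for a b i
  proof -
    have *: "\<not> a < b" if h: "a < len i" "b < len i" "(p ^^ a) (rep i) = (p ^^ b) (rep i)" for a b
    proof
      assume ab: "a < b"
      have "(p ^^ a) ((p ^^ (b - a)) (rep i)) = (p ^^ a) (rep i)" using h(3) ab by (metis comp_apply funpow_add le_add_diff_inverse less_imp_le)
      then have "(p ^^ (b - a)) (rep i) = rep i" using inj by blast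
      then have "len i \<le> b - a" using len_le[of "b - a" "rep i"] ab lrep by simp
      then show False using h(2) ab by linarith
    qed
    show ?thesis using *[OF that] *[OF that(2,1) that(3)[symmetric]] by simp
  qed
  have \<kappa>p: "\<kappa> (p i) = (\<kappa> i + 1) mod len i" for i
  proof (rule uniq[of _ i])
    show "\<kappa> (p i) < len i" using \<kappa>len[of "p i"] len_eq[OF p_in] by simp
    show "(\<kappa> i + 1) mod len i < len i" using len by simp
    have "(p ^^ ((\<kappa> i + 1) mod len i)) (rep i) = p ((p ^^ \<kappa> i) (rep i))" unfolding mod by simp
    then show "(p ^^ \<kappa> (p i)) (rep i) = (p ^^ ((\<kappa> i + 1) mod len i)) (rep i)"
      using \<kappa>[of "p i"] \<kappa>[of i] rep_eq[OF p_in] by simp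
  qed
  show thesis
  proof (rule that[of N rep len \<kappa>, OF N(2) rep_eq[OF p_in] len_eq[OF p_in]])
    show "len i dvd N" for i
    proof (rule ccontr)
      assume "\<not> len i dvd N"
      then have "0 < N mod len i" by (simp add: dvd_eq_mod_eq_0)
      moreover have "(p ^^ (N mod len i)) i = i" using funpow_mod_eq[of "len i" p i N] len[of i] pN[of 1 i] by simp
      ultimately have "len i \<le> N mod len i" using len_le by blast
      then show False using len[of i] mod_less_divisor[of "len i" N] by linarith
    qed
    show "rep l = l" unfolding rep_def f_def using self by simp
    show "rep j = l \<or> rep j = j" unfolding rep_def f_def using self by simp
    show "len i = len k" if "rep i = rep k" for i k using lrep[of i] lrep[of k] that by simp
    show "rep (rep i) = rep i" for i using rep_eq[OF rep_in] .
  qed (use len len_le \<kappa>len \<kappa>p \<kappa> in auto)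
qed

lemma norm_cis_diff_1: "(norm (cis t - 1))\<^sup>2 = 2 - 2 * cos t"
proof -
  have "(norm (cis t - 1))\<^sup>2 = (cos t - 1)\<^sup>2 + (sin t)\<^sup>2" by (simp add: cmod_power2)
  also have "\<dots> = ((sin t)\<^sup>2 + (cos t)\<^sup>2) + 1 - 2 * cos t" by (simp add: power2_eq_square algebra_simps del: sin_cos_squared_add)
  finally show ?thesis by simp
qed

text \<open>Among the nontrivial \<open>r\<close>-th roots of unity the two neighbours of 1 have the
  largest real part, hence are closest to 1. Passing from \<open>k\<close> to \<open>r - k\<close>
  brings the angle into the range where the cosine decreases.\<close>

lemma cos_root_of_unity_le:
  fixes k r :: nat
  assumes "0 < k" "k < r"
  shows "cos (2 * pi * k / r) \<le> cos (2 * pi / r)"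
proof -
  have *: "cos (2 * pi * m / r) \<le> cos (2 * pi / r)" if "0 < m" "2 * m \<le> r" for m :: nat
  proof (rule cos_monotone_0_pi_le)
    have r: "real r > 0" using assms by simp
    show "0 \<le> 2 * pi / r" using r by simp
    have "2 * pi * 1 \<le> 2 * pi * real m" using that(1) by (intro mult_left_mono) auto
    then show "2 * pi / r \<le> 2 * pi * m / r" using r by (simp add: divide_right_mono)
    have "real (2 * m) \<le> real r" using that(2) by (simp only: of_nat_le_iff)
    then have "pi * real (2 * m) \<le> pi * r" by (intro mult_left_mono) auto
    then show "2 * pi * m / r \<le> pi" using r by (simp add: divide_le_eq algebra_simps)
  qed
  show ?thesis
  proof (cases "2 * k \<le> r")
    case True
    then show ?thesis using * assms by blast
  next
    case False
    have "cos (2 * pi * (r - k) / r) \<le> cos (2 * pi / r)" using *[of "r - k"] False assms by simp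
    moreover have "2 * pi * real (r - k) / r = 2 * pi - 2 * pi * k / r" using assms by (simp add: of_nat_diff field_simps)
    ultimately show ?thesis by (simp add: cos_diff)
  qed
qed

text \<open>The cycle of \<open>l\<close> lies on the unit circle, and cycles containing neither
  \<open>j\<close> nor \<open>l\<close> have radius at least 3. The point of \<open>j\<close> is
  nearest to 1, at distance at most 9/5, so that its loop around 1 stays within radius 14/5 and
  cannot meet points that rotate at another speed. The common speed of \<open>j\<close>,
  \<open>p j\<close>, \<open>l\<close>, \<open>p l\<close> makes the rotation rigid when there are
  no other strands.\<close>

proposition rotating_configuration:
  assumes p: "p permutes {..<n}" and n: "n \<ge> 3" and moved: "i0 < n" "p i0 \<noteq> i0"
  obtains d :: "nat \<Rightarrow> complex" and v :: "nat \<Rightarrow> real" and N r j l :: nat where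
    "inj d" "\<And>i. d (p i) = cis (2 * pi * v i) * d i"
    "\<And>i k. v i = v k \<or> norm (d i) \<noteq> norm (d k)" "\<And>k. v k = v j \<or> norm (d k) \<ge> 3"
    "\<And>i. cis (2 * pi * (real N * v i)) = 1" "l < n" "j < n" "p l \<noteq> l" "l \<noteq> j" "l \<noteq> p j"
    "d l = 1" "norm (d j - 1) \<le> 9/5" "\<And>k. k \<noteq> l \<Longrightarrow> norm (d k - 1) \<ge> norm (d j - 1)"
    "r > 0" "\<And>i. i \<in> {j, p j, l, p l} \<Longrightarrow> v i = 1 / r" "N > 0"
proof -
  have pn: "p i < n \<longleftrightarrow> i < n" for i using permutes_in_image[OF p, of i] by simp
  have pinj: "p x = p y \<longleftrightarrow> x = y" for x y using permutes_inj[OF p] by (simp add: inj_eq)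
  \<comment> \<open>If \<open>p\<close> is an involution, \<open>n \<ge> 3\<close> leaves a
    \<open>j\<close> outside the cycle of \<open>i0\<close>, which serves as \<open>l\<close>.
    Otherwise some cycle has length at least 3, and \<open>j\<close> is the successor of
    \<open>l\<close> on it. In both cases \<open>j\<close> is fixed or its cycle is as long as that
    of \<open>l\<close>.\<close>
  have "\<exists>l j. l < n \<and> j < n \<and> p l \<noteq> l \<and> l \<noteq> j \<and> l \<noteq> p j \<and> ((j = p l \<and> p (p l) \<noteq> l) \<or> (\<forall>i. p (p i) = i))"
  proof (cases "\<forall>i<n. p (p i) = i")
    case True
    then have inv: "\<forall>i. p (p i) = i" using permutes_not_in[OF p] by (metis lessThan_iff)
    have "card ({..<n} - {i0, p i0}) > 0" using n moved by (simp add: card_Diff_subset pn)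
    then obtain j where "j \<in> {..<n} - {i0, p i0}" by (metis card_gt_0_iff ex_in_conv)
    then have "i0 < n \<and> j < n \<and> p i0 \<noteq> i0 \<and> i0 \<noteq> j \<and> i0 \<noteq> p j" using moved inv by (metis Diff_iff insertCI lessThan_iff)
    then show ?thesis using inv by blast
  next
    case False
    then obtain l where l: "l < n" "p (p l) \<noteq> l" by blast
    then have "p l \<noteq> l" by metis
    then show ?thesis using l pn[of l] by metis
  qed
  then obtain l j where lj: "l < n" "j < n" "p l \<noteq> l" "l \<noteq> j" "l \<noteq> p j"
    and cs: "(j = p l \<and> p (p l) \<noteq> l) \<or> (\<forall>i. p (p i) = i)" by blast
  obtain rep len \<kappa> N where N: "N > 0"
    and rp: "\<And>i. rep (p i) = rep i" and lp: "\<And>i. len (p i) = len i" and l0: "\<And>i. len i > 0" and lN: "\<And>i. len i dvd N"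
    and pl: "\<And>i. (p ^^ len i) i = i" and lmin: "\<And>i k. 0 < k \<Longrightarrow> (p ^^ k) i = i \<Longrightarrow> len i \<le> k"
    and \<kappa>l: "\<And>i. \<kappa> i < len i" and \<kappa>p: "\<And>i. \<kappa> (p i) = (\<kappa> i + 1) mod len i" and \<kappa>r: "\<And>i. (p ^^ \<kappa> i) (rep i) = i"
    and rl: "\<And>i k. rep i = rep k \<Longrightarrow> len i = len k" and rr: "\<And>i. rep (rep i) = rep i"
    and repl: "rep l = l" and repj: "rep j = l \<or> rep j = j"
    by (rule orbit_coordinates[OF p, of l j]) (rule that)
  have same: "i = k" if "rep i = rep k" "\<kappa> i = \<kappa> k" for i k using \<kappa>r[of i] \<kappa>r[of k] that by metis
  have \<kappa>rep: "\<kappa> (rep i) = 0" for i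
  proof (rule ccontr)
    assume "\<kappa> (rep i) \<noteq> 0"
    then have "len (rep i) \<le> \<kappa> (rep i)" using lmin[of "\<kappa> (rep i)" "rep i"] \<kappa>r[of "rep i"] rr[of i] by simp
    then show False using \<kappa>l[of "rep i"] by simp
  qed
  have len1: "p i \<noteq> i" if "len i \<noteq> 1" for i
  proof
    assume "p i = i"
    then have "len i \<le> 1" using lmin[of 1 i] by simp
    then show False using that l0[of i] by simp
  qed
  have fixed: "len i = 1" if "p i = i" for i using len1 that by blast
  have lenl: "len l \<ge> 2" using pl[of l] lj(3) l0[of l] by (cases "len l = 1") auto
  define jf where "jf \<longleftrightarrow> p j = j"
  have jrep: "rep j = j" if "\<forall>i. p (p i) = i"
  proof (rule ccontr)
    assume "rep j \<noteq> j"
    then have rj: "rep j = l" using repj by simp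
    have "len l \<le> 2" using lmin[of 2 l] that by (simp add: numeral_2_eq_2)
    then have "\<kappa> j < 2" using \<kappa>l[of j] rl[of j l] rj repl by simp
    then have "\<kappa> j = 0 \<or> \<kappa> j = 1" by linarith
    then have "l = j \<or> p l = j" using \<kappa>r[of j] rj by auto
    then show False using lj(4,5) that by metis
  qed
  have jf_inv: "\<forall>i. p (p i) = i" if jf
  proof -
    have "\<not> (j = p l \<and> p (p l) \<noteq> l)" using that lj(3) pinj[of "p l" l] unfolding jf_def by auto
    then show ?thesis using cs by blast
  qed
  have jlen: "rep j = l" if "\<not> (\<forall>i. p (p i) = i)" using cs that rp[of l] repl by auto
  \<comment> \<open>A fixed \<open>j\<close> goes to the centre, where any speed is possible, in
    particular that of \<open>l\<close>. If \<open>j\<close> represents a longer cycle, radius 14/5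
    puts it at distance 9/5 from 1, closer than all points besides \<open>l\<close>. The values
    \<open>3 + real m\<close> give the remaining cycles distinct radii.\<close>
  define Rad where "Rad m = (if m = l then 1 else if m = j then (if jf then 0 else 14/5) else 3 + real m)" for m
  define v where "v i = (if jf \<and> i = j then 1 / real (len l) else 1 / real (len i))" for i
  define d where "d i = of_real (Rad (rep i)) * cis (2 * pi * \<kappa> i / len i)" for i
  have Rad0: "Rad m \<ge> 0" for m by (simp add: Rad_def)
  have nd: "norm (d i) = Rad (rep i)" for i using Rad0[of "rep i"] by (simp add: d_def norm_mult)
  have Radinj: "m = m'" if "Rad m = Rad m'" for m m'
    using that of_nat_0_le_iff[of m, where 'a = real] of_nat_0_le_iff[of m', where 'a = real] unfolding Rad_def by (auto split: if_splits)
  have repj_fixed: "i = j" if jf "rep i = j" for i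
    using \<kappa>l[of i] rl[of i j] that jrep[OF jf_inv] fixed[of j] \<kappa>r[of i] unfolding jf_def by auto
  have vrep: "v i = v k" if "rep i = rep k" for i k
  proof (cases "jf \<and> (i = j \<or> k = j)")
    case True
    then have "i = k" using repj_fixed that jrep[OF jf_inv] by metis
    then show ?thesis by simp
  next
    case False
    then show ?thesis using rl[OF that] by (auto simp: v_def)
  qed
  have vj: "v j = v l"
  proof (cases "\<forall>i. p (p i) = i")
    case True
    then have "len x \<le> 2" for x using lmin[of 2 x] by (simp add: numeral_2_eq_2)
    then have l2: "len l = 2" using lenl by (metis le_antisym)
    show ?thesis
    proof (cases jf)
      case False
      then have "len j = 2" using \<open>\<And>x. len x \<le> 2\<close>[of j] pl[of j] l0[of j] unfolding jf_def by (cases "len j = 1") auto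
      then show ?thesis using l2 False by (simp add: v_def)
    qed (use l2 lj in \<open>simp add: v_def\<close>)
  next
    case False
    then have "rep j = rep l" using jlen repl by simp
    then show ?thesis by (rule vrep)
  qed
  show thesis
  proof (rule that[of d v j N l "len l"])
    show "inj d"
    proof (rule injI)
      fix i k assume e: "d i = d k"
      then have rik: "rep i = rep k" using nd Radinj by metis
      show "i = k"
      proof (cases "Rad (rep i) = 0")
        case True
        then have "jf" "rep i = j" by (auto simp: Rad_def split: if_splits)
        then show ?thesis using repj_fixed rik by metis
      next
        case False
        have le: "len i = len k" by (rule rl[OF rik])
        have pos: "real (len k) > 0" using l0 by simp
        have "cis (2 * pi * (\<kappa> i / len k)) = cis (2 * pi * (\<kappa> k / len k))" using e False rik le by (simp add: d_def)
        moreover have "real (\<kappa> i) / len k < 1" "real (\<kappa> k) / len k < 1" using \<kappa>l[of i] \<kappa>l[of k] le pos by simp_all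
        ultimately have "real (\<kappa> i) / len k = \<kappa> k / len k" using cis_2pi_eq[of "\<kappa> i / len k" "\<kappa> k / len k"] pos by auto
        then have "\<kappa> i = \<kappa> k" using pos by simp
        then show ?thesis using same rik by blast
      qed
    qed
    show "d (p i) = cis (2 * pi * v i) * d i" for i
    proof (cases "jf \<and> i = j")
      case True
      then have "d i = 0" "p i = i" using jrep[OF jf_inv] lj(4) by (auto simp: d_def Rad_def jf_def)
      then show ?thesis by simp
    next
      case False
      then have vi: "v i = 1 / len i" by (auto simp: v_def)
      have pos: "real (len i) > 0" using l0 by simp
      define q where "q = (\<kappa> i + 1) div len i"
      have q: "real (\<kappa> i + 1) = real q * real (len i) + real ((\<kappa> i + 1) mod len i)"
        unfolding q_def by (metis div_mult_mod_eq of_nat_add of_nat_mult)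
      have "2 * pi * real (\<kappa> i) / len i + 2 * pi * (1 / len i) = 2 * pi * real (\<kappa> i + 1) / len i"
        by (simp add: add_divide_distrib distrib_left)
      also have "\<dots> = 2 * pi * real q + 2 * pi * real ((\<kappa> i + 1) mod len i) / len i"
        unfolding q using pos by (simp add: add_divide_distrib distrib_left)
      finally have "2 * pi * real (\<kappa> i) / len i + 2 * pi * (1 / len i) = 2 * pi * real q + 2 * pi * real ((\<kappa> i + 1) mod len i) / len i" .
      then have "cis (2 * pi * v i) * cis (2 * pi * \<kappa> i / len i) = cis (2 * pi * real q) * cis (2 * pi * real ((\<kappa> i + 1) mod len i) / len i)"
        unfolding vi cis_mult by (simp add: add.commute)
      also have "cis (2 * pi * real q) = 1" using cis_multiple_2pi[of "real q"] by simp
      finally show ?thesis unfolding d_def rp lp \<kappa>p by (simp add: algebra_simps)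
    qed
    show "v i = v k \<or> norm (d i) \<noteq> norm (d k)" for i k using nd Radinj vrep by metis
    show "v k = v j \<or> norm (d k) \<ge> 3" for k
    proof (cases "rep k = l \<or> rep k = j")
      case True
      then have "v k = v l \<or> v k = v j" using vrep[of k l] vrep[of k j] repl repj rr[of k] by metis
      then show ?thesis using vj by metis
    next
      case False
      then show ?thesis by (simp add: nd Rad_def)
    qed
    show "cis (2 * pi * (real N * v i)) = 1" for i
    proof -
      have "\<exists>m. v i = 1 / real m \<and> m dvd N \<and> m > 0" unfolding v_def using lN l0 by (cases "jf \<and> i = j") auto
      then obtain m k where "v i = 1 / real m" "N = m * k" "m > 0" by (metis dvd_def)
      then have "real N * v i = real k" by simp
      then show ?thesis using cis_multiple_2pi[of "real k"] by simp
    qed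
    have dl: "d l = 1" using repl \<kappa>rep[of l] by (simp add: d_def Rad_def)
    then show "d l = 1" .
    have other: "norm (d k - 1) \<ge> 2" if "rep k \<noteq> l" "rep k \<noteq> j" for k
      using norm_triangle_ineq2[of "d k" 1] nd[of k] that by (simp add: Rad_def)
    have orbl: "d k = cis (2 * pi * \<kappa> k / len l)" if "rep k = l" for k
      using that rl[of k l] repl by (simp add: d_def Rad_def)
    have main: "norm (d j - 1) \<le> 9/5 \<and> (\<forall>k. k \<noteq> l \<longrightarrow> norm (d k - 1) \<ge> norm (d j - 1))"
    proof (cases "\<forall>i. p (p i) = i")
      case True
      then have len2: "len x \<le> 2" for x using lmin[of 2 x] by (simp add: numeral_2_eq_2)
      then have l2: "len l = 2" using lenl by (metis le_antisym)
      have rj: "rep j = j" by (rule jrep[OF True])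
      have dj: "d j = of_real (Rad j)" using rj \<kappa>rep[of j] by (simp add: d_def)
      have Rj: "Rad j = (if jf then 0 else 14/5)" using lj(4) by (simp add: Rad_def)
      have nj: "norm (d j - 1) = (if jf then 1 else 9/5)"
      proof -
        have "d j - 1 = of_real (Rad j - 1)" by (simp add: dj)
        then have "norm (d j - 1) = \<bar>Rad j - 1\<bar>" by (simp only: norm_of_real)
        then show ?thesis using Rj by simp
      qed
      have "norm (d k - 1) \<ge> norm (d j - 1)" if k: "k \<noteq> l" for k
      proof -
        have kk: "\<kappa> k = 0 \<or> (\<kappa> k = 1 \<and> len k = 2)" using \<kappa>l[of k] len2[of k] by linarith
        consider "rep k = l" | "rep k = j" "k = j" | "rep k = j" "k \<noteq> j" | "rep k \<noteq> l" "rep k \<noteq> j" by blast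
        then show ?thesis
        proof cases
          case 1
          then have "\<kappa> k \<noteq> 0" using same[of k l] repl \<kappa>rep[of l] k by metis
          then have "\<kappa> k = 1" using kk by simp
          then have "d k = -1" using orbl[OF 1] l2 by (simp add: complex_eq_iff)
          then show ?thesis using nj by simp
        next
          case 3
          then have "\<kappa> k \<noteq> 0" using same[of k j] rj \<kappa>rep[of j] by metis
          then have k1: "\<kappa> k = 1" "len k = 2" using kk by auto
          have nf: "\<not> jf" using repj_fixed 3 by metis
          have "d k = - of_real (14/5)" using k1 3(1) Rj nf by (simp add: d_def complex_eq_iff)
          then have "norm (d k - 1) = 19/5"
          proof -
            have "d k - 1 = of_real (- (19/5))" using \<open>d k = - of_real (14/5)\<close> by (simp add: complex_eq_iff)
            then show ?thesis by (simp only: norm_of_real)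
          qed
          then show ?thesis using nj by simp
        qed (use nj other[of k] in auto)
      qed
      then show ?thesis using nj by auto
    next
      case False
      have jp: "j = p l" "p (p l) \<noteq> l" using cs False by auto
      have l3: "len l \<ge> 3"
      proof (rule ccontr)
        assume "\<not> len l \<ge> 3"
        then have "len l = 2" using lenl by simp
        then show False using pl[of l] jp(2) by (simp add: numeral_2_eq_2)
      qed
      have "\<kappa> j = 1" using \<kappa>p[of l] \<kappa>rep[of l] repl l3 jp(1) by simp
      moreover have rj: "rep j = l" using jlen[OF False] .
      ultimately have dj: "d j = cis (2 * pi / len l)" using orbl[of j] by simp
      have sq: "(norm (d j - 1))\<^sup>2 = 2 - 2 * cos (2 * pi / len l)" unfolding dj by (rule norm_cis_diff_1)
      \<comment> \<open>The distance from 1 to the neighbouring root of unity is largest for cycle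
        length 3, where it is the square root of 3, which is below 9/5.\<close>
      have "cos (2 * pi / 3) \<le> cos (2 * pi / len l)"
      proof (rule cos_monotone_0_pi_le)
        show "2 * pi / len l \<le> 2 * pi / 3" using l3 by (intro divide_left_mono) auto
        show "2 * pi / 3 \<le> pi" by simp
      qed simp
      then have "- (1/2) \<le> cos (2 * pi / len l)" using cos_120 by simp
      then have le3: "(norm (d j - 1))\<^sup>2 \<le> 3" using sq by simp
      have "norm (d j - 1) \<le> 9/5"
        by (rule power2_le_imp_le) (use le3 in \<open>simp_all add: power2_eq_square\<close>)
      moreover have "norm (d k - 1) \<ge> norm (d j - 1)" if k: "k \<noteq> l" for k
      proof (cases "rep k = l")
        case True
        then have k0: "\<kappa> k > 0" using same[of k l] repl \<kappa>rep[of l] k by (metis gr0I)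
        have "\<kappa> k < len l" using \<kappa>l[of k] rl[of k l] True repl by simp
        then have "cos (2 * pi * \<kappa> k / len l) \<le> cos (2 * pi / len l)" using cos_root_of_unity_le[OF k0] by simp
        then have "(norm (d j - 1))\<^sup>2 \<le> (norm (d k - 1))\<^sup>2"
          unfolding sq orbl[OF True] norm_cis_diff_1 by simp
        then show ?thesis by (rule power2_le_imp_le) simp
      next
        case False
        then have "rep k \<noteq> j" using rr[of k] rj lj(4) by metis
        then show ?thesis using other[OF False] calculation by simp
      qed
      ultimately show ?thesis by blast
    qed
    then show "norm (d j - 1) \<le> 9/5" by simp
    show "norm (d k - 1) \<ge> norm (d j - 1)" if "k \<noteq> l" for k using main that by blast
    show "v i = 1 / len l" if "i \<in> {j, p j, l, p l}" for i
    proof -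
      have "v i = v l" using that vj vrep[OF rp[of j]] vrep[OF rp[of l]] by auto
      also have "v l = 1 / len l" using lj(4) by (simp add: v_def)
      finally show ?thesis .
    qed
  qed (use lj l0 N in auto)
qed

section \<open>Bi-ordered groups\<close>

lemma biorderable_order:
  assumes "biorderable G"
  obtains r where "\<And>x. x \<in> carrier G \<Longrightarrow> \<not> r x x"
    "\<And>x y z. x \<in> carrier G \<Longrightarrow> y \<in> carrier G \<Longrightarrow> z \<in> carrier G \<Longrightarrow> r x y \<Longrightarrow> r y z \<Longrightarrow> r x z"
    "\<And>x y. x \<in> carrier G \<Longrightarrow> y \<in> carrier G \<Longrightarrow> x \<noteq> y \<Longrightarrow> r x y \<or> r y x"
    "\<And>x y g. x \<in> carrier G \<Longrightarrow> y \<in> carrier G \<Longrightarrow> g \<in> carrier G \<Longrightarrow> r x y \<Longrightarrow> r (g \<otimes>\<^bsub>G\<^esub> x) (g \<otimes>\<^bsub>G\<^esub> y)"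
    "\<And>x y g. x \<in> carrier G \<Longrightarrow> y \<in> carrier G \<Longrightarrow> g \<in> carrier G \<Longrightarrow> r x y \<Longrightarrow> r (x \<otimes>\<^bsub>G\<^esub> g) (y \<otimes>\<^bsub>G\<^esub> g)"
  using assms[unfolded biorderable_def]
proof (elim exE conjE)
  fix r assume r: "\<forall>x \<in> carrier G. \<not> r x x"
      "\<forall>x \<in> carrier G. \<forall>y \<in> carrier G. \<forall>z \<in> carrier G. r x y \<longrightarrow> r y z \<longrightarrow> r x z"
      "\<forall>x \<in> carrier G. \<forall>y \<in> carrier G. x \<noteq> y \<longrightarrow> r x y \<or> r y x"
      "\<forall>x \<in> carrier G. \<forall>y \<in> carrier G. \<forall>g \<in> carrier G. r x y \<longrightarrow>
          r (g \<otimes>\<^bsub>G\<^esub> x) (g \<otimes>\<^bsub>G\<^esub> y) \<and> r (x \<otimes>\<^bsub>G\<^esub> g) (y \<otimes>\<^bsub>G\<^esub> g)"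
  show thesis
  proof (rule that[of r])
    show "r x z" if "x \<in> carrier G" "y \<in> carrier G" "z \<in> carrier G" "r x y" "r y z" for x y z
      using r(2) that by metis
  qed (simp_all add: r(1,3,4))
qed

text \<open>If \<open>x \<otimes> y\<close> were smaller than \<open>y \<otimes> x\<close>,
  multiplication by powers of \<open>x\<close> on the left and by \<open>x\<close> on the right
  would give the same strict inequality with every positive power of \<open>x\<close> in place of
  \<open>x\<close>.\<close>

lemma biorderable_root_commutes:
  fixes G (structure) and k :: nat
  assumes G: "group G" "biorderable G" and x: "x \<in> carrier G" and y: "y \<in> carrier G" and k: "k > 0"
    and com: "x [^] k \<otimes> y = y \<otimes> x [^] k"
  shows "x \<otimes> y = y \<otimes> x"
proof (rule ccontr)
  interpret group G by (rule G(1))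
  obtain r where r: "\<And>x. x \<in> carrier G \<Longrightarrow> \<not> r x x"
    "\<And>x y z. x \<in> carrier G \<Longrightarrow> y \<in> carrier G \<Longrightarrow> z \<in> carrier G \<Longrightarrow> r x y \<Longrightarrow> r y z \<Longrightarrow> r x z"
    "\<And>x y. x \<in> carrier G \<Longrightarrow> y \<in> carrier G \<Longrightarrow> x \<noteq> y \<Longrightarrow> r x y \<or> r y x"
    "\<And>x y g. x \<in> carrier G \<Longrightarrow> y \<in> carrier G \<Longrightarrow> g \<in> carrier G \<Longrightarrow> r x y \<Longrightarrow> r (g \<otimes> x) (g \<otimes> y)"
    "\<And>x y g. x \<in> carrier G \<Longrightarrow> y \<in> carrier G \<Longrightarrow> g \<in> carrier G \<Longrightarrow> r x y \<Longrightarrow> r (x \<otimes> g) (y \<otimes> g)"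
    by (rule biorderable_order[OF G(2)]) (rule that)
  \<comment> \<open>Stated for any transitive relation compatible with the product, so that the
    reversed order covers the opposite inequality.\<close>
  have up: "s (x [^] Suc m \<otimes> y) (y \<otimes> x [^] Suc m)"
    if s: "s (x \<otimes> y) (y \<otimes> x)"
      "\<And>x y z. x \<in> carrier G \<Longrightarrow> y \<in> carrier G \<Longrightarrow> z \<in> carrier G \<Longrightarrow> s x y \<Longrightarrow> s y z \<Longrightarrow> s x z"
      "\<And>x y g. x \<in> carrier G \<Longrightarrow> y \<in> carrier G \<Longrightarrow> g \<in> carrier G \<Longrightarrow> s x y \<Longrightarrow> s (g \<otimes> x) (g \<otimes> y)"
      "\<And>x y g. x \<in> carrier G \<Longrightarrow> y \<in> carrier G \<Longrightarrow> g \<in> carrier G \<Longrightarrow> s x y \<Longrightarrow> s (x \<otimes> g) (y \<otimes> g)" for m s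
  proof (induction m)
    case 0
    then show ?case using s(1) x by simp
  next
    case (Suc m)
    let ?z = "x [^] Suc m"
    have z: "?z \<in> carrier G" using x by simp
    have "s (?z \<otimes> (x \<otimes> y)) (?z \<otimes> (y \<otimes> x))" using s(3)[OF _ _ z s(1)] x y by simp
    moreover have "s ((?z \<otimes> y) \<otimes> x) ((y \<otimes> ?z) \<otimes> x)" using s(4)[OF _ _ x Suc] x y z by simp
    ultimately have "s (?z \<otimes> (x \<otimes> y)) ((y \<otimes> ?z) \<otimes> x)"
      using s(2)[of "?z \<otimes> (x \<otimes> y)" "?z \<otimes> (y \<otimes> x)" "(y \<otimes> ?z) \<otimes> x"] x y z by (simp only: m_assoc m_closed)
    moreover have "?z \<otimes> (x \<otimes> y) = x [^] Suc (Suc m) \<otimes> y" "(y \<otimes> ?z) \<otimes> x = y \<otimes> x [^] Suc (Suc m)"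
      using x y z by (simp_all only: nat_pow_Suc[of x "Suc m"] m_assoc)
    ultimately show ?case by simp
  qed
  assume ne: "x \<otimes> y \<noteq> y \<otimes> x"
  have kS: "Suc (k - 1) = k" using k by simp
  have yx: "y \<otimes> x [^] k \<in> carrier G" using x y by simp
  have "r (x \<otimes> y) (y \<otimes> x) \<or> r (y \<otimes> x) (x \<otimes> y)" using r(3) ne x y by simp
  then show False
  proof
    assume "r (x \<otimes> y) (y \<otimes> x)"
    from up[where s = r and m = "k - 1", OF this r(2,4,5)] show False using com r(1)[OF yx] unfolding kS by simp
  next
    assume h: "r (y \<otimes> x) (x \<otimes> y)"
    have "(\<lambda>a b. r b a) (x [^] Suc (k - 1) \<otimes> y) (y \<otimes> x [^] Suc (k - 1))"
      by (rule up[where s = "\<lambda>a b. r b a"]) (fact h, (rule r(2); assumption), (rule r(4); assumption), (rule r(5); assumption))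
    then show False using com r(1)[OF yx] unfolding kS by simp
  qed
qed

text \<open>Powers of a positive element are positive, and powers of a negative one are
  negative.\<close>

lemma biorderable_torsion_free:
  fixes G (structure) and k :: nat
  assumes G: "group G" "biorderable G" and x: "x \<in> carrier G" and k: "k > 0" and one: "x [^] k = \<one>"
  shows "x = \<one>"
proof (rule ccontr)
  interpret group G by (rule G(1))
  obtain r where r: "\<And>x. x \<in> carrier G \<Longrightarrow> \<not> r x x"
    "\<And>x y z. x \<in> carrier G \<Longrightarrow> y \<in> carrier G \<Longrightarrow> z \<in> carrier G \<Longrightarrow> r x y \<Longrightarrow> r y z \<Longrightarrow> r x z"
    "\<And>x y. x \<in> carrier G \<Longrightarrow> y \<in> carrier G \<Longrightarrow> x \<noteq> y \<Longrightarrow> r x y \<or> r y x"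
    "\<And>x y g. x \<in> carrier G \<Longrightarrow> y \<in> carrier G \<Longrightarrow> g \<in> carrier G \<Longrightarrow> r x y \<Longrightarrow> r (g \<otimes> x) (g \<otimes> y)"
    "\<And>x y g. x \<in> carrier G \<Longrightarrow> y \<in> carrier G \<Longrightarrow> g \<in> carrier G \<Longrightarrow> r x y \<Longrightarrow> r (x \<otimes> g) (y \<otimes> g)"
    by (rule biorderable_order[OF G(2)]) (rule that)
  have up: "s \<one> (x [^] Suc m)"
    if s: "s \<one> x"
      "\<And>x y z. x \<in> carrier G \<Longrightarrow> y \<in> carrier G \<Longrightarrow> z \<in> carrier G \<Longrightarrow> s x y \<Longrightarrow> s y z \<Longrightarrow> s x z"
      "\<And>x y g. x \<in> carrier G \<Longrightarrow> y \<in> carrier G \<Longrightarrow> g \<in> carrier G \<Longrightarrow> s x y \<Longrightarrow> s (x \<otimes> g) (y \<otimes> g)" for m s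
  proof (induction m)
    case 0
    then show ?case using s(1) x by simp
  next
    case (Suc m)
    have "s (\<one> \<otimes> x) (x [^] Suc m \<otimes> x)" using s(3)[OF _ _ x Suc] x by simp
    then have "s x (x [^] Suc (Suc m))" using x by (simp only: l_one nat_pow_Suc)
    then show ?case using s(2)[of \<one> x "x [^] Suc (Suc m)"] s(1) x by simp
  qed
  assume "x \<noteq> \<one>"
  then have "r \<one> x \<or> r x \<one>" using r(3)[of \<one> x] x by auto
  have kS: "Suc (k - 1) = k" using k by simp
  from \<open>r \<one> x \<or> r x \<one>\<close> show False
  proof
    assume "r \<one> x"
    from up[where s = r and m = "k - 1", OF this r(2,5)] show False using one r(1)[OF one_closed] unfolding kS by simp
  next
    assume h: "r x \<one>"
    have "(\<lambda>a b. r b a) \<one> (x [^] Suc (k - 1))"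
      by (rule up[where s = "\<lambda>a b. r b a"]) (fact h, (rule r(2); assumption), (rule r(5); assumption))
    then show False using one r(1)[OF one_closed] unfolding kS by simp
  qed
qed

section \<open>Conjugation by a path\<close>

text \<open>Change of base point along \<open>\<mu>\<close>, from loops at \<open>\<mu> 1\<close> to
  loops at \<open>\<mu> 0\<close>. The rotating points have their own base configuration in a chart,
  while the braid group is based at \<open>b\<close>.\<close>

definition conj_loop :: "(real \<Rightarrow> 'a) \<Rightarrow> (real \<Rightarrow> 'a) \<Rightarrow> real \<Rightarrow> 'a" where
  "conj_loop \<mu> p = loop_join (loop_join \<mu> p) (\<lambda>t. \<mu> (1 - t))"

lemma conj_loop_ends [simp]: "conj_loop \<mu> p 0 = \<mu> 0" "conj_loop \<mu> p 1 = \<mu> 0"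
  by (simp_all add: conj_loop_def)

context
  fixes X :: "'a topology" and \<mu> :: "real \<Rightarrow> 'a"
  assumes \<mu>: "pathin X \<mu>"
begin

lemma loopin_conj_loop: "loopin X (\<mu> 1) p \<Longrightarrow> loopin X (\<mu> 0) (conj_loop \<mu> p)"
  using \<mu> by (auto simp: loopin_def conj_loop_def intro!: pathin_loop_join pathin_reverse)

lemma path_homotopic_conj_loop:
  assumes "path_homotopic X p q" "p 0 = \<mu> 1" "p 1 = \<mu> 1"
  shows "path_homotopic X (conj_loop \<mu> p) (conj_loop \<mu> q)"
  unfolding conj_loop_def
  by (intro path_homotopic_loop_join path_homotopic_refl[OF \<mu>] assms(1) path_homotopic_refl[OF pathin_reverse[OF \<mu>]])
    (use assms in auto)

text \<open>The cancellation behind both properties of the change of base point, multiplicativity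
  and injectivity.\<close>

lemma path_homotopic_cancel_left:
  assumes "loopin X (\<mu> 1) p" "pathin X q" "q 0 = \<mu> 1"
  shows "path_homotopic X (loop_join (\<lambda>t. \<mu> (1 - t)) (loop_join (loop_join \<mu> p) q)) (loop_join p q)"
proof -
  let ?\<nu> = "\<lambda>t. \<mu> (1 - t)"
  note [simp] = \<mu> pathin_reverse[OF \<mu>] assms(2) pathin_loop_join
  have p [simp]: "pathin X p" "p 0 = \<mu> 1" "p 1 = \<mu> 1" using assms(1) by (auto simp: loopin_def)
  have "path_homotopic X (loop_join ?\<nu> (loop_join \<mu> p)) (loop_join (loop_join ?\<nu> \<mu>) p)"
    by (rule path_homotopic_sym[OF path_homotopic_assoc]) (simp_all add: assms)
  also have "path_homotopic X (loop_join (loop_join ?\<nu> \<mu>) p) (loop_join (\<lambda>_. p 0) p)"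
    by (rule path_homotopic_loop_join) (use path_homotopic_reverse'[OF \<mu>] in \<open>simp_all add: path_homotopic_refl\<close>)
  also have "path_homotopic X (loop_join (\<lambda>_. p 0) p) p" by (rule path_homotopic_const_left) simp
  finally have h: "path_homotopic X (loop_join ?\<nu> (loop_join \<mu> p)) p" .
  have "path_homotopic X (loop_join ?\<nu> (loop_join (loop_join \<mu> p) q)) (loop_join (loop_join ?\<nu> (loop_join \<mu> p)) q)"
    by (rule path_homotopic_sym[OF path_homotopic_assoc]) (simp_all add: assms)
  also have "path_homotopic X (loop_join (loop_join ?\<nu> (loop_join \<mu> p)) q) (loop_join p q)"
    by (rule path_homotopic_loop_join[OF h]) (simp_all add: assms path_homotopic_refl)
  finally show ?thesis .
qed

lemma conj_loop_join:
  assumes "loopin X (\<mu> 1) p" "loopin X (\<mu> 1) q"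
  shows "path_homotopic X (loop_join (conj_loop \<mu> p) (conj_loop \<mu> q)) (conj_loop \<mu> (loop_join p q))"
proof -
  let ?\<nu> = "\<lambda>t. \<mu> (1 - t)"
  note [simp] = \<mu> pathin_reverse[OF \<mu>] pathin_loop_join path_homotopic_refl
  have p [simp]: "pathin X p" "p 0 = \<mu> 1" "p 1 = \<mu> 1" "pathin X q" "q 0 = \<mu> 1" "q 1 = \<mu> 1" using assms by (auto simp: loopin_def)
  have "path_homotopic X (loop_join (loop_join (loop_join \<mu> p) ?\<nu>) (loop_join (loop_join \<mu> q) ?\<nu>))
      (loop_join (loop_join \<mu> p) (loop_join ?\<nu> (loop_join (loop_join \<mu> q) ?\<nu>)))"
    by (rule path_homotopic_assoc) simp_all
  also have "path_homotopic X (loop_join (loop_join \<mu> p) (loop_join ?\<nu> (loop_join (loop_join \<mu> q) ?\<nu>)))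
      (loop_join (loop_join \<mu> p) (loop_join q ?\<nu>))"
    by (rule path_homotopic_loop_join) (use path_homotopic_cancel_left[OF assms(2), of ?\<nu>] in simp_all)
  also have "path_homotopic X (loop_join (loop_join \<mu> p) (loop_join q ?\<nu>)) (loop_join (loop_join (loop_join \<mu> p) q) ?\<nu>)"
    by (rule path_homotopic_sym[OF path_homotopic_assoc]) simp_all
  also have "path_homotopic X (loop_join (loop_join (loop_join \<mu> p) q) ?\<nu>) (loop_join (loop_join \<mu> (loop_join p q)) ?\<nu>)"
    by (rule path_homotopic_loop_join) (use path_homotopic_assoc[of X \<mu> p q] in simp_all)
  finally show ?thesis unfolding conj_loop_def .
qed

lemma conj_loop_inject:
  assumes p: "loopin X (\<mu> 1) p" "loopin X (\<mu> 1) q" and h: "path_homotopic X (conj_loop \<mu> p) (conj_loop \<mu> q)"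
  shows "path_homotopic X p q"
proof -
  let ?\<nu> = "\<lambda>t. \<mu> (1 - t)"
  note [simp] = \<mu> pathin_reverse[OF \<mu>] pathin_loop_join path_homotopic_refl
  have strip: "path_homotopic X (loop_join (loop_join p ?\<nu>) \<mu>) p" if "loopin X (\<mu> 1) p" for p
  proof -
    have [simp]: "pathin X p" "p 1 = \<mu> 1" "p 0 = \<mu> 1" using that by (auto simp: loopin_def)
    have "path_homotopic X (loop_join (loop_join p ?\<nu>) \<mu>) (loop_join p (loop_join ?\<nu> \<mu>))"
      by (rule path_homotopic_assoc) simp_all
    also have "path_homotopic X (loop_join p (loop_join ?\<nu> \<mu>)) (loop_join p (\<lambda>_. p 1))"
      by (rule path_homotopic_loop_join) (use path_homotopic_reverse'[OF \<mu>] in simp_all)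
    also have "path_homotopic X (loop_join p (\<lambda>_. p 1)) p" by (rule path_homotopic_const_right) simp
    finally show ?thesis .
  qed
  have [simp]: "p 0 = \<mu> 1" "p 1 = \<mu> 1" using p(1) by (auto simp: loopin_def)
  have "path_homotopic X (loop_join ?\<nu> (conj_loop \<mu> p)) (loop_join p ?\<nu>)"
    unfolding conj_loop_def by (rule path_homotopic_cancel_left[OF p(1)]) simp_all
  from path_homotopic_sym[OF this] have "path_homotopic X (loop_join p ?\<nu>) (loop_join ?\<nu> (conj_loop \<mu> p))" .
  also have "path_homotopic X (loop_join ?\<nu> (conj_loop \<mu> p)) (loop_join ?\<nu> (conj_loop \<mu> q))"
    by (rule path_homotopic_loop_join[OF _ h]) simp_all
  also have "path_homotopic X (loop_join ?\<nu> (conj_loop \<mu> q)) (loop_join q ?\<nu>)"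
    unfolding conj_loop_def by (rule path_homotopic_cancel_left[OF p(2)]) simp_all
  finally have pq: "path_homotopic X (loop_join p ?\<nu>) (loop_join q ?\<nu>)" .
  have "path_homotopic X p (loop_join (loop_join p ?\<nu>) \<mu>)" by (rule path_homotopic_sym[OF strip[OF p(1)]])
  also have "path_homotopic X (loop_join (loop_join p ?\<nu>) \<mu>) (loop_join (loop_join q ?\<nu>) \<mu>)"
    by (rule path_homotopic_loop_join[OF pq]) simp_all
  also have "path_homotopic X (loop_join (loop_join q ?\<nu>) \<mu>) q" by (rule strip[OF p(2)])
  finally show ?thesis .
qed

end

lemma loop_class_in_fundamental_group:
  assumes "loopin X x p"
  shows "loop_class X x p \<in> carrier (fundamental_group X x)"
proof -
  have "\<exists>g. loop_class X x p = loop_class X x g \<and> loopin X x g" using assms by (intro exI[of _ p] conjI refl)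
  then show ?thesis unfolding fundamental_group_def by (simp only: partial_object.select_convs mem_Collect_eq)
qed

lemma path_homotopic_left_cancel:
  assumes "loopin X x \<beta>" "loopin X x p" "loopin X x q" "path_homotopic X (loop_join \<beta> p) (loop_join \<beta> q)"
  shows "path_homotopic X p q"
proof -
  have x: "x \<in> topspace X" using assms(1) pathin_in_topspace[of X \<beta> 0] by (auto simp: loopin_def)
  interpret group "fundamental_group X x" by (rule group_fundamental_group[OF x])
  note car = loop_class_in_fundamental_group
  have "loop_class X x (loop_join \<beta> p) = loop_class X x (loop_join \<beta> q)"
    using loop_class_eq_iff[OF loopin_loop_join[OF assms(1,2)] loopin_loop_join[OF assms(1,3)]] assms(4) by (rule iffD2)
  then have "loop_class X x p = loop_class X x q"
    using Units_l_cancel[unfolded Units_eq, OF car[OF assms(1)] car[OF assms(2)] car[OF assms(3)]]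
    unfolding fundamental_group_mult[OF assms(1,2)] fundamental_group_mult[OF assms(1,3)] by (rule iffD1[rotated])
  then show ?thesis using loop_class_eq_iff[OF assms(2,3)] by simp
qed

section \<open>Braids of rotating points\<close>

lemma one_minus_parabola_pos: "0 < 1 - t * (1 - t)" for t :: real
proof -
  have "0 < (t - 1/2)\<^sup>2 + 3/4" by (rule add_nonneg_pos) simp_all
  then show ?thesis by (simp add: power2_eq_square algebra_simps)
qed

text \<open>The assumptions on \<open>d\<close>, \<open>v\<close>, \<open>N\<close>,
  \<open>r\<close>, \<open>j\<close>, \<open>l\<close> are what
  \<open>rotating_configuration\<close> provides; \<open>e\<close> places the points in the
  surface.\<close>

locale rotating_strands =
  fixes M :: "'a topology" and n :: nat and p :: "nat \<Rightarrow> nat" and e :: "complex \<Rightarrow> 'a"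
    and d :: "nat \<Rightarrow> complex" and v :: "nat \<Rightarrow> real" and N r j l :: nat
  assumes M: "surface_with_boundary M" "compact_space M" "connected_space M"
    and n: "n \<ge> 3" and p: "p permutes {..<n}" and e: "open_embedding UNIV M e"
    and inj_d: "inj d" and d_p: "\<And>i. d (p i) = cis (2 * pi * v i) * d i"
    and v_norm: "\<And>i k. v i = v k \<or> norm (d i) \<noteq> norm (d k)" and v_j: "\<And>k. v k = v j \<or> norm (d k) \<ge> 3"
    and v_N: "\<And>i. cis (2 * pi * (real N * v i)) = 1"
    and l: "l < n" "p l \<noteq> l" "l \<noteq> j" "l \<noteq> p j" "d l = 1" and j: "j < n" "norm (d j - 1) \<le> 9/5"
    and nearest: "\<And>k. k \<noteq> l \<Longrightarrow> norm (d k - 1) \<ge> norm (d j - 1)"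
    and r: "r > 0" "\<And>i. i \<in> {j, p j, l, p l} \<Longrightarrow> v i = 1 / r" and N: "N > 0"
begin

lemma d_eq_iff [simp]: "d i = d k \<longleftrightarrow> i = k"
  using inj_d by (auto simp: inj_def)

lemma p_eq_iff [simp]: "p i = p k \<longleftrightarrow> i = k"
  using permutes_inj[OF p] by (auto simp: inj_def)

lemma p_less_iff [simp]: "p i < n \<longleftrightarrow> i < n"
  using permutes_in_image[OF p, of i] by simp

lemma e_eq_iff [simp]: "e z = e w \<longleftrightarrow> z = w"
  using e by (auto simp: open_embedding_def inj_on_def)

text \<open>\<open>d (p i)\<close> and \<open>d i\<close> have equal moduli, and points of equal
  modulus rotate at the same speed.\<close>

lemma v_p [simp]: "v (p i) = v i"
  using v_norm[of "p i" i] by (simp add: d_p norm_mult)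

lemma Hausdorff: "Hausdorff_space M"
  using M(1) by (simp add: surface_with_boundary_def)

text \<open>The loop of \<open>d j\<close> around \<open>d l = 1\<close>. The radial factor is 1
  only at the ends and dips to 3/4 in between, so the loop passes strictly inside the circle around
  1 through \<open>d j\<close>, on which further points of the configuration may lie.\<close>

definition \<alpha> :: "real \<Rightarrow> complex" where
  "\<alpha> t = 1 + of_real (1 - t * (1 - t)) * cis (2 * pi * t) * (d j - 1)"

definition strand :: "nat \<Rightarrow> real \<Rightarrow> complex" where
  "strand i t = (if i = j then \<alpha> t else d i)"

text \<open>\<open>\<tau>\<close> is the rotation time and \<open>s\<close> the time along the pure
  braid \<open>y\<close>. For \<open>s = 0\<close> the set of points is the base configuration at
  every integer \<open>\<tau>\<close>, and at \<open>\<tau> = N\<close> each point has made full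
  turns.\<close>

definition spin :: "real \<Rightarrow> real \<Rightarrow> nat \<Rightarrow> 'a" where
  "spin \<tau> s = (\<lambda>i\<in>{..<n}. e (cis (2 * pi * (\<tau> * v i)) * strand i s))"

text \<open>The slice \<open>\<tau> = 1\<close> of \<open>spin\<close>, relabelled by
  \<open>p\<close> so that it starts, as a labelled configuration, where \<open>spin 0\<close>
  starts. The loop is now carried by the strand \<open>p j\<close>.\<close>

definition moved_strand :: "real \<Rightarrow> nat \<Rightarrow> 'a" where
  "moved_strand s = (\<lambda>i\<in>{..<n}. e (if i = p j then cis (2 * pi * v j) * \<alpha> s else d i))"

lemma \<alpha>_ends [simp]: "\<alpha> 0 = d j" "\<alpha> 1 = d j"
  by (simp_all add: \<alpha>_def)

lemma strand_0 [simp]: "strand i 0 = d i" "strand i 1 = d i"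
  by (simp_all add: strand_def)

lemma continuous_on_\<alpha> [continuous_intros]: "continuous_on T f \<Longrightarrow> continuous_on T (\<lambda>x. \<alpha> (f x))"
  unfolding \<alpha>_def by (intro continuous_intros)

text \<open>In the straight contraction of the loop to \<open>d j\<close>, the distance from 1 is at
  most \<open>c * norm (d j - 1)\<close>, with \<open>c < 1\<close> unless the point is
  \<open>d j\<close> itself. The points \<open>d k\<close> with \<open>k \<noteq> l\<close> are no
  closer to 1 than \<open>d j\<close>, so only \<open>d l\<close> can be hit. The bound 14/5 is 1
  plus 9/5.\<close>

lemma contracted_strand:
  assumes "\<sigma> \<in> {0..1}" "s \<in> {0..1}"
  shows "norm (of_real (1 - \<sigma>) * \<alpha> s + of_real \<sigma> * d j) \<le> 14/5"
    and "k \<noteq> j \<Longrightarrow> k \<noteq> l \<Longrightarrow> of_real (1 - \<sigma>) * \<alpha> s + of_real \<sigma> * d j \<noteq> d k"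
proof -
  define c where "c = (1 - \<sigma>) * (1 - s * (1 - s)) + \<sigma>"
  let ?z = "of_real (1 - \<sigma>) * \<alpha> s + of_real \<sigma> * d j"
  have s: "0 \<le> s * (1 - s)" "s * (1 - s) \<le> 1" using assms(2) mult_le_one[of s "1 - s"] by auto
  have "?z - 1 = (of_real (1 - \<sigma>) * (of_real (1 - s * (1 - s)) * cis (2 * pi * s)) + of_real \<sigma>) * (d j - 1)"
    by (simp add: \<alpha>_def algebra_simps)
  then have "norm (?z - 1) = norm (of_real (1 - \<sigma>) * (of_real (1 - s * (1 - s)) * cis (2 * pi * s)) + of_real \<sigma>) * norm (d j - 1)"
    by (simp only: norm_mult)
  also have "norm (of_real (1 - \<sigma>) * (of_real (1 - s * (1 - s)) * cis (2 * pi * s)) + of_real \<sigma>) \<le>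
      norm (of_real (1 - \<sigma>) * (of_real (1 - s * (1 - s)) * cis (2 * pi * s))) + norm (of_real \<sigma> :: complex)"
    by (rule norm_triangle_ineq)
  also have "\<dots> = c" using assms s by (simp add: c_def norm_mult del: of_real_diff of_real_mult)
  finally have zc: "norm (?z - 1) \<le> c * norm (d j - 1)" by (simp add: mult_right_mono)
  have c: "c = 1 - (1 - \<sigma>) * (s * (1 - s))" by (simp add: c_def algebra_simps)
  have "0 \<le> (1 - \<sigma>) * (s * (1 - s))" "0 \<le> (1 - \<sigma>) * (1 - s * (1 - s)) + \<sigma>" using assms s by auto
  then have "c \<le> 1" "0 \<le> c" using c unfolding c_def by auto
  have "norm ?z \<le> norm (?z - 1) + 1" using norm_triangle_ineq[of "?z - 1" 1] by simp
  moreover have "c * norm (d j - 1) \<le> 1 * (9/5)" using \<open>c \<le> 1\<close> \<open>0 \<le> c\<close> j(2) by (intro mult_mono) auto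
  ultimately show "norm ?z \<le> 14/5" using zc by argo
  assume k: "k \<noteq> j" "k \<noteq> l"
  show "?z \<noteq> d k"
  proof (cases "\<sigma> = 1 \<or> s = 0 \<or> s = 1")
    case True
    then have "?z = d j" by (auto simp: algebra_simps)
    then show ?thesis using k by auto
  next
    case False
    then have "0 < (1 - \<sigma>) * (s * (1 - s))" using assms by auto
    then have "c < 1" using c by simp
    moreover have "norm (d j - 1) > 0" using l(3,5) d_eq_iff[of l j] by auto
    ultimately have "c * norm (d j - 1) < norm (d j - 1)"
      using mult_strict_right_mono[of c 1 "norm (d j - 1)"] by (simp only: mult_1)
    from le_less_trans[OF zc this] show ?thesis using nearest[OF k(2)] by auto
  qed
qed

lemma norm_\<alpha>: "s \<in> {0..1} \<Longrightarrow> norm (\<alpha> s) \<le> 14/5"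
  using contracted_strand(1)[of 0 s] by simp

lemma \<alpha>_neq: "s \<in> {0..1} \<Longrightarrow> k \<noteq> j \<Longrightarrow> \<alpha> s \<noteq> d k"
proof (cases "k = l")
  case True
  assume s: "s \<in> {0..1}"
  have "s * (1 - s) < 1" using one_minus_parabola_pos[of s] by simp
  moreover have "d j \<noteq> 1" using l(3,5) d_eq_iff[of l j] by auto
  ultimately show ?thesis using True l(5) by (simp add: \<alpha>_def del: of_real_diff of_real_mult)
qed (use contracted_strand(2)[of 0 s k] in simp)

text \<open>Points with the same speed keep their mutual distances under the rotation. Points with
  different speeds have different moduli, even while \<open>j\<close> runs along its loop, because
  those with another speed than \<open>j\<close> have modulus at least 3.\<close>

lemma strand_rotation_inj:
  assumes "s \<in> {0..1}" "i \<noteq> k"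
  shows "cis (2 * pi * (\<tau> * v i)) * strand i s \<noteq> cis (2 * pi * (\<tau> * v k)) * strand k s"
proof -
  have *: "cis (2 * pi * (\<tau> * v i)) * strand i s \<noteq> cis (2 * pi * (\<tau> * v k)) * strand k s"
    if "i \<noteq> k" "k \<noteq> j" for i k
  proof (cases "v i = v k")
    case True
    then show ?thesis using that \<alpha>_neq[OF assms(1), of k] by (simp add: strand_def)
  next
    case False
    have "norm (strand i s) \<noteq> norm (strand k s)"
    proof (cases "i = j")
      case True
      then show ?thesis using False v_j[of k] norm_\<alpha>[OF assms(1)] that by (auto simp: strand_def)
    next
      case ne: False
      then show ?thesis using False v_norm[of i k] that by (simp add: strand_def)
    qed
    then show ?thesis by (metis mult_1 norm_cis norm_mult)
  qed
  show ?thesis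
  proof (cases "k = j")
    case True
    then show ?thesis using *[of k i] assms(2) by metis
  qed (use * assms(2) in metis)
qed

lemma continuous_map_spin:
  assumes "continuous_on T f" "continuous_on T g" "\<And>x. x \<in> T \<Longrightarrow> g x \<in> {0..1}"
  shows "continuous_map (top_of_set T) (ordered_config M n) (\<lambda>x. spin (f x) (g x))"
  unfolding continuous_map_ordered_config
proof (intro conjI allI impI ballI)
  fix i assume i: "i < n"
  have "continuous_on T (\<lambda>x. strand i (g x))"
    by (cases "i = j") (simp_all add: strand_def continuous_on_\<alpha> assms(2))
  then have "continuous_map (top_of_set T) M (\<lambda>x. e (cis (2 * pi * (f x * v i)) * strand i (g x)))"
    by (intro open_embedding_compose[OF e]) (auto intro!: continuous_intros assms(1))
  then show "continuous_map (top_of_set T) M (\<lambda>x. spin (f x) (g x) i)" using i by (simp add: spin_def)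
next
  fix x assume x: "x \<in> topspace (top_of_set T)"
  then have g: "g x \<in> {0..1}" using assms(3) by simp
  show "spin (f x) (g x) \<in> extensional {..<n}" by (simp add: spin_def)
  show "inj_on (spin (f x) (g x)) {..<n}"
  proof (rule inj_onI, rule ccontr)
    fix i k assume "i \<in> {..<n}" "k \<in> {..<n}" "spin (f x) (g x) i = spin (f x) (g x) k" "i \<noteq> k"
    then show False using strand_rotation_inj[OF g, of i k "f x"] by (simp add: spin_def)
  qed
qed

lemma spin_in_config: "s \<in> {0..1} \<Longrightarrow> spin \<tau> s \<in> topspace (ordered_config M n)"
  using continuous_map_image_subset_topspace[OF continuous_map_spin[of "{0}::real set" "\<lambda>_. \<tau>" "\<lambda>_. s"]] by auto

lemma spin_1 [simp]: "spin \<tau> 1 = spin \<tau> 0"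
  by (simp add: spin_def)

lemma spin_N: "spin (real N) s = spin 0 s"
  by (simp add: spin_def v_N)

lemma spin_shift: "i < n \<Longrightarrow> spin (\<tau> + 1) 0 i = spin \<tau> 0 (p i)"
  by (simp add: spin_def d_p cis_mult algebra_simps)

lemma image_p: "(\<lambda>i. f (p i)) ` {..<n} = f ` {..<n}"
  using permutes_image[OF p] by (metis image_image)

lemma spin_shift_set: "spin (\<tau> + real k) 0 ` {..<n} = spin \<tau> 0 ` {..<n}"
proof (induction k)
  case (Suc k)
  have "spin (\<tau> + real (Suc k)) 0 ` {..<n} = (\<lambda>i. spin (\<tau> + real k) 0 (p i)) ` {..<n}"
    using spin_shift[of _ "\<tau> + real k"] by (intro image_cong) (simp_all add: add_ac)
  also have "\<dots> = spin (\<tau> + real k) 0 ` {..<n}" by (rule image_p)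
  finally show ?case using Suc by (rule trans)
qed simp

lemma spin_1_set: "spin 1 s ` {..<n} = moved_strand s ` {..<n}"
proof -
  have "spin 1 s ` {..<n} = (\<lambda>i. moved_strand s (p i)) ` {..<n}"
    by (intro image_cong) (auto simp: spin_def moved_strand_def strand_def d_p)
  then show ?thesis using image_p by simp
qed

definition rot :: "nat \<Rightarrow> real \<Rightarrow> 'a set" where
  "rot k t = spin (real k * t) 0 ` {..<n}"

text \<open>Both sides reparametrize the path of \<open>\<tau>\<close> from 0 to
  \<open>k + 1\<close>, since the unlabelled family at \<open>s = 0\<close> has period 1 in
  \<open>\<tau>\<close>.\<close>

lemma rot_join: "path_homotopic (unordered_config M n) (loop_join (rot k) (rot 1)) (rot (Suc k))"
proof (rule path_homotopic_convex[where C = "UNIV :: real set" and G = "\<lambda>\<tau>. spin \<tau> 0 ` {..<n}"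
      and u = "\<lambda>t. real k * min (2 * t) 1 + max 0 (2 * t - 1)" and v = "\<lambda>t. real (Suc k) * t"])
  show "continuous_map (top_of_set UNIV) (unordered_config M n) (\<lambda>\<tau>. spin \<tau> 0 ` {..<n})"
    using continuous_map_compose[OF continuous_map_spin[of UNIV "\<lambda>x. x" "\<lambda>_. 0"] continuous_map_config_set]
    by (simp add: o_def)
  show "loop_join (rot k) (rot 1) t = spin (real k * min (2 * t) 1 + max 0 (2 * t - 1)) 0 ` {..<n}" for t
  proof (cases "t \<le> 1/2")
    case True
    then show ?thesis by (simp add: loop_join_def rot_def)
  next
    case False
    then show ?thesis using spin_shift_set[of "2 * t - 1" k] by (simp add: loop_join_def rot_def add.commute)
  qed
  show "rot (Suc k) t = spin (real (Suc k) * t) 0 ` {..<n}" for t by (simp add: rot_def)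
qed (auto intro!: continuous_intros)

text \<open>The boundary relation of the square with sides \<open>s\<close> and
  \<open>\<tau>\<close>. For \<open>k = N\<close> the slice on the right is \<open>y\<close> again,
  so the rotation commutes with \<open>y\<close>; for \<open>k = 1\<close> it is the conjugate of
  \<open>y\<close>.\<close>

lemma spin_square:
  "path_homotopic (unordered_config M n) (loop_join (\<lambda>t. spin 0 t ` {..<n}) (rot k)) (loop_join (rot k) (\<lambda>t. spin (real k) t ` {..<n}))"
proof -
  let ?S = "\<lambda>x::real \<times> real. spin (real k * snd x) (fst x) ` {..<n}"
  have "continuous_map (top_of_set unit_square) (ordered_config M n) (\<lambda>x. spin (real k * snd x) (fst x))"
    by (intro continuous_map_spin continuous_intros) auto
  then have "continuous_map (top_of_set unit_square) (unordered_config M n) ?S"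
    using continuous_map_compose[OF _ continuous_map_config_set] by (fastforce simp: o_def)
  from path_homotopic_square[OF this] show ?thesis by (simp add: rot_def[abs_def])
qed

lemma pathin_spin: "pathin (ordered_config M n) (spin \<tau>)" "pathin (ordered_config M n) (\<lambda>t. spin (c * t) 0)"
  unfolding pathin_def by (rule continuous_map_spin; auto intro!: continuous_intros)+

lemma loopin_rot: "loopin (unordered_config M n) (spin 0 0 ` {..<n}) (rot k)"
  using pathin_compose[OF pathin_spin(2)[of "real k"] continuous_map_config_set] spin_shift_set[of 0 k]
  by (simp add: loopin_def rot_def[abs_def] o_def)

lemma loopin_spin: "loopin (unordered_config M n) (spin 0 0 ` {..<n}) (\<lambda>t. spin (real k) t ` {..<n})"
  using pathin_compose[OF pathin_spin(1)[of "real k"] continuous_map_config_set] spin_shift_set[of 0 k]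
  by (simp add: loopin_def o_def)

lemma pathin_moved_strand: "pathin (ordered_config M n) moved_strand"
proof -
  have "bij_betw (inv_into UNIV p) {..<n} {..<n}" using permutes_inv[OF p] by (rule permutes_imp_bij)
  then have "continuous_map (top_of_set {0..1}) (ordered_config M n) (\<lambda>s. \<lambda>i\<in>{..<n}. spin 1 s (inv_into UNIV p i))"
    using continuous_map_compose[OF _ relabel_config(1)] pathin_spin(1)[of 1, unfolded pathin_def] by (fastforce simp: o_def)
  moreover have "(\<lambda>i\<in>{..<n}. spin 1 s (inv_into UNIV p i)) = moved_strand s" for s
  proof
    fix i
    show "(\<lambda>i\<in>{..<n}. spin 1 s (inv_into UNIV p i)) i = moved_strand s i"
    proof (cases "i < n")
      case True
      obtain k where k: "i = p k" using permutes_surj[OF p] by blast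
      then show ?thesis using True permutes_inverses(2)[OF p, of k]
        by (auto simp: spin_def moved_strand_def strand_def d_p)
    qed (simp add: moved_strand_def)
  qed
  ultimately show ?thesis by (simp add: pathin_def)
qed

text \<open>From the boundary inwards: \<open>spin 0\<close> on the circle, the given homotopy on
  the outer annulus until \<open>moved_strand\<close> is reached, and the contraction of the strand
  \<open>p j\<close> on the inner disc. In the contraction only \<open>p j\<close> and
  \<open>p l\<close> can collide, whence the restriction on \<open>k\<close>.\<close>

lemma strand_discs:
  assumes K: "path_homotopic (ordered_config M n) (spin 0) moved_strand"
  obtains X where "\<And>i. i < n \<Longrightarrow> continuous_map (top_of_set (cball (0::complex) 1)) M (X i)"
    "\<And>i z. i < n \<Longrightarrow> norm z \<le> 1 \<Longrightarrow> X i z \<in> manifold_interior M"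
    "\<And>i t. i < n \<Longrightarrow> t \<in> {0..1} \<Longrightarrow> X i (cis (2 * pi * t)) = e (strand i t)"
    "\<And>i k z. i < n \<Longrightarrow> k < n \<Longrightarrow> i \<noteq> k \<Longrightarrow> k \<notin> {p j, p l} \<Longrightarrow> norm z \<le> 1 \<Longrightarrow> X i z \<noteq> X k z"
proof -
  obtain S where S: "continuous_map (top_of_set unit_square) (ordered_config M n) S"
    "\<And>t. t \<in> {0..1} \<Longrightarrow> S (0, t) = spin 0 t \<and> S (1, t) = moved_strand t"
    "\<And>s. s \<in> {0..1} \<Longrightarrow> S (s, 0) = spin 0 0 \<and> S (s, 1) = spin 0 1"
    by (rule path_homotopicE[OF K]) (rule that)
  have Si: "continuous_map (top_of_set unit_square) M (\<lambda>x. S x i)" if "i < n" for i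
    using S(1) that unfolding continuous_map_ordered_config by blast
  have Sinj: "S x i \<noteq> S x k" if "x \<in> unit_square" "i < n" "k < n" "i \<noteq> k" for x i k
  proof -
    have "inj_on (S x) {..<n}" using S(1) that(1) unfolding continuous_map_ordered_config by auto
    then show ?thesis using that(2-4) by (auto simp: inj_on_def)
  qed
  define c where "c i x = (if i = p j then of_real (1 - fst x) * (cis (2 * pi * v j) * \<alpha> (snd x)) + of_real (fst x) * d i else d i)"
    for i and x :: "real \<times> real"
  define f where "f i x = (if 1 - fst x \<le> 1/2 then S (2 - 2 * fst x, snd x) i else e (c i (1 - 2 * fst x, snd x)))"
    for i and x :: "real \<times> real"
  have cc: "continuous_on T (\<lambda>x. c i (g x, h x))" if "continuous_on T g" "continuous_on T h" for T :: "(real \<times> real) set" and g h i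
    unfolding c_def using that by (cases "i = p j") (auto intro!: continuous_intros)
  have fcont: "continuous_map (top_of_set unit_square) M (f i)" if i: "i < n" for i
    unfolding f_def
  proof (rule continuous_map_top_of_set_cases_le)
    show "continuous_map (top_of_set {x \<in> unit_square. 1 - fst x \<le> 1/2}) M (\<lambda>x. S (2 - 2 * fst x, snd x) i)"
      by (rule continuous_map_compose_on[OF Si[OF i]]) (auto intro!: continuous_intros)
    show "continuous_map (top_of_set {x \<in> unit_square. 1/2 \<le> 1 - fst x}) M (\<lambda>x. e (c i (1 - 2 * fst x, snd x)))"
      by (rule open_embedding_compose[OF e]) (auto intro!: cc continuous_intros)
    show "S (2 - 2 * fst x, snd x) i = e (c i (1 - 2 * fst x, snd x))" if x: "x \<in> unit_square" "1 - fst x = 1/2" for x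
    proof -
      have ee: "2 - 2 * fst x = 1" "1 - 2 * fst x = 0" using x(2) by argo+
      have "S (1, snd x) = moved_strand (snd x)" using S(2) x(1) by (auto simp: mem_Times_iff)
      then show ?thesis unfolding ee using i by (simp add: moved_strand_def c_def)
    qed
  qed (auto intro!: continuous_intros)
  have c1: "c i (1, t) = d i" "c i (\<sigma>, 0) = c i (\<sigma>, 1)" for i \<sigma> t by (simp_all add: c_def)
  \<comment> \<open>The rotation of \<open>j\<close> is undone first. A point with the same speed is
    handled by \<open>contracted_strand\<close>; one with another speed has modulus at least 3,
    against at most 14/5.\<close>
  have cne: "c i (\<sigma>, t) \<noteq> d k" if h: "k \<notin> {p j, p l}" "i \<noteq> k" "\<sigma> \<in> {0..1}" "t \<in> {0..1}" for i k \<sigma> t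
  proof (cases "i = p j")
    case True
    obtain k' where k': "k = p k'" using permutes_surj[OF p] by blast
    let ?z = "of_real (1 - \<sigma>) * \<alpha> t + of_real \<sigma> * d j"
    have z: "c i (\<sigma>, t) = cis (2 * pi * v j) * ?z" using True by (simp add: c_def d_p algebra_simps)
    show ?thesis
    proof (cases "v k' = v j")
      case eq: True
      have "?z \<noteq> d k'" by (rule contracted_strand(2)) (use h k' in auto)
      then show ?thesis using eq unfolding z k' d_p by simp
    next
      case False
      then have "norm (d k) \<ge> 3" using v_j[of k'] by (simp add: k' d_p norm_mult)
      moreover have "norm (c i (\<sigma>, t)) \<le> 14/5" unfolding z norm_mult using contracted_strand(1)[OF h(3,4)] by simp
      ultimately show ?thesis by auto
    qed
  qed (use h in \<open>simp add: c_def\<close>)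
  have fne: "f i x \<noteq> f k x" if h: "i < n" "k < n" "i \<noteq> k" "k \<notin> {p j, p l}" "x \<in> unit_square" for i k x
  proof (cases "1 - fst x \<le> 1/2")
    case True
    have "(2 - 2 * fst x, snd x) \<in> unit_square" using True h(5) by (auto simp: mem_Times_iff)
    then show ?thesis using True Sinj[OF _ h(1-3)] by (simp add: f_def)
  next
    case False
    have "c i (1 - 2 * fst x, snd x) \<noteq> d k" by (rule cne[OF h(4,3)]) (use False h(5) in \<open>auto simp: mem_Times_iff\<close>)
    moreover have "c k (1 - 2 * fst x, snd x) = d k" using h(4) by (simp add: c_def)
    ultimately show ?thesis using False by (simp add: f_def)
  qed
  have "\<exists>g. continuous_map (top_of_set (cball (0::complex) 1)) M g \<and>
      (\<forall>\<kappa>\<in>{0..1}. \<forall>t\<in>{0..1}. g (of_real \<kappa> * cis (2 * pi * t)) = f i (\<kappa>, t))" if i: "i < n" for i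
  proof -
    have "f i (\<kappa>, 0) = f i (\<kappa>, 1)" if "\<kappa> \<in> {0..1}" for \<kappa>
    proof (cases "1 - \<kappa> \<le> 1/2")
      case True
      then have "2 - 2 * \<kappa> \<in> {0..1}" using that by auto
      then show ?thesis using True S(3)[of "2 - 2 * \<kappa>"] by (simp add: f_def)
    qed (use c1(2) in \<open>simp add: f_def\<close>)
    moreover have "f i (0, t) = f i (0, 0)" for t by (simp add: f_def c1(1))
    ultimately obtain g where "continuous_map (top_of_set (cball (0::complex) 1)) M g"
      "\<And>\<kappa> t. \<kappa> \<in> {0..1} \<Longrightarrow> t \<in> {0..1} \<Longrightarrow> g (of_real \<kappa> * cis (2 * pi * t)) = f i (\<kappa>, t)"
      using polar_descend[OF fcont[OF i]] by metis
    then show ?thesis by (intro exI[of _ g]) simp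
  qed
  then have "\<exists>g. \<forall>i<n. continuous_map (top_of_set (cball (0::complex) 1)) M (g i) \<and>
      (\<forall>\<kappa>\<in>{0..1}. \<forall>t\<in>{0..1}. g i (of_real \<kappa> * cis (2 * pi * t)) = f i (\<kappa>, t))"
    by (intro choice) simp
  then obtain g where g0: "\<forall>i<n. continuous_map (top_of_set (cball (0::complex) 1)) M (g i) \<and>
      (\<forall>\<kappa>\<in>{0..1}. \<forall>t\<in>{0..1}. g i (of_real \<kappa> * cis (2 * pi * t)) = f i (\<kappa>, t))" ..
  have g: "\<And>i. i < n \<Longrightarrow> continuous_map (top_of_set (cball (0::complex) 1)) M (g i)"
    "\<And>i \<kappa> t. i < n \<Longrightarrow> \<kappa> \<in> {0..1} \<Longrightarrow> t \<in> {0..1} \<Longrightarrow> g i (of_real \<kappa> * cis (2 * pi * t)) = f i (\<kappa>, t)"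
    using g0 by blast+
  have polar: "\<exists>x\<in>unit_square. z = of_real (fst x) * cis (2 * pi * snd x)" if "norm z \<le> 1" for z :: complex
  proof (cases "z = 0")
    case True
    then show ?thesis by (intro bexI[of _ "(0, 0)"]) auto
  next
    case False
    obtain t where t: "t \<in> {0..1}" "z / of_real (norm z) = cis (2 * pi * t)"
      using unit_circle_param[of "z / of_real (norm z)"] False by (auto simp: norm_divide)
    then show ?thesis using False that by (intro bexI[of _ "(norm z, t)"]) (auto simp: field_simps)
  qed
  have g_ne: "g i z \<noteq> g k z" if h: "i < n" "k < n" "i \<noteq> k" "k \<notin> {p j, p l}" "norm z \<le> 1" for i k z
  proof -
    obtain x where x: "x \<in> unit_square" "z = of_real (fst x) * cis (2 * pi * snd x)" using polar[OF h(5)] by blast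
    have "g i z = f i x" "g k z = f k x" using g(2)[of _ "fst x" "snd x"] h(1,2) x by (auto simp: mem_Times_iff)
    then show ?thesis using fne[OF h(1-4) x(1)] by simp
  qed
  have g_circle: "g i (cis (2 * pi * t)) = e (strand i t)" if "i < n" "t \<in> {0..1}" for i t
    using g(2)[of i 1 t] that S(2)[OF that(2)] by (simp add: f_def spin_def)
  \<comment> \<open>The discs must keep their boundary values when they are pushed into the
    interior, so the push has to fix a chart disc that contains every strand of
    \<open>spin 0\<close>.\<close>
  define R where "R = 3 + (\<Sum>i<n. norm (d i))"
  have R: "norm (strand i t) \<le> R" if "i < n" "t \<in> {0..1}" for i t
  proof -
    have "norm (d i) \<le> (\<Sum>i<n. norm (d i))" using that(1) by (intro member_le_sum) auto
    moreover have "0 \<le> (\<Sum>i<n. norm (d i))" by (intro sum_nonneg) simp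
    ultimately show ?thesis using norm_\<alpha>[OF that(2)] by (simp add: strand_def R_def)
  qed
  have "closedin M (e ` cball 0 R)" by (rule open_embedding_compact_image(2)[OF e Hausdorff]) auto
  moreover have "e ` cball 0 R \<subseteq> manifold_interior M" using e by (auto simp: manifold_interior_def)
  ultimately obtain h where h: "continuous_map M M h" "inj_on h (topspace M)"
    "\<And>x. x \<in> topspace M \<Longrightarrow> h x \<in> manifold_interior M" "\<And>x. x \<in> e ` cball 0 R \<Longrightarrow> h x = x"
    using push_into_interior[OF M(1,2)] by metis
  have top: "g i z \<in> topspace M" if "i < n" "norm z \<le> 1" for i z
    using g(1)[OF that(1)] that(2) by (auto simp: continuous_map_def Pi_iff)
  show thesis
  proof (rule that[of "\<lambda>i z. h (g i z)"])
    show "continuous_map (top_of_set (cball 0 1)) M (\<lambda>z. h (g i z))" if "i < n" for i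
      using continuous_map_compose[OF g(1)[OF that] h(1)] by (simp add: o_def)
    show "h (g i (cis (2 * pi * t))) = e (strand i t)" if "i < n" "t \<in> {0..1}" for i t
      using h(4)[of "e (strand i t)"] R[OF that] by (simp add: g_circle[OF that])
    show "h (g i z) \<noteq> h (g k z)" if "i < n" "k < n" "i \<noteq> k" "k \<notin> {p j, p l}" "norm z \<le> 1" for i k z
      using g_ne[OF that] inj_on_eq_iff[OF h(2) top[OF that(1,5)] top[OF that(2,5)]] by simp
  qed (use h(3) top in simp)
qed

text \<open>A strand \<open>q\<close> outside \<open>{j, p j, l, p l}\<close> makes the hypothesis
  contradictory, by winding numbers. Without one, all points rotate rigidly at speed
  \<open>1 / r\<close>, and the null-homotopy yields the cap that contracts the double
  rotation.\<close>

lemma double_rotation: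
  assumes K: "path_homotopic (ordered_config M n) (spin 0) moved_strand"
  shows "path_homotopic (ordered_config M n) (\<lambda>t. spin (real (2 * r) * t) 0) (\<lambda>_. spin 0 0)"
proof -
  obtain X where X: "\<And>i. i < n \<Longrightarrow> continuous_map (top_of_set (cball (0::complex) 1)) M (X i)"
    "\<And>i z. i < n \<Longrightarrow> norm z \<le> 1 \<Longrightarrow> X i z \<in> manifold_interior M"
    "\<And>i t. i < n \<Longrightarrow> t \<in> {0..1} \<Longrightarrow> X i (cis (2 * pi * t)) = e (strand i t)"
    "\<And>i k z. i < n \<Longrightarrow> k < n \<Longrightarrow> i \<noteq> k \<Longrightarrow> k \<notin> {p j, p l} \<Longrightarrow> norm z \<le> 1 \<Longrightarrow> X i z \<noteq> X k z"
    by (rule strand_discs[OF K]) (rule that)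
  have Xc: "X i z = e (d i)" if h: "i < n" "i \<noteq> j" "norm z = 1" for i z
  proof -
    obtain t where "t \<in> {0..1}" "z = cis (2 * pi * t)" by (rule unit_circle_param[OF h(3)])
    then show ?thesis using X(3)[of i t] h(1,2) by (simp add: strand_def)
  qed
  \<comment> \<open>The comparison strand must be at rest on the boundary and avoid the strands
    \<open>l\<close> and \<open>q\<close>. One of \<open>p j\<close> and \<open>p l\<close> is
    always suitable; a collision between these two does no harm.\<close>
  define m where "m = (if p l = j then p j else p l)"
  have m: "m < n" "m \<noteq> j" "m \<noteq> l" using l j p_eq_iff[of l j] by (auto simp: m_def)
  have lp: "l \<notin> {p j, p l}" using l by auto
  have dj: "d j \<noteq> 1" using l(3,5) d_eq_iff[of l j] by auto
  show ?thesis
  proof (cases "\<exists>q<n. q \<notin> {j, p j, l, p l}")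
    case True
    then obtain q where q: "q < n" "q \<notin> {p j, p l}" "q \<noteq> j" "q \<noteq> l" by blast
    then have mq: "m \<noteq> q" by (auto simp: m_def)
    obtain h k where I: "isotopy (top_of_set (cball (0::complex) 1)) M h k" "\<And>z. norm z \<le> 1 \<Longrightarrow> h z (X l 1) = X l z"
      "\<And>z. norm z \<le> 1 \<Longrightarrow> h z (X q 1) = X q z"
      by (rule trivialization_disc2[OF Hausdorff X(1)[OF l(1)] X(1)[OF q(1)] X(2)[OF l(1)] X(2)[OF q(1)]
          X(4)[OF l(1) q(1) q(4)[symmetric] q(2)]]) (auto intro: that)
    have h: "h z (e 1) = X l z" "h z (e (d q)) = X q z" if "norm z \<le> 1" for z
      using I(2,3)[OF that] Xc[OF l(1,3), of 1] Xc[OF q(1,3), of 1] l(5) by simp_all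
    obtain Y where Y: "continuous_map (top_of_set (cball (0::complex) 1)) (subtopology M (topspace M - e ` {1, d q})) Y"
      "\<And>z. norm z = 1 \<Longrightarrow> Y z = X j z"
    proof (rule section_null_homotopic[OF I(1), of "e ` {1, d q}" "X j" "X m" "e (d m)"])
      show "e ` {1, d q} \<subseteq> topspace M" using open_embedding_topspace[OF e] by auto
      show "h z x = x" if "norm z = 1" "x \<in> e ` {1, d q}" for z x
        using that h[of z] Xc[OF l(1,3) that(1)] Xc[OF q(1,3) that(1)] l(5) by auto
      show "path_connected_space (subtopology M (topspace M - e ` {1, d q}))"
        by (rule surface_minus_finite_path_connected[OF M(1,3)]) simp
      show "X j z \<noteq> h z x" if "norm z \<le> 1" "x \<in> e ` {1, d q}" for z x
        using that h[OF that(1)] X(4)[OF j(1) l(1) l(3)[symmetric] lp that(1)]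
          X(4)[OF j(1) q(1) q(3)[symmetric] q(2) that(1)] by auto
      show "X m z \<noteq> h z x" if "norm z \<le> 1" "x \<in> e ` {1, d q}" for z x
        using that h[OF that(1)] X(4)[OF m(1) l(1) m(3) lp that(1)] X(4)[OF m(1) q(1) mq q(2) that(1)] by auto
      show "X m z = e (d m)" if "norm z = 1" for z by (rule Xc[OF m(1,2) that])
    qed (use X(1) j(1) m(1) that in auto)
    define w where "w = d q - 1"
    have w: "norm w \<ge> norm (d j - 1)" "w \<noteq> 0" using nearest[OF q(4)] dj by (auto simp: w_def)
    \<comment> \<open>\<open>L1\<close> follows the definition of \<open>\<alpha>\<close> and gains
      \<open>2 * pi * \<i>\<close>. For \<open>L2\<close>, \<open>\<alpha> t - d q\<close> is
      factored as \<open>(1 - (\<alpha> t - 1) / w) * (- w)\<close>; the first factor stays in the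
      right half-plane because \<open>d q\<close> is no closer to 1 than \<open>d j\<close> and the
      loop misses it.\<close>
    define L1 where "L1 t = of_real (ln (1 - t * (1 - t))) + of_real (2 * pi * t) * \<i> + Ln (d j - 1)" for t
    define L2 where "L2 t = Ln (1 - (\<alpha> t - 1) / w) + Ln (- w)" for t
    note pos = one_minus_parabola_pos
    have Re: "Re (1 - (\<alpha> t - 1) / w) > 0" if t: "t \<in> {0..1}" for t
    proof -
      let ?x = "(\<alpha> t - 1) / w"
      have "norm (\<alpha> t - 1) = (1 - t * (1 - t)) * norm (d j - 1)"
        using pos[of t] by (simp add: \<alpha>_def norm_mult del: of_real_diff of_real_mult)
      also have "\<dots> \<le> 1 * norm w" by (rule mult_mono) (use t w pos[of t] in \<open>auto intro: mult_nonneg_nonneg\<close>)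
      finally have "norm ?x \<le> 1" using w(2) by (simp add: norm_divide)
      moreover have "?x \<noteq> 1" using \<alpha>_neq[OF t q(3)] w(2) by (auto simp: w_def)
      ultimately have "Re ?x < 1" using complex_Re_le_cmod[of ?x] cmod_power2[of ?x] power_le_one[of "norm ?x" 2]
        by (cases "Re ?x = 1") (auto simp: complex_eq_iff power2_eq_square)
      then show ?thesis by simp
    qed
    have False
    proof (rule no_null_homotopy_around_point[OF Hausdorff e Y(1), of \<alpha> "3 + norm (d q)" L1 L2])
      show "Y (cis (2 * pi * t)) = e (\<alpha> t)" if "t \<in> {0..1}" for t
        using Y(2)[of "cis (2 * pi * t)"] X(3)[OF j(1) that] by (simp add: strand_def)
      show "norm (\<alpha> t) \<le> 3 + norm (d q)" if "t \<in> {0..1}" for t using norm_\<alpha>[OF that] norm_ge_zero[of "d q"] by argo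
      show "continuous_on {0..1} L1" unfolding L1_def using pos by (intro continuous_intros) (metis less_irrefl)
      show "exp (L1 t) = \<alpha> t - 1" for t
      proof -
        have "exp (L1 t) = exp (of_real (ln (1 - t * (1 - t)))) * cis (2 * pi * t) * (d j - 1)"
          using dj by (simp add: L1_def exp_add cis_conv_exp mult.commute)
        also have "exp (of_real (ln (1 - t * (1 - t)))) = (of_real (1 - t * (1 - t)) :: complex)"
          using pos[of t] by (simp only: exp_of_real exp_ln)
        finally show ?thesis by (simp add: \<alpha>_def)
      qed
      show "L1 1 = L1 0 + 2 * pi * \<i>" by (simp add: L1_def)
      have nonpos: "1 - (\<alpha> t - 1) / w \<notin> \<real>\<^sub>\<le>\<^sub>0" if "t \<in> {0..1}" for t
        using Re[OF that] unfolding complex_nonpos_Reals_iff by argo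
      show "continuous_on {0..1} L2" unfolding L2_def by (intro continuous_intros) (use nonpos w(2) in blast)+
      show "exp (L2 t) = \<alpha> t - d q" if "t \<in> {0..1}" for t
      proof -
        have "1 - (\<alpha> t - 1) / w \<noteq> 0" using Re[OF that] by auto
        then have "exp (L2 t) = (1 - (\<alpha> t - 1) / w) * (- w)" using w(2) by (simp add: L2_def exp_add)
        also have "\<dots> = \<alpha> t - d q" using w(2) by (simp add: w_def field_simps)
        finally show ?thesis .
      qed
      show "L2 1 = L2 0" by (simp add: L2_def)
    qed simp_all
    then show ?thesis ..
  next
    case False
    obtain h k where I: "isotopy (top_of_set (cball (0::complex) 1)) M h k" "\<And>z. norm z \<le> 1 \<Longrightarrow> h z (X l 1) = X l z"
      by (rule trivialization_disc[OF Hausdorff closedin_empty X(1)[OF l(1)] X(2)[OF l(1)]]) (auto intro: that)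
    have h: "h z (e 1) = X l z" if "norm z \<le> 1" for z
      using I(2)[OF that] Xc[OF l(1,3), of 1] l(5) by simp
    obtain Y where Y: "continuous_map (top_of_set (cball (0::complex) 1)) (subtopology M (topspace M - {e 1})) Y"
      "\<And>z. norm z = 1 \<Longrightarrow> Y z = X j z"
    proof (rule section_null_homotopic[OF I(1), of "{e 1}" "X j" "X m" "e (d m)"])
      show "{e 1} \<subseteq> topspace M" using open_embedding_topspace[OF e] by auto
      show "h z x = x" if "norm z = 1" "x \<in> {e 1}" for z x
        using that h[of z] Xc[OF l(1,3) that(1)] l(5) by auto
      show "path_connected_space (subtopology M (topspace M - {e 1}))"
        by (rule surface_minus_finite_path_connected[OF M(1,3)]) simp
      show "X j z \<noteq> h z x" if "norm z \<le> 1" "x \<in> {e 1}" for z x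
        using that h[OF that(1)] X(4)[OF j(1) l(1) l(3)[symmetric] lp that(1)] by auto
      show "X m z \<noteq> h z x" if "norm z \<le> 1" "x \<in> {e 1}" for z x
        using that h[OF that(1)] X(4)[OF m(1) l(1) m(3) lp that(1)] by auto
      show "X m z = e (d m)" if "norm z = 1" for z by (rule Xc[OF m(1,2) that])
    qed (use X(1) j(1) m(1) that in auto)
    define B where "B = (\<Sum>i<n. norm (d i))"
    have B: "norm (d i) \<le> B" if "i < n" for i unfolding B_def using that by (intro member_le_sum) auto
    have B0: "B \<ge> 0" unfolding B_def by (intro sum_nonneg) simp
    define \<delta> where "\<delta> = Min ((\<lambda>(i, k). norm (d i - d k)) ` {(i, k). i < n \<and> k < n \<and> i \<noteq> k})"
    have fin: "finite ((\<lambda>(i, k). norm (d i - d k)) ` {(i, k). i < n \<and> k < n \<and> i \<noteq> k})"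
      by (rule finite_imageI, rule finite_subset[of _ "{..<n} \<times> {..<n}"]) auto
    have \<delta>: "\<delta> > 0" unfolding \<delta>_def
      using fin l(1,3) j(1) by (subst Min_gr_iff) auto
    have \<delta>_le: "\<delta> \<le> norm (d i - d k)" if "i < n" "k < n" "i \<noteq> k" for i k
      unfolding \<delta>_def by (rule Min_le[OF fin]) (use that in force)
    \<comment> \<open>The summand \<open>B + 3\<close> makes the circle of radius \<open>L\<close>
      around 1 enclose the configuration and the loop; the fraction ensures
      \<open>\<delta> * L > 4 * (1 + B)^2\<close>, the separation condition for centre
      \<open>u = 1\<close>.\<close>
    define L where "L = B + 3 + (2 * (1 + B)\<^sup>2 * 2 + 1) / \<delta>"
    have "(2 * (1 + B)\<^sup>2 * 2 + 1) / \<delta> \<ge> 0" using \<delta> by simp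
    then have L: "L \<ge> B + 3" by (simp add: L_def)
    have "\<delta> * L = \<delta> * (B + 3) + (2 * (1 + B)\<^sup>2 * 2 + 1)" using \<delta> by (simp add: L_def field_simps)
    moreover have "\<delta> * (B + 3) \<ge> 0" using \<delta> B0 by simp
    ultimately have L2: "2 * (1 + B)\<^sup>2 * 2 < \<delta> * L" by argo
    obtain G where G: "continuous_map (top_of_set (cball (0::complex) 1)) M G" "\<And>z. norm z \<le> 1 \<Longrightarrow> G z \<notin> e ` ball 1 L"
      "\<And>z. norm z = 1 \<Longrightarrow> G z = e (1 + of_real L * z)"
    proof (rule push_null_homotopy_outside[OF Hausdorff e Y(1), of "\<lambda>t. 1 - t * (1 - t)" "d j - 1" L])
      show "Y (cis (2 * pi * t)) = e (1 + of_real (1 - t * (1 - t)) * cis (2 * pi * t) * (d j - 1))" if "t \<in> {0..1}" for t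
        using Y(2)[of "cis (2 * pi * t)"] X(3)[OF j(1) that] by (simp add: strand_def \<alpha>_def)
      show *: "0 < 1 - t * (1 - t)" for t :: real by (rule one_minus_parabola_pos)
      show "(1 - t * (1 - t)) * norm (d j - 1) \<le> L" if "t \<in> {0..1}" for t
      proof -
        have "(1 - t * (1 - t)) * norm (d j - 1) \<le> 1 * (9/5)"
          by (rule mult_mono) (use that j(2) *[of t] in \<open>auto intro: mult_nonneg_nonneg\<close>)
        then show ?thesis using L B0 by argo
      qed
    qed (use dj L B0 that in auto)
    have v: "v i = 1 / r" if "i < n" for i using False that r(2) by blast
    have "path_homotopic (ordered_config M n) (\<lambda>t. \<lambda>i\<in>{..<n}. e (cis (4 * pi * t) * d i)) (\<lambda>_. \<lambda>i\<in>{..<n}. e (d i))"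
      by (rule double_rotation_null_homotopic[OF e G B \<delta>_le \<delta> _ _ _ B0]) (use L L2 B0 in auto)
    \<comment> \<open>At speed \<open>1 / r\<close>, rotation time \<open>2 * r\<close> amounts to
      two full turns.\<close>
    moreover have "(\<lambda>i\<in>{..<n}. e (cis (4 * pi * t) * d i)) = spin (real (2 * r) * t) 0" for t
      unfolding spin_def by (rule restrict_ext) (use r(1) in \<open>simp add: v algebra_simps\<close>)
    moreover have "(\<lambda>i\<in>{..<n}. e (d i)) = spin 0 0" by (simp add: spin_def)
    ultimately show ?thesis by simp
  qed
qed

end

section \<open>Embedding the rotating strands into the braid group\<close>

text \<open>A chart off the base points makes the rotating configuration disjoint from
  \<open>b\<close>, as \<open>config_path\<close> requires. If the chart found at a point outside
  \<open>S\<close> is a half-plane chart, the point \<open>g \<i>\<close> is interior and serves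
  instead.\<close>

lemma chart_avoiding_finite:
  assumes M: "surface_with_boundary M" and "x \<in> topspace M" and S: "finite S"
  obtains e where "open_embedding UNIV M e" "range e \<inter> S = {}"
proof -
  have "closedin M (topspace M \<inter> S)"
    using M S closedin_Hausdorff_finite[of M "topspace M \<inter> S"] by (simp add: surface_with_boundary_def)
  moreover have "topspace M - S = topspace M - topspace M \<inter> S" by blast
  ultimately have N: "openin M (topspace M - S)" by (metis openin_diff openin_topspace)
  obtain W where "openin M W" "W - S \<noteq> {}"
    by (rule surface_nice_neighbourhood[OF M openin_topspace assms(2) S])
  then obtain y where y: "y \<in> topspace M - S" using openin_subset by blast
  from surface_chart[OF M N y] show thesis
  proof (elim disjE exE conjE)
    fix e assume "open_embedding UNIV M e" "range e \<subseteq> topspace M - S"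
    then show thesis by (intro that[of e]) blast+
  next
    fix g assume g: "open_embedding upper_half_plane M g" "g ` upper_half_plane \<subseteq> topspace M - S"
    have "g \<i> \<in> manifold_interior M" by (rule manifold_interior_half_chart[OF g(1)]) simp
    moreover have "g \<i> \<in> topspace M - S" using g(2) by force
    ultimately obtain e where "open_embedding UNIV M e" "range e \<subseteq> topspace M - S"
      by (rule interior_chart[OF _ N])
    then show thesis by (intro that[of e]) blast+
  qed
qed

lemma conj_loop_const:
  assumes "pathin X \<mu>"
  shows "path_homotopic X (conj_loop \<mu> (\<lambda>_. \<mu> 1)) (\<lambda>_. \<mu> 0)"
proof -
  have "path_homotopic X (conj_loop \<mu> (\<lambda>_. \<mu> 1)) (loop_join \<mu> (\<lambda>t. \<mu> (1 - t)))"
    unfolding conj_loop_def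
    by (rule path_homotopic_loop_join[OF path_homotopic_const_right[OF assms] path_homotopic_refl[OF pathin_reverse[OF assms]]]) simp
  also have "path_homotopic X (loop_join \<mu> (\<lambda>t. \<mu> (1 - t))) (\<lambda>_. \<mu> 0)" by (rule path_homotopic_reverse[OF assms])
  finally show ?thesis .
qed

lemma loop_join_map: "f (loop_join p q t) = loop_join (\<lambda>t. f (p t)) (\<lambda>t. f (q t)) t"
  by (simp add: loop_join_def)

theorem theorem2:
  fixes M :: "'a topology" and n :: nat and b :: "nat \<Rightarrow> 'a"
    and H :: "(real \<Rightarrow> 'a set) set set"
  assumes "n \<ge> 3"
    and "surface_with_boundary M" and "compact_space M" and "connected_space M"
    and "\<not> (M homeomorphic_space sphere2)"
    and "\<not> (M homeomorphic_space real_projective_plane)"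
    and "b \<in> topspace (ordered_config M n)"
    and "subgroup H (braid_group M n b)"
    and "pure_braid_subgroup M n b \<subset> H"
  shows "\<not> biorderable ((braid_group M n b)\<lparr>carrier := H\<rparr>)"
proof
  assume bi: "biorderable ((braid_group M n b)\<lparr>carrier := H\<rparr>)"
  let ?F = "ordered_config M n" and ?C = "unordered_config M n" and ?x = "b ` {..<n}"
  let ?q = "\<lambda>z. z ` {..<n}"
  let ?B = "braid_group M n b"
  let ?cl = "loop_class ?C ?x"
  have haus: "Hausdorff_space M" using assms(2) by (simp add: surface_with_boundary_def)
  have b: "b \<in> {..<n} \<rightarrow>\<^sub>E topspace M" "inj_on b {..<n}" using assms(7) by (simp_all add: topspace_ordered_config)
  have x: "?x \<in> topspace ?C" using assms(7) by (simp add: topspace_unordered_config)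
  interpret B: group ?B unfolding braid_group_def by (rule group_fundamental_group[OF x])
  interpret H: subgroup H ?B by (rule assms(8))
  define G where "G = ?B\<lparr>carrier := H\<rparr>"
  have G: "group G" unfolding G_def by (rule H.subgroup_is_group) (rule B.group_axioms)
  interpret G: group G by (rule G)
  have G_simps [simp]: "carrier G = H" "\<one>\<^bsub>G\<^esub> = \<one>\<^bsub>?B\<^esub>" "u \<otimes>\<^bsub>G\<^esub> w = u \<otimes>\<^bsub>?B\<^esub> w" for u w by (simp_all add: G_def)
  have mult: "?cl s \<otimes>\<^bsub>?B\<^esub> ?cl t = ?cl (loop_join s t)" if "loopin ?C ?x s" "loopin ?C ?x t" for s t
    unfolding braid_group_def by (rule fundamental_group_mult[OF that])
  have one: "\<one>\<^bsub>?B\<^esub> = ?cl (\<lambda>_. ?x)" by (simp add: braid_group_def fundamental_group_def)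
  have car: "?cl s \<in> carrier ?B" if "loopin ?C ?x s" for s
    unfolding braid_group_def by (rule loop_class_in_fundamental_group[OF that])
  have const: "loopin ?C ?x (\<lambda>_. ?x)" using x by (simp add: loopin_def)
  have qpath: "pathin ?C (\<lambda>t. ?q (g t))" if "pathin ?F g" for g
    using pathin_compose[OF that continuous_map_config_set] by (simp add: o_def)
  have pureH: "?cl (\<lambda>t. ?q (g t)) \<in> H" if "loopin ?F b g" for g
    using assms(9) that unfolding pure_braid_subgroup_def by auto
  obtain c0 where c0: "c0 \<in> H" "c0 \<notin> pure_braid_subgroup M n b" using assms(9) by blast
  then have "c0 \<in> carrier ?B" by simp
  then obtain \<eta> where \<eta>: "c0 = ?cl \<eta>" "loopin ?C ?x \<eta>" by (auto simp: braid_group_def fundamental_group_def)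
  have \<eta>p: "pathin ?C \<eta>" "\<eta> 0 = ?x" "\<eta> 1 = ?x" using \<eta>(2) by (auto simp: loopin_def)
  obtain g where g: "pathin ?F g" "\<And>t. t \<in> {0..1} \<Longrightarrow> ?q (g t) = \<eta> t" "g 0 = b"
    by (rule config_path_lift[OF haus \<eta>p(1) assms(7) \<eta>p(2)[symmetric]]) (rule that)
  have qg: "loopin ?C ?x (\<lambda>t. ?q (g t))" using qpath[OF g(1)] g(2)[of 1] g(3) \<eta>p(3) by (simp add: loopin_def)
  have c0g: "c0 = ?cl (\<lambda>t. ?q (g t))"
    unfolding \<eta>(1) loop_class_eq_iff[OF \<eta>(2) qg] by (rule path_homotopic_eq[OF \<eta>p(1)]) (rule g(2))
  have g1: "g 1 \<in> topspace ?F" using pathin_in_topspace[OF g(1), of 1] by simp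
  have g1b: "?q (g 1) = ?q b" using g(2)[of 1] \<eta>p(3) by simp
  \<comment> \<open>The labelled lift of \<open>c0\<close> ends at a rearrangement of
    \<open>b\<close>. This is the permutation to be realized by the rotation, extended by the
    identity beyond \<open>n\<close> to satisfy \<open>permutes\<close>.\<close>
  obtain \<sigma> where \<sigma>: "bij_betw \<sigma> {..<n} {..<n}" "g 1 = (\<lambda>i\<in>{..<n}. b (\<sigma> i))"
    by (rule same_config_relabel[OF g1 assms(7) g1b]) (rule that)
  define p where "p i = (if i < n then \<sigma> i else i)" for i
  have pb: "bij_betw p {..<n} {..<n}" using \<sigma>(1) bij_betw_cong[of "{..<n}" p \<sigma>] by (simp add: p_def)
  then have p: "p permutes {..<n}" by (rule bij_imp_permutes) (simp add: p_def)
  have g1p: "g 1 = (\<lambda>i\<in>{..<n}. b (p i))" unfolding \<sigma>(2) by (rule restrict_ext) (simp add: p_def)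
  have "\<exists>i<n. p i \<noteq> i"
  proof (rule ccontr)
    assume "\<not> (\<exists>i<n. p i \<noteq> i)"
    then have "g 1 = (\<lambda>i\<in>{..<n}. b i)" unfolding g1p by (intro restrict_ext) simp
    also have "\<dots> = b" using b(1) by (auto simp: PiE_def extensional_def)
    finally have "loopin ?F b g" using g(1,3) by (simp add: loopin_def)
    then show False using c0(2) unfolding c0g pure_braid_subgroup_def by auto
  qed
  then obtain i0 where i0: "i0 < n" "p i0 \<noteq> i0" by blast
  obtain d v and N r j l :: nat where R: "inj d" "\<And>i. d (p i) = cis (2 * pi * v i) * d i"
    "\<And>i k. v i = v k \<or> norm (d i) \<noteq> norm (d k)" "\<And>k. v k = v j \<or> norm (d k) \<ge> 3"
    "\<And>i. cis (2 * pi * (real N * v i)) = 1" "l < n" "j < n" "p l \<noteq> l" "l \<noteq> j" "l \<noteq> p j"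
    "d l = 1" "norm (d j - 1) \<le> 9/5" "\<And>k. k \<noteq> l \<Longrightarrow> norm (d k - 1) \<ge> norm (d j - 1)"
    "r > 0" "\<And>i. i \<in> {j, p j, l, p l} \<Longrightarrow> v i = 1 / r" "N > 0"
    by (rule rotating_configuration[OF p assms(1) i0]) (rule that)
  have "b 0 \<in> topspace M" by (rule PiE_mem[OF b(1)]) (use assms(1) in simp)
  then obtain e where e: "open_embedding UNIV M e" "range e \<inter> ?x = {}"
    by (rule chart_avoiding_finite[OF assms(2) _ finite_imageI[OF finite_lessThan]]) (rule that)
  interpret S: rotating_strands M n p e d v N r j l
    by (rule rotating_strands.intro[OF assms(2-4,1) p e(1) R(1-6,8-11,7,12-16)])
  let ?z = "S.spin 0 0"
  have z: "?z \<in> topspace ?F" by (rule S.spin_in_config) simp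
  have "?q b \<inter> ?q ?z = {}" using e(2) by (auto simp: S.spin_def)
  from config_path[OF assms(2,4,7) z this]
  obtain \<nu> where \<nu>: "pathin ?F \<nu>" "\<nu> 0 = b" "\<nu> 1 = ?z" unfolding path_component_of_def by blast
  define \<mu> where "\<mu> t = ?q (\<nu> t)" for t
  have \<mu>: "pathin ?C \<mu>" "\<mu> 0 = ?x" "\<mu> 1 = ?q ?z" using qpath[OF \<nu>(1)] \<nu>(2,3) by (simp_all add: \<mu>_def[abs_def])
  let ?L = "\<lambda>s. loopin ?C (?q ?z) s"
  have cj: "loopin ?C ?x (conj_loop \<mu> s)" if "?L s" for s
    using loopin_conj_loop[OF \<mu>(1), of s] that by (simp add: \<mu>)
  \<comment> \<open>Change of base point from the rotating configuration to \<open>b\<close>; by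
    \<open>K_mult\<close> and \<open>K_eq\<close> it is multiplicative and injective on loop
    classes.\<close>
  define K where "K s = ?cl (conj_loop \<mu> s)" for s
  have K_mult: "K s \<otimes>\<^bsub>?B\<^esub> K t = K (loop_join s t)" if st: "?L s" "?L t" for s t
  proof -
    have "path_homotopic ?C (loop_join (conj_loop \<mu> s) (conj_loop \<mu> t)) (conj_loop \<mu> (loop_join s t))"
      by (rule conj_loop_join[OF \<mu>(1)]) (use st in \<open>simp_all add: \<mu>(3)\<close>)
    then show ?thesis
      unfolding K_def mult[OF cj[OF st(1)] cj[OF st(2)]]
      using loop_class_eq_iff[OF loopin_loop_join[OF cj[OF st(1)] cj[OF st(2)]] cj[OF loopin_loop_join[OF st]]] by (rule iffD2[rotated])
  qed
  have K_eq: "K s = K t \<longleftrightarrow> path_homotopic ?C s t" if st: "?L s" "?L t" for s t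
  proof
    assume "K s = K t"
    then have "path_homotopic ?C (conj_loop \<mu> s) (conj_loop \<mu> t)"
      unfolding K_def loop_class_eq_iff[OF cj[OF st(1)] cj[OF st(2)]] .
    then show "path_homotopic ?C s t" by (rule conj_loop_inject[OF \<mu>(1), rotated 2]) (use st in \<open>simp_all add: \<mu>(3)\<close>)
  next
    assume "path_homotopic ?C s t"
    then have "path_homotopic ?C (conj_loop \<mu> s) (conj_loop \<mu> t)"
      by (rule path_homotopic_conj_loop[OF \<mu>(1)]) (use st in \<open>simp_all add: \<mu>(3) loopin_def\<close>)
    then show "K s = K t" unfolding K_def loop_class_eq_iff[OF cj[OF st(1)] cj[OF st(2)]] .
  qed
  have K_const: "K (\<lambda>_. ?q ?z) = \<one>\<^bsub>?B\<^esub>"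
  proof -
    have "?L (\<lambda>_. ?q ?z)" using z by (simp add: loopin_def topspace_unordered_config)
    moreover have "path_homotopic ?C (conj_loop \<mu> (\<lambda>_. ?q ?z)) (\<lambda>_. ?x)" using conj_loop_const[OF \<mu>(1)] by (simp add: \<mu>)
    ultimately show ?thesis unfolding K_def one using loop_class_eq_iff[OF cj const] by blast
  qed
  \<comment> \<open>A labelled lift of the conjugated rotation. The rotation permutes the labels by
    \<open>p\<close>, so the way back follows \<open>\<nu>\<close> with labels shifted by
    \<open>p\<close>; the lift ends at \<open>g 1\<close>, as does the lift of
    \<open>c0\<close>.\<close>
  define \<gamma> where "\<gamma> = loop_join (loop_join \<nu> (\<lambda>t. S.spin t 0)) (\<lambda>t. \<lambda>i\<in>{..<n}. \<nu> (1 - t) (p i))"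
  have spin1: "S.spin 1 0 = (\<lambda>i\<in>{..<n}. ?z (p i))"
  proof -
    have "S.spin 1 0 = (\<lambda>i\<in>{..<n}. S.spin 1 0 i)" unfolding S.spin_def by (rule ext) simp
    also have "\<dots> = (\<lambda>i\<in>{..<n}. ?z (p i))" by (rule restrict_ext) (use S.spin_shift[of _ 0] in simp)
    finally show ?thesis .
  qed
  have "pathin ?F (\<lambda>t. \<lambda>i\<in>{..<n}. \<nu> (1 - t) (p i))"
    using pathin_compose[OF pathin_reverse[OF \<nu>(1)] relabel_config(1)[OF pb]] by (simp add: o_def)
  then have \<gamma>: "pathin ?F \<gamma>"
    unfolding \<gamma>_def using S.pathin_spin(2)[of 1] \<nu> spin1 by (intro pathin_loop_join) simp_all
  have \<gamma>_ends: "\<gamma> 0 = b" "\<gamma> 1 = g 1" by (simp_all add: \<gamma>_def \<nu> g1p)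
  have q\<gamma>: "?q (\<gamma> t) = conj_loop \<mu> (S.rot 1) t" for t
    unfolding \<gamma>_def conj_loop_def loop_join_map[of ?q] relabel_config(2)[OF pb] \<mu>_def S.rot_def
    by (simp add: loop_join_map[of ?q, abs_def] loop_join_def)
  let ?X = "K (S.rot 1)" and ?a = "\<lambda>t. ?q (S.spin 0 t)" and ?a' = "\<lambda>t. ?q (S.spin 1 t)"
  have La: "?L ?a" "?L ?a'" using S.loopin_spin[of 0] S.loopin_spin[of 1] by simp_all
  \<comment> \<open>The rotation followed by the reverse of \<open>c0\<close> lifts to a closed path
    of labelled configurations, so it is pure and lies in \<open>H\<close>; multiplication by
    \<open>c0\<close> recovers the rotation.\<close>
  have X: "?X \<in> H"
  proof -
    let ?R = "\<lambda>t. ?q (g (1 - t))"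
    have R: "loopin ?C ?x ?R" using pathin_reverse[of ?C "\<lambda>t. ?q (g t)"] qg by (simp add: loopin_def)
    have "loopin ?F b (loop_join \<gamma> (\<lambda>t. g (1 - t)))"
      using \<gamma> \<gamma>_ends g by (auto simp: loopin_def intro!: pathin_loop_join pathin_reverse)
    from pureH[OF this] have h: "?X \<otimes>\<^bsub>?B\<^esub> ?cl ?R \<in> H"
      unfolding K_def mult[OF cj[OF S.loopin_rot] R] loop_join_map[of ?q] q\<gamma> .
    have "path_homotopic ?C (loop_join ?R (\<lambda>t. ?q (g t))) (\<lambda>_. ?x)"
      using path_homotopic_reverse'[OF qpath[OF g(1)]] g1b by simp
    then have "?cl ?R \<otimes>\<^bsub>?B\<^esub> c0 = \<one>\<^bsub>?B\<^esub>"
      unfolding c0g mult[OF R qg] one loop_class_eq_iff[OF loopin_loop_join[OF R qg] const] .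
    then have "(?X \<otimes>\<^bsub>?B\<^esub> ?cl ?R) \<otimes>\<^bsub>?B\<^esub> c0 = ?X"
      using car[OF cj[OF S.loopin_rot[of 1]]] car[OF R] c0(1) by (simp add: B.m_assoc K_def)
    then show ?thesis using H.m_closed[OF h c0(1)] by simp
  qed
  have Y: "K ?a \<in> H"
  proof -
    have "loopin ?F b (conj_loop \<nu> (S.spin 0))"
      using \<nu> S.pathin_spin(1)[of 0] loopin_conj_loop[OF \<nu>(1), of "S.spin 0"] by (simp add: loopin_def)
    from pureH[OF this] show ?thesis
      unfolding K_def conj_loop_def loop_join_map[of ?q] \<mu>_def .
  qed
  have pow: "?X [^]\<^bsub>G\<^esub> Suc k = K (S.rot (Suc k))" for k
  proof (induction k)
    case 0
    then show ?case using X by simp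
  next
    case (Suc k)
    have "?X [^]\<^bsub>G\<^esub> Suc (Suc k) = K (S.rot (Suc k)) \<otimes>\<^bsub>?B\<^esub> ?X"
      unfolding G.nat_pow_Suc[of ?X "Suc k"] Suc by simp
    also have "\<dots> = K (loop_join (S.rot (Suc k)) (S.rot 1))" by (rule K_mult[OF S.loopin_rot S.loopin_rot])
    also have "\<dots> = K (S.rot (Suc (Suc k)))"
      unfolding K_eq[OF loopin_loop_join[OF S.loopin_rot S.loopin_rot] S.loopin_rot] by (rule S.rot_join)
    finally show ?case .
  qed
  have pow': "?X [^]\<^bsub>G\<^esub> k = K (S.rot k)" if "k > 0" for k using pow[of "k - 1"] that by simp
  have square: "K ?a \<otimes>\<^bsub>?B\<^esub> K (S.rot k) = K (S.rot k) \<otimes>\<^bsub>?B\<^esub> K (\<lambda>t. ?q (S.spin (real k) t))" for k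
    unfolding K_mult[OF La(1) S.loopin_rot] K_mult[OF S.loopin_rot S.loopin_spin]
      K_eq[OF loopin_loop_join[OF La(1) S.loopin_rot] loopin_loop_join[OF S.loopin_rot S.loopin_spin]]
    by (rule S.spin_square)
  have "?X [^]\<^bsub>G\<^esub> N \<otimes>\<^bsub>G\<^esub> K ?a = K ?a \<otimes>\<^bsub>G\<^esub> ?X [^]\<^bsub>G\<^esub> N"
    unfolding pow'[OF R(16)] G_simps using square[of N] by (simp add: S.spin_N)
  from biorderable_root_commutes[OF G bi[folded G_def] _ _ R(16) this] X Y
  have "?X \<otimes>\<^bsub>?B\<^esub> K ?a = K ?a \<otimes>\<^bsub>?B\<^esub> ?X" by simp
  \<comment> \<open>The commutation is compared with the square relation for \<open>k = 1\<close>;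
    cancelling the rotation leaves \<open>y\<close> equal to its conjugate.\<close>
  then have "K (loop_join (S.rot 1) ?a) = K (loop_join (S.rot 1) ?a')"
    using square[of 1] K_mult[OF S.loopin_rot La(1), of 1] K_mult[OF S.loopin_rot La(2), of 1] by simp
  then have "path_homotopic ?C (loop_join (S.rot 1) ?a) (loop_join (S.rot 1) ?a')"
    unfolding K_eq[OF loopin_loop_join[OF S.loopin_rot La(1)] loopin_loop_join[OF S.loopin_rot La(2)]] .
  then have "path_homotopic ?C ?a ?a'" by (rule path_homotopic_left_cancel[OF S.loopin_rot La])
  then have "path_homotopic ?C ?a (\<lambda>t. ?q (S.moved_strand t))" unfolding S.spin_1_set .
  \<comment> \<open>The homotopy so far is one of unlabelled configurations. It lifts because both
    labelled paths start at the same tuple, and this is the purpose of the relabelling in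
    \<open>moved_strand\<close>.\<close>
  moreover have "S.spin 0 0 = S.moved_strand 0"
    unfolding S.spin_def S.moved_strand_def by (rule restrict_ext) (simp add: S.d_p)
  ultimately have "path_homotopic ?F (S.spin 0) S.moved_strand"
    by (intro config_homotopy_lift[OF haus S.pathin_spin(1) S.pathin_moved_strand])
  from path_homotopic_compose[OF S.double_rotation[OF this] continuous_map_config_set]
  have "path_homotopic ?C (S.rot (2 * r)) (\<lambda>_. ?q ?z)" by (simp add: S.rot_def[abs_def])
  moreover have "?L (\<lambda>_. ?q ?z)" using z by (simp add: loopin_def topspace_unordered_config)
  ultimately have "K (S.rot (2 * r)) = \<one>\<^bsub>?B\<^esub>"
    using K_eq[OF S.loopin_rot, of "\<lambda>_. ?q ?z" "2 * r"] unfolding K_const by (simp only:)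
  then have "?X [^]\<^bsub>G\<^esub> (2 * r) = \<one>\<^bsub>G\<^esub>" using R(14) by (subst pow') simp_all
  from biorderable_torsion_free[OF G bi[folded G_def] _ _ this] X R(14) have "?X = \<one>\<^bsub>?B\<^esub>" by simp
  then have "path_homotopic ?C (conj_loop \<mu> (S.rot 1)) (\<lambda>_. ?x)"
    unfolding K_def one loop_class_eq_iff[OF cj[OF S.loopin_rot] const] .
  \<comment> \<open>Triviality of the rotation lifts to a homotopy with fixed ends from
    \<open>\<gamma>\<close> to the constant path, so \<open>b\<close> permuted by \<open>p\<close>
    would be \<open>b\<close> itself.\<close>
  then have "path_homotopic ?C (\<lambda>t. ?q (\<gamma> t)) (\<lambda>t. ?q b)" unfolding q\<gamma> .
  then have "path_homotopic ?F \<gamma> (\<lambda>_. b)"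
    by (intro config_homotopy_lift[OF haus \<gamma>]) (simp_all add: assms(7) \<gamma>_ends)
  from path_homotopicD(4)[OF this] have "b = (\<lambda>i\<in>{..<n}. b (p i))" by (simp add: \<gamma>_ends g1p)
  then have "b i0 = b (p i0)" using i0(1) by (metis lessThan_iff restrict_apply')
  moreover have "p i0 < n" using i0(1) by simp
  ultimately show False using b(2) i0 by (auto simp: inj_on_def)
qed

end
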